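(* Let $\mathcal{C}$ be an abelian category, let $n\ge 2$, and let $(\mathcal{A},\mathcal{B})$ be a left $n$-cotorsion pair in $\mathcal{C}$ such that: (i) $\mathcal{B}$ is closed under finite coproducts in $\mathcal{C}$, and (ii) $\mathrm{Ext}^1_{\mathcal{C}}(\mathcal{B},\mathcal{B}^\wedge_{k-1})=0$ for any $1\le k\le\max(1,n-1)$. Then the class $\mathrm{Prec}^k(\mathcal{A},\mathcal{B})$ is closed under extensions for any $1\le k\le\max(1,n-1)$.
   Context: $\mathrm{Ext}^i_{\mathcal{C}}$ denotes Yoneda Ext; $\mathrm{Ext}^i_{\mathcal{C}}(\mathcal{A},\mathcal{B})=0$ means $\mathrm{Ext}^i_{\mathcal{C}}(A,B)=0$ for all $A\in\mathcal{A}$, $B\in\mathcal{B}$. $\mathcal{B}^\wedge_m$ is the class of objects $C$ admitting an exact sequence $0\to B_m\to\cdots\to B_0\to C\to 0$ of length at most $m$ with all terms $B_k\in\mathcal{B}$ (i.e. $\mathcal{B}$-resolution dimension $\le m$). Left $n$-cotorsion pair $(\mathcal{A},\mathcal{B})$: (1) $\mathcal{A}$ is closed under direct summands; (2) $\mathrm{Ext}^i_{\mathcal{C}}(\mathcal{A},\mathcal{B})=0$ for $1\le i\le n$; (3) for every $C\in\mathcal{C}$ there is a short exact sequence $0\to K\to A\to C\to 0$ with $A\in\mathcal{A}$ and $K\in\mathcal{B}^\wedge_{n-1}$. An $\mathcal{A}$-precover of $C$ is a morphism $f:A\to C$ with $A\in\mathcal{A}$ through which every morphism $A'\to C$ with $A'\in\mathcal{A}$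 factors. For a positive integer $k$, it is a special $(\mathcal{A},k,\mathcal{B})$-precover if moreover $f$ is epic and $\mathrm{Ker}(f)\in\mathcal{B}^\wedge_{k-1}$. $\mathrm{Prec}^k(\mathcal{A},\mathcal{B})$ is the class of all objects $C\in\mathcal{C}$ admitting a special $(\mathcal{A},k,\mathcal{B})$-precover. *)

theory Defs
  imports "HOL-Algebra.Group"
begin

section \<open>Abelian categories\<close>

text \<open>Objects and arrows are carrier sets inside two arbitrary types, so nothing is assumed about
  the size of the category. The fields \<open>Zero\<close> and \<open>Plus\<close> are the abelian group structure on the
  hom-sets; \<open>g \<cdot> f\<close> means first \<open>f\<close>, then \<open>g\<close>.\<close>

record ('o, 'm) cat =
  Obj :: "'o set"
  Arr :: "'m set"
  Dom :: "'m \<Rightarrow> 'o"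
  Cod :: "'m \<Rightarrow> 'o"
  Ident :: "'o \<Rightarrow> 'm"
  Comp :: "'m \<Rightarrow> 'm \<Rightarrow> 'm"  (infixl "\<cdot>\<index>" 70)
  Zero :: "'o \<Rightarrow> 'o \<Rightarrow> 'm"
  Plus :: "'m \<Rightarrow> 'm \<Rightarrow> 'm"

definition Hom :: "('o, 'm, 'r) cat_scheme \<Rightarrow> 'o \<Rightarrow> 'o \<Rightarrow> 'm set" where
  "Hom C X Y = {f \<in> Arr C. Dom C f = X \<and> Cod C f = Y}"

definition mono_arr :: "('o, 'm, 'r) cat_scheme \<Rightarrow> 'm \<Rightarrow> bool" where
  "mono_arr C f \<longleftrightarrow> f \<in> Arr C \<and>
    (\<forall>W. \<forall>g \<in> Hom C W (Dom C f). \<forall>h \<in> Hom C W (Dom C f).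
      f \<cdot>\<^bsub>C\<^esub> g = f \<cdot>\<^bsub>C\<^esub> h \<longrightarrow> g = h)"

definition epi_arr :: "('o, 'm, 'r) cat_scheme \<Rightarrow> 'm \<Rightarrow> bool" where
  "epi_arr C f \<longleftrightarrow> f \<in> Arr C \<and>
    (\<forall>W. \<forall>g \<in> Hom C (Cod C f) W. \<forall>h \<in> Hom C (Cod C f) W.
      g \<cdot>\<^bsub>C\<^esub> f = h \<cdot>\<^bsub>C\<^esub> f \<longrightarrow> g = h)"

definition zero_obj :: "('o, 'm, 'r) cat_scheme \<Rightarrow> 'o \<Rightarrow> bool" where
  "zero_obj C Z \<longleftrightarrow> Z \<in> Obj C \<and>
    (\<forall>X \<in> Obj C. (\<exists>!f. f \<in> Hom C X Z) \<and> (\<exists>!f. f \<in> Hom C Z X))"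

definition is_kernel :: "('o, 'm, 'r) cat_scheme \<Rightarrow> 'm \<Rightarrow> 'm \<Rightarrow> bool" where
  "is_kernel C k f \<longleftrightarrow> f \<in> Arr C \<and> k \<in> Arr C \<and> Cod C k = Dom C f \<and>
    f \<cdot>\<^bsub>C\<^esub> k = Zero C (Dom C k) (Cod C f) \<and>
    (\<forall>W. \<forall>t \<in> Hom C W (Dom C f). f \<cdot>\<^bsub>C\<^esub> t = Zero C W (Cod C f) \<longrightarrow>
      (\<exists>!u. u \<in> Hom C W (Dom C k) \<and> k \<cdot>\<^bsub>C\<^esub> u = t))"

definition is_cokernel :: "('o, 'm, 'r) cat_scheme \<Rightarrow> 'm \<Rightarrow> 'm \<Rightarrow> bool" where
  "is_cokernel C q f \<longleftrightarrow> f \<in> Arr C \<and> q \<in> Arr C \<and> Dom C q = Cod C f \<and>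
    q \<cdot>\<^bsub>C\<^esub> f = Zero C (Dom C f) (Cod C q) \<and>
    (\<forall>W. \<forall>t \<in> Hom C (Cod C f) W. t \<cdot>\<^bsub>C\<^esub> f = Zero C (Dom C f) W \<longrightarrow>
      (\<exists>!u. u \<in> Hom C (Cod C q) W \<and> u \<cdot>\<^bsub>C\<^esub> q = t))"

text \<open>\<open>P\<close> is a coproduct of the domains of the arrows in the finite list \<open>js\<close>, with these arrows
  as the injections. For the empty list this says that \<open>P\<close> is initial.\<close>

definition is_coproduct :: "('o, 'm, 'r) cat_scheme \<Rightarrow> 'm list \<Rightarrow> 'o \<Rightarrow> bool" where
  "is_coproduct C js P \<longleftrightarrow> P \<in> Obj C \<and> (\<forall>j \<in> set js. j \<in> Arr C \<and> Cod C j = P) \<and>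
    (\<forall>T \<in> Obj C. \<forall>fs. length fs = length js \<and>
        (\<forall>i < length js. fs ! i \<in> Hom C (Dom C (js ! i)) T) \<longrightarrow>
      (\<exists>!h. h \<in> Hom C P T \<and> (\<forall>i < length js. h \<cdot>\<^bsub>C\<^esub> (js ! i) = fs ! i)))"

locale category =
  fixes C :: "('o, 'm, 'r) cat_scheme" (structure)
  assumes Dom_Obj: "f \<in> Arr C \<Longrightarrow> Dom C f \<in> Obj C"
    and Cod_Obj: "f \<in> Arr C \<Longrightarrow> Cod C f \<in> Obj C"
    and Ident_Hom: "X \<in> Obj C \<Longrightarrow> Ident C X \<in> Hom C X X"
    and Comp_Hom: "\<lbrakk>f \<in> Hom C X Y; g \<in> Hom C Y Z\<rbrakk> \<Longrightarrow> g \<cdot> f \<in> Hom C X Z"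
    and Comp_assoc: "\<lbrakk>f \<in> Hom C W X; g \<in> Hom C X Y; h \<in> Hom C Y Z\<rbrakk> \<Longrightarrow>
      (h \<cdot> g) \<cdot> f = h \<cdot> (g \<cdot> f)"
    and Comp_Ident: "f \<in> Hom C X Y \<Longrightarrow> f \<cdot> Ident C X = f"
    and Ident_Comp: "f \<in> Hom C X Y \<Longrightarrow> Ident C Y \<cdot> f = f"

locale preadditive_category = category +
  assumes Hom_group: "\<lbrakk>X \<in> Obj C; Y \<in> Obj C\<rbrakk> \<Longrightarrow>
      comm_group \<lparr>carrier = Hom C X Y, monoid.mult = Plus C, one = Zero C X Y\<rparr>"
    and Comp_Plus: "\<lbrakk>f \<in> Hom C X Y; g \<in> Hom C X Y; h \<in> Hom C Y Z\<rbrakk> \<Longrightarrow>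
      h \<cdot> Plus C f g = Plus C (h \<cdot> f) (h \<cdot> g)"
    and Plus_Comp: "\<lbrakk>f \<in> Hom C X Y; g \<in> Hom C Y Z; h \<in> Hom C Y Z\<rbrakk> \<Longrightarrow>
      Plus C g h \<cdot> f = Plus C (g \<cdot> f) (h \<cdot> f)"

locale abelian_category = preadditive_category +
  assumes ex_zero_obj: "\<exists>Z. zero_obj C Z"
    and ex_coproduct: "\<lbrakk>X \<in> Obj C; Y \<in> Obj C\<rbrakk> \<Longrightarrow>
      \<exists>P i j. Dom C i = X \<and> Dom C j = Y \<and> is_coproduct C [i, j] P"
    and ex_kernel: "f \<in> Arr C \<Longrightarrow> \<exists>k. is_kernel C k f"
    and ex_cokernel: "f \<in> Arr C \<Longrightarrow> \<exists>q. is_cokernel C q f"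
    and mono_normal: "mono_arr C f \<Longrightarrow> \<exists>g. is_kernel C f g"
    and epi_normal: "epi_arr C f \<Longrightarrow> \<exists>g. is_cokernel C f g"


section \<open>Exact sequences\<close>

definition is_image :: "('o, 'm, 'r) cat_scheme \<Rightarrow> 'm \<Rightarrow> 'm \<Rightarrow> bool" where
  "is_image C m f \<longleftrightarrow> (\<exists>q. is_cokernel C q f \<and> is_kernel C m q)"

definition exact_at :: "('o, 'm, 'r) cat_scheme \<Rightarrow> 'm \<Rightarrow> 'm \<Rightarrow> bool" where
  "exact_at C f g \<longleftrightarrow> (\<exists>m. is_image C m f \<and> is_kernel C m g)"

definition exact_seq :: "('o, 'm, 'r) cat_scheme \<Rightarrow> 'm list \<Rightarrow> bool" where
  "exact_seq C fs \<longleftrightarrow> (\<forall>i. Suc i < length fs \<longrightarrow> exact_at C (fs ! i) (fs ! Suc i))"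

text \<open>The arrows \<open>fs\<close>, listed from left to right, form an exact sequence once it is
  prolonged by \<open>0\<close> at both ends.\<close>

definition exact_with_zeros :: "('o, 'm, 'r) cat_scheme \<Rightarrow> 'm list \<Rightarrow> bool" where
  "exact_with_zeros C fs \<longleftrightarrow> fs \<noteq> [] \<and> (\<exists>Z Z'. zero_obj C Z \<and> zero_obj C Z' \<and>
    exact_seq C ([Zero C Z (Dom C (hd fs))] @ fs @ [Zero C (Cod C (last fs)) Z']))"

definition short_exact :: "('o, 'm, 'r) cat_scheme \<Rightarrow> 'm \<Rightarrow> 'm \<Rightarrow> bool" where
  "short_exact C f g \<longleftrightarrow> exact_with_zeros C [f, g]"


section \<open>Yoneda Ext\<close>

text \<open>For \<open>k \<ge> 1\<close>, a \<open>k\<close>-extension of \<open>A\<close> by \<open>B\<close> is an exact sequence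
  \<open>0 \<rightarrow> B \<rightarrow> E\<^sub>k \<rightarrow> \<dots> \<rightarrow> E\<^sub>1 \<rightarrow> A \<rightarrow> 0\<close>, given by its \<open>k + 1\<close> inner arrows.\<close>

definition extensions :: "('o, 'm, 'r) cat_scheme \<Rightarrow> nat \<Rightarrow> 'o \<Rightarrow> 'o \<Rightarrow> 'm list set" where
  "extensions C k A B = {fs. length fs = Suc k \<and> exact_with_zeros C fs \<and>
    Dom C (hd fs) = B \<and> Cod C (last fs) = A}"

text \<open>Morphisms of \<open>k\<close>-extensions that are the identity on both ends; \<open>hs\<close> lists the vertical
  arrows, including the two identities.\<close>

definition extension_morphism ::
    "('o, 'm, 'r) cat_scheme \<Rightarrow> nat \<Rightarrow> 'o \<Rightarrow> 'o \<Rightarrow> ('m list \<times> 'm list) set" where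
  "extension_morphism C k A B = {(fs, gs). fs \<in> extensions C k A B \<and> gs \<in> extensions C k A B \<and>
    (\<exists>hs. length hs = k + 2 \<and> hs ! 0 = Ident C B \<and> hs ! Suc k = Ident C A \<and>
      (\<forall>i \<le> k. hs ! i \<in> Hom C (Dom C (fs ! i)) (Dom C (gs ! i))) \<and>
      (\<forall>i \<le> k. hs ! Suc i \<cdot>\<^bsub>C\<^esub> fs ! i = gs ! i \<cdot>\<^bsub>C\<^esub> hs ! i))}"

text \<open>The Yoneda equivalence relation is generated by the existence of such a morphism.\<close>

definition yoneda_Ext :: "('o, 'm, 'r) cat_scheme \<Rightarrow> nat \<Rightarrow> 'o \<Rightarrow> 'o \<Rightarrow> 'm list set set" where
  "yoneda_Ext C k A B = extensions C k A B //
    (extension_morphism C k A B \<union> (extension_morphism C k A B)\<inverse>)\<^sup>*"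

text \<open>Only the vanishing of Ext is needed, and a group is zero iff its underlying set has exactly
  one element; hence the Baer sum is not defined.\<close>

definition Ext_vanishes ::
    "('o, 'm, 'r) cat_scheme \<Rightarrow> nat \<Rightarrow> 'o set \<Rightarrow> 'o set \<Rightarrow> bool" where
  "Ext_vanishes C k \<A> \<B> \<longleftrightarrow> (\<forall>A \<in> \<A>. \<forall>B \<in> \<B>. is_singleton (yoneda_Ext C k A B))"


section \<open>Cotorsion pairs and precovers\<close>

definition closed_direct_summands :: "('o, 'm, 'r) cat_scheme \<Rightarrow> 'o set \<Rightarrow> bool" where
  "closed_direct_summands C \<A> \<longleftrightarrow>
    (\<forall>i j P. is_coproduct C [i, j] P \<and> P \<in> \<A> \<longrightarrow> Dom C i \<in> \<A> \<and> Dom C j \<in> \<A>)"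

definition closed_finite_coproducts :: "('o, 'm, 'r) cat_scheme \<Rightarrow> 'o set \<Rightarrow> bool" where
  "closed_finite_coproducts C \<B> \<longleftrightarrow>
    (\<forall>js P. is_coproduct C js P \<and> (\<forall>j \<in> set js. Dom C j \<in> \<B>) \<longrightarrow> P \<in> \<B>)"

definition closed_extensions :: "('o, 'm, 'r) cat_scheme \<Rightarrow> 'o set \<Rightarrow> bool" where
  "closed_extensions C \<X> \<longleftrightarrow>
    (\<forall>f g. short_exact C f g \<and> Dom C f \<in> \<X> \<and> Cod C g \<in> \<X> \<longrightarrow> Cod C f \<in> \<X>)"

text \<open>The class of objects of \<open>\<B>\<close>-resolution dimension at most \<open>m\<close>: the arrows of a resolution
  \<open>0 \<rightarrow> B\<^sub>j \<rightarrow> \<dots> \<rightarrow> B\<^sub>0 \<rightarrow> X \<rightarrow> 0\<close> with \<open>j \<le> m\<close> form a list of length \<open>j + 1\<close> whose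
  domains are \<open>B\<^sub>j, \<dots>, B\<^sub>0\<close>.\<close>

definition resolved :: "('o, 'm, 'r) cat_scheme \<Rightarrow> 'o set \<Rightarrow> nat \<Rightarrow> 'o set" where
  "resolved C \<B> m = {X \<in> Obj C. \<exists>j \<le> m. \<exists>fs. length fs = Suc j \<and> exact_with_zeros C fs \<and>
    Cod C (last fs) = X \<and> (\<forall>f \<in> set fs. Dom C f \<in> \<B>)}"

definition left_cotorsion_pair ::
    "('o, 'm, 'r) cat_scheme \<Rightarrow> nat \<Rightarrow> 'o set \<Rightarrow> 'o set \<Rightarrow> bool" where
  "left_cotorsion_pair C n \<A> \<B> \<longleftrightarrow> \<A> \<subseteq> Obj C \<and> \<B> \<subseteq> Obj C \<and>
    closed_direct_summands C \<A> \<and>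
    (\<forall>i. 1 \<le> i \<and> i \<le> n \<longrightarrow> Ext_vanishes C i \<A> \<B>) \<and>
    (\<forall>X \<in> Obj C. \<exists>f g. short_exact C f g \<and> Cod C g = X \<and>
      Dom C g \<in> \<A> \<and> Dom C f \<in> resolved C \<B> (n - 1))"

definition precover :: "('o, 'm, 'r) cat_scheme \<Rightarrow> 'o set \<Rightarrow> 'o \<Rightarrow> 'm \<Rightarrow> bool" where
  "precover C \<A> X f \<longleftrightarrow> f \<in> Arr C \<and> Cod C f = X \<and> Dom C f \<in> \<A> \<and>
    (\<forall>A' \<in> \<A>. \<forall>g \<in> Hom C A' X. \<exists>h \<in> Hom C A' (Dom C f). f \<cdot>\<^bsub>C\<^esub> h = g)"

text \<open>Used only for \<open>k \<ge> 1\<close>, where \<open>k - 1\<close> is not truncated.\<close>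

definition special_precover ::
    "('o, 'm, 'r) cat_scheme \<Rightarrow> 'o set \<Rightarrow> nat \<Rightarrow> 'o set \<Rightarrow> 'o \<Rightarrow> 'm \<Rightarrow> bool" where
  "special_precover C \<A> k \<B> X f \<longleftrightarrow> precover C \<A> X f \<and> epi_arr C f \<and>
    (\<exists>\<kappa>. is_kernel C \<kappa> f \<and> Dom C \<kappa> \<in> resolved C \<B> (k - 1))"

definition Prec :: "('o, 'm, 'r) cat_scheme \<Rightarrow> nat \<Rightarrow> 'o set \<Rightarrow> 'o set \<Rightarrow> 'o set" where
  "Prec C k \<A> \<B> = {X \<in> Obj C. \<exists>f. special_precover C \<A> k \<B> X f}"

end

theory Submission
  imports Defs
begin

text \<open>Given \<open>0 \<rightarrow> X \<rightarrow> Y \<rightarrow> Z \<rightarrow> 0\<close> and special precovers \<open>A \<rightarrow> X\<close>, \<open>A' \<rightarrow> Z\<close> with kernels \<open>K\<close>, \<open>K'\<close>, the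
  vanishing of \<open>Ext\<^sup>2(A', K)\<close> yields an extension \<open>E\<close> of \<open>A'\<close> by \<open>A\<close> mapping onto \<open>Y\<close>. Since
  \<open>Ext\<^sup>1\<close> from \<open>A\<close> and \<open>A'\<close> vanishes on \<open>\<B>\<close>-resolution dimension at most \<open>n - 1\<close>, the special precover of \<open>E\<close>
  splits and \<open>E\<close> is in the first class. The kernel of \<open>E \<rightarrow> Y\<close> is an extension of \<open>K'\<close> by \<open>K\<close>, so the
  horseshoe construction, available because \<open>Ext\<^sup>1\<close> vanishes from \<open>\<B>\<close> to the resolution classes,
  bounds its resolution dimension.

  No long exact sequence of Yoneda Ext is used: a vanishing extension class is only ever exploited
  through the predicate \<open>erased\<close>, which says that the class dies under successive epimorphic
  covers. This predicate passes along morphisms of extensions in both directions, hence depends only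
  on the Yoneda class, and dimension shifting for it is a matter of pushing out short exact
  sequences.\<close>

text \<open>No group structure on Yoneda Ext is at hand, and no projectives or injectives are
  assumed: vanishing only says that any two extensions are joined by a zigzag of morphisms. It can
  be exploited through a property that is invariant along every edge of such a zigzag and holds for
  one explicit extension, the trivial one; then it holds for all. The bounds come from counting
  degrees. In degree i, with coefficients of resolution dimension m, vanishing on \<B> is consumed
  in the degrees from i to i + m. The extension E needs degree 2 and dimension k - 1, hence k + 1
  \<le> n. Placing E in the first class needs degree 1 and dimension n - 1, which is the whole range
  up to n. Diagram chases use generalized elements: an arrow from W to Y plays the role of an
  element of Y, and lifts along an epimorphism exist after W is replaced by an epimorphic cover. The
  price is a descent along that cover when the result is wanted on W itself.\<close>

context category
begin

section \<open>Calculus of arrows, monomorphisms and epimorphisms\<close>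

lemma in_Hom [simp]: "f \<in> Hom C X Y \<longleftrightarrow> f \<in> Arr C \<and> Dom C f = X \<and> Cod C f = Y"
  by (simp add: Hom_def)

lemma Comp_arr [simp]:
  assumes "f \<in> Arr C" "g \<in> Arr C" "Cod C f = Dom C g"
  shows "g \<cdot> f \<in> Arr C" "Dom C (g \<cdot> f) = Dom C f" "Cod C (g \<cdot> f) = Cod C g"
  using Comp_Hom[of f "Dom C f" "Cod C f" g "Cod C g"] assms by auto

lemma Comp_assoc' [simp]:
  assumes "f \<in> Arr C" "g \<in> Arr C" "h \<in> Arr C" "Cod C f = Dom C g" "Cod C g = Dom C h"
  shows "(h \<cdot> g) \<cdot> f = h \<cdot> (g \<cdot> f)"
  using Comp_assoc[of f "Dom C f" "Cod C f" g "Cod C g" h "Cod C h"] assms by auto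

lemma Dom_in_Obj [simp]: "f \<in> Arr C \<Longrightarrow> Dom C f \<in> Obj C"
  and Cod_in_Obj [simp]: "f \<in> Arr C \<Longrightarrow> Cod C f \<in> Obj C"
  by (rule Dom_Obj Cod_Obj, assumption)+

lemma Ident_arr [simp]:
  assumes "X \<in> Obj C"
  shows "Ident C X \<in> Arr C" "Dom C (Ident C X) = X" "Cod C (Ident C X) = X"
  using Ident_Hom[OF assms] by auto

lemma Comp_Ident' [simp]: "\<lbrakk>f \<in> Arr C; Dom C f = X\<rbrakk> \<Longrightarrow> f \<cdot> Ident C X = f"
  using Comp_Ident[of f X "Cod C f"] by simp

lemma Ident_Comp' [simp]: "\<lbrakk>f \<in> Arr C; Cod C f = X\<rbrakk> \<Longrightarrow> Ident C X \<cdot> f = f"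
  using Ident_Comp[of f "Dom C f" X] by simp

lemma precomp: "f = g \<Longrightarrow> f \<cdot> h = g \<cdot> h"
  and postcomp: "f = g \<Longrightarrow> h \<cdot> f = h \<cdot> g"
  by simp_all

lemma mono_arrD: "mono_arr C f \<Longrightarrow> f \<in> Arr C"
  and epi_arrD: "epi_arr C f \<Longrightarrow> f \<in> Arr C"
  by (simp_all add: mono_arr_def epi_arr_def)

lemma mono_cancel:
  assumes "mono_arr C f" "f \<cdot> g = f \<cdot> h" "g \<in> Arr C" "h \<in> Arr C"
    "Dom C g = Dom C h" "Cod C g = Dom C f" "Cod C h = Dom C f"
  shows "g = h"
  using assms unfolding mono_arr_def by simp

lemma epi_cancel:
  assumes "epi_arr C f" "g \<cdot> f = h \<cdot> f" "g \<in> Arr C" "h \<in> Arr C"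
    "Cod C g = Cod C h" "Dom C g = Cod C f" "Dom C h = Cod C f"
  shows "g = h"
  using assms unfolding epi_arr_def by simp

lemma epi_Ident: "X \<in> Obj C \<Longrightarrow> epi_arr C (Ident C X)"
  and mono_Ident: "X \<in> Obj C \<Longrightarrow> mono_arr C (Ident C X)"
  by (auto simp: epi_arr_def mono_arr_def)

lemma epi_Comp:
  assumes "epi_arr C f" "epi_arr C g" "Cod C f = Dom C g"
  shows "epi_arr C (g \<cdot> f)"
proof -
  note [simp] = epi_arrD[OF assms(1)] epi_arrD[OF assms(2)]
  have "t = s" if "t \<in> Arr C" "s \<in> Arr C" "Dom C t = Cod C g" "Dom C s = Cod C g"
    "Cod C t = Cod C s" "t \<cdot> (g \<cdot> f) = s \<cdot> (g \<cdot> f)" for s t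
  proof -
    have "(t \<cdot> g) \<cdot> f = (s \<cdot> g) \<cdot> f" using that assms(3) by simp
    then have "t \<cdot> g = s \<cdot> g" by (rule epi_cancel[OF assms(1)]) (use that assms(3) in simp_all)
    then show ?thesis by (rule epi_cancel[OF assms(2)]) (use that assms(3) in simp_all)
  qed
  then show ?thesis using assms(3) unfolding epi_arr_def by auto
qed

lemma mono_Comp:
  assumes "mono_arr C f" "mono_arr C g" "Cod C f = Dom C g"
  shows "mono_arr C (g \<cdot> f)"
proof -
  note [simp] = mono_arrD[OF assms(1)] mono_arrD[OF assms(2)]
  have "t = s" if "t \<in> Arr C" "s \<in> Arr C" "Cod C t = Dom C f" "Cod C s = Dom C f"
    "Dom C t = Dom C s" "g \<cdot> (f \<cdot> t) = g \<cdot> (f \<cdot> s)" for s t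
  proof -
    have "f \<cdot> t = f \<cdot> s" by (rule mono_cancel[OF assms(2)]) (use that assms(3) in simp_all)
    then show ?thesis by (rule mono_cancel[OF assms(1)]) (use that assms(3) in simp_all)
  qed
  then show ?thesis using assms(3) unfolding mono_arr_def by auto
qed

lemma mono_Comp_right:
  assumes "mono_arr C (g \<cdot> f)" "f \<in> Arr C" "g \<in> Arr C" "Cod C f = Dom C g"
  shows "mono_arr C f"
  unfolding mono_arr_def
proof (intro conjI allI ballI impI)
  fix W s t assume st: "s \<in> Hom C W (Dom C f)" "t \<in> Hom C W (Dom C f)" "f \<cdot> s = f \<cdot> t"
  then have "(g \<cdot> f) \<cdot> s = (g \<cdot> f) \<cdot> t" using assms by simp
  then show "s = t" by (rule mono_cancel[OF assms(1)]) (use st(1,2) assms in simp_all)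
qed (use assms in simp)

lemma epi_Comp_left:
  assumes "epi_arr C (g \<cdot> f)" "f \<in> Arr C" "g \<in> Arr C" "Cod C f = Dom C g"
  shows "epi_arr C g"
  unfolding epi_arr_def
proof (intro conjI allI ballI impI)
  fix W s t assume st: "s \<in> Hom C (Cod C g) W" "t \<in> Hom C (Cod C g) W" "s \<cdot> g = t \<cdot> g"
  have "(s \<cdot> g) \<cdot> f = (t \<cdot> g) \<cdot> f" by (simp only: st)
  then have "s \<cdot> (g \<cdot> f) = t \<cdot> (g \<cdot> f)" using assms st(1,2) by simp
  then show "s = t" by (rule epi_cancel[OF assms(1)]) (use st(1,2) assms in simp_all)
qed (use assms in simp)

end

section \<open>Arithmetic in the hom-groups\<close>

context preadditive_category
begin

text \<open>The category record carries sums but no negatives; packaging a hom-set as a library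
  group lets the group inverse supply them.\<close>

definition Hom_gr where
  "Hom_gr X Y = \<lparr>carrier = Hom C X Y, monoid.mult = Plus C, one = Zero C X Y\<rparr>"

definition Neg where
  "Neg f = inv\<^bsub>Hom_gr (Dom C f) (Cod C f)\<^esub> f"

definition Minus  (infixl "\<ominus>" 65) where
  "f \<ominus> g = Plus C f (Neg g)"

lemma Hom_gr_simps [simp]:
  "carrier (Hom_gr X Y) = Hom C X Y" "monoid.mult (Hom_gr X Y) = Plus C"
  "one (Hom_gr X Y) = Zero C X Y"
  by (simp_all add: Hom_gr_def)

lemma Hom_gr_group: "\<lbrakk>X \<in> Obj C; Y \<in> Obj C\<rbrakk> \<Longrightarrow> comm_group (Hom_gr X Y)"
  unfolding Hom_gr_def by (rule Hom_group)

lemma Zero_arr [simp]: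
  assumes "X \<in> Obj C" "Y \<in> Obj C"
  shows "Zero C X Y \<in> Arr C" "Dom C (Zero C X Y) = X" "Cod C (Zero C X Y) = Y"
proof -
  interpret G: comm_group "Hom_gr X Y" by (rule Hom_gr_group[OF assms])
  show "Zero C X Y \<in> Arr C" "Dom C (Zero C X Y) = X" "Cod C (Zero C X Y) = Y"
    using G.one_closed by simp_all
qed

lemma Plus_arr [simp]:
  assumes "f \<in> Arr C" "g \<in> Arr C" "Dom C f = Dom C g" "Cod C f = Cod C g"
  shows "Plus C f g \<in> Arr C" "Dom C (Plus C f g) = Dom C g" "Cod C (Plus C f g) = Cod C g"
proof -
  interpret G: comm_group "Hom_gr (Dom C f) (Cod C f)" using assms by (simp add: Hom_gr_group)
  show "Plus C f g \<in> Arr C" "Dom C (Plus C f g) = Dom C g" "Cod C (Plus C f g) = Cod C g"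
    using G.m_closed[of f g] assms by simp_all
qed

lemma Neg_arr [simp]:
  assumes "f \<in> Arr C"
  shows "Neg f \<in> Arr C" "Dom C (Neg f) = Dom C f" "Cod C (Neg f) = Cod C f"
proof -
  interpret G: comm_group "Hom_gr (Dom C f) (Cod C f)" using assms by (simp add: Hom_gr_group)
  show "Neg f \<in> Arr C" "Dom C (Neg f) = Dom C f" "Cod C (Neg f) = Cod C f"
    using G.inv_closed[of f] assms unfolding Neg_def by simp_all
qed

lemma Plus_assoc:
  assumes "f \<in> Arr C" "g \<in> Arr C" "h \<in> Arr C" "Dom C f = Dom C g" "Dom C h = Dom C g"
    "Cod C f = Cod C g" "Cod C h = Cod C g"
  shows "Plus C (Plus C f g) h = Plus C f (Plus C g h)"
proof -
  interpret G: comm_group "Hom_gr (Dom C f) (Cod C f)" using assms by (simp add: Hom_gr_group)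
  show ?thesis using G.m_assoc[of f g h] assms by simp
qed

lemma Plus_commute:
  assumes "f \<in> Arr C" "g \<in> Arr C" "Dom C f = Dom C g" "Cod C f = Cod C g"
  shows "Plus C f g = Plus C g f"
proof -
  interpret G: comm_group "Hom_gr (Dom C f) (Cod C f)" using assms by (simp add: Hom_gr_group)
  show ?thesis using G.m_comm[of f g] assms by simp
qed

lemma Plus_Zero [simp]:
  assumes "f \<in> Arr C" "Dom C f = X" "Cod C f = Y"
  shows "Plus C f (Zero C X Y) = f" "Plus C (Zero C X Y) f = f"
proof -
  interpret G: comm_group "Hom_gr (Dom C f) (Cod C f)" using assms by (auto simp: Hom_gr_group)
  show "Plus C f (Zero C X Y) = f" "Plus C (Zero C X Y) f = f"
    using G.l_one[of f] G.r_one[of f] assms by simp_all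
qed

lemma Plus_Neg [simp]:
  assumes "f \<in> Arr C"
  shows "Plus C f (Neg f) = Zero C (Dom C f) (Cod C f)"
    "Plus C (Neg f) f = Zero C (Dom C f) (Cod C f)"
proof -
  interpret G: comm_group "Hom_gr (Dom C f) (Cod C f)" using assms by (simp add: Hom_gr_group)
  show "Plus C f (Neg f) = Zero C (Dom C f) (Cod C f)"
    "Plus C (Neg f) f = Zero C (Dom C f) (Cod C f)"
    using G.l_inv[of f] G.r_inv[of f] assms unfolding Neg_def by simp_all
qed

lemma Minus_arr [simp]:
  assumes "f \<in> Arr C" "g \<in> Arr C" "Dom C f = Dom C g" "Cod C f = Cod C g"
  shows "f \<ominus> g \<in> Arr C" "Dom C (f \<ominus> g) = Dom C g" "Cod C (f \<ominus> g) = Cod C g"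
  using assms by (simp_all add: Minus_def)

lemma Minus_Plus [simp]:
  assumes "f \<in> Arr C" "g \<in> Arr C" "Dom C f = Dom C g" "Cod C f = Cod C g"
  shows "Plus C (f \<ominus> g) g = f"
  using assms by (simp add: Minus_def Plus_assoc)

lemma Plus_Minus:
  assumes "f \<in> Arr C" "g \<in> Arr C" "Dom C f = Dom C g" "Cod C f = Cod C g"
  shows "Plus C f g \<ominus> g = f"
  using assms by (simp add: Minus_def Plus_assoc)

lemma Minus_eq_Zero_iff [simp]:
  assumes "f \<in> Arr C" "g \<in> Arr C" "Dom C f = X" "Cod C f = Y" "Dom C g = X" "Cod C g = Y"
  shows "f \<ominus> g = Zero C X Y \<longleftrightarrow> f = g"
  using Minus_Plus[of f g] assms by (auto simp: Minus_def)

text \<open>The computing rule for differences: a candidate is verified by adding g back, so that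
  the distributive laws for differences follow from those for sums.\<close>

lemma Minus_unique:
  assumes "Plus C d g = f" "d \<in> Arr C" "g \<in> Arr C" "Dom C d = Dom C g" "Cod C d = Cod C g"
  shows "f \<ominus> g = d"
  using assms Plus_Minus[of d g] by simp

lemma Minus_Zero [simp]:
  assumes "f \<in> Arr C" "Dom C f = X" "Cod C f = Y"
  shows "f \<ominus> Zero C X Y = f"
  using assms by (intro Minus_unique) auto

lemma Minus_Minus:
  assumes "f \<in> Arr C" "g \<in> Arr C" "Dom C f = Dom C g" "Cod C f = Cod C g"
  shows "f \<ominus> (f \<ominus> g) = g"
  using assms Minus_Plus[of f g] by (intro Minus_unique) (auto simp: Plus_commute[of g])

lemma Comp_Plus' [simp]:
  assumes "f \<in> Arr C" "g \<in> Arr C" "h \<in> Arr C" "Dom C f = Dom C g" "Cod C f = Cod C g"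
    "Cod C g = Dom C h"
  shows "h \<cdot> Plus C f g = Plus C (h \<cdot> f) (h \<cdot> g)"
  using Comp_Plus[of f "Dom C g" "Cod C g" g h "Cod C h"] assms by auto

lemma Plus_Comp' [simp]:
  assumes "f \<in> Arr C" "g \<in> Arr C" "h \<in> Arr C" "Dom C h = Dom C g" "Cod C h = Cod C g"
    "Cod C f = Dom C g"
  shows "Plus C g h \<cdot> f = Plus C (g \<cdot> f) (h \<cdot> f)"
  using Plus_Comp[of f "Dom C f" "Dom C g" g "Cod C g" h] assms by auto

text \<open>Distributivity turns 0 + 0 = 0 into z + z = z for the composite z, and the only
  idempotent of a group is its neutral element.\<close>

lemma Comp_Zero [simp]:
  assumes "h \<in> Arr C" "Dom C h = Y" "X \<in> Obj C"
  shows "h \<cdot> Zero C X Y = Zero C X (Cod C h)"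
proof -
  have Y: "Y \<in> Obj C" using assms by auto
  let ?z = "h \<cdot> Zero C X Y"
  have "Plus C ?z ?z = ?z" using Comp_Plus'[of "Zero C X Y" "Zero C X Y" h] assms Y by simp
  then have "?z \<ominus> ?z = ?z" using assms Y by (intro Minus_unique) auto
  then show ?thesis using assms Y Minus_eq_Zero_iff[of ?z ?z X "Cod C h"] by simp
qed

lemma Zero_Comp [simp]:
  assumes "h \<in> Arr C" "Cod C h = X" "Y \<in> Obj C"
  shows "Zero C X Y \<cdot> h = Zero C (Dom C h) Y"
proof -
  have X: "X \<in> Obj C" using assms by auto
  let ?z = "Zero C X Y \<cdot> h"
  have "Plus C ?z ?z = ?z" using Plus_Comp'[of h "Zero C X Y" "Zero C X Y"] assms X by simp
  then have "?z \<ominus> ?z = ?z" using assms X by (intro Minus_unique) auto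
  then show ?thesis using assms X Minus_eq_Zero_iff[of ?z ?z "Dom C h" Y] by simp
qed

lemma Comp_Minus [simp]:
  assumes "f \<in> Arr C" "g \<in> Arr C" "h \<in> Arr C" "Dom C f = Dom C g" "Cod C f = Cod C g"
    "Cod C g = Dom C h"
  shows "h \<cdot> (f \<ominus> g) = h \<cdot> f \<ominus> h \<cdot> g"
proof -
  have "Plus C (h \<cdot> (f \<ominus> g)) (h \<cdot> g) = h \<cdot> f"
    using Comp_Plus'[of "f \<ominus> g" g h] assms by (simp del: Comp_Plus')
  then show ?thesis using assms by (intro Minus_unique[symmetric]) auto
qed

lemma Minus_Comp [simp]:
  assumes "f \<in> Arr C" "g \<in> Arr C" "h \<in> Arr C" "Dom C h = Dom C g" "Cod C h = Cod C g"
    "Cod C f = Dom C g"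
  shows "(g \<ominus> h) \<cdot> f = g \<cdot> f \<ominus> h \<cdot> f"
proof -
  have "Plus C ((g \<ominus> h) \<cdot> f) (h \<cdot> f) = g \<cdot> f"
    using Plus_Comp'[of f "g \<ominus> h" h] assms by (simp del: Plus_Comp')
  then show ?thesis using assms by (intro Minus_unique[symmetric]) auto
qed

text \<open>Passing to the difference of two arrows turns cancellation into a statement about arrows
  that are killed.\<close>

lemma mono_iff:
  "mono_arr C f \<longleftrightarrow> f \<in> Arr C \<and>
    (\<forall>t \<in> Arr C. Cod C t = Dom C f \<and> f \<cdot> t = Zero C (Dom C t) (Cod C f) \<longrightarrow>
      t = Zero C (Dom C t) (Dom C f))" (is "?L \<longleftrightarrow> ?R")
proof
  assume L: ?L
  note [simp] = mono_arrD[OF L]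
  show ?R
  proof (intro conjI ballI impI, simp, elim conjE)
    fix t assume "t \<in> Arr C" "Cod C t = Dom C f" "f \<cdot> t = Zero C (Dom C t) (Cod C f)"
    then show "t = Zero C (Dom C t) (Dom C f)"
      by (intro mono_cancel[OF L, of t "Zero C (Dom C t) (Dom C f)"]) simp_all
  qed
next
  assume R: ?R
  then have [simp]: "f \<in> Arr C" by simp
  show ?L unfolding mono_arr_def
  proof (intro conjI allI ballI impI)
    fix W s t assume st: "s \<in> Hom C W (Dom C f)" "t \<in> Hom C W (Dom C f)" "f \<cdot> s = f \<cdot> t"
    then have "f \<cdot> (s \<ominus> t) = Zero C W (Cod C f)" by simp
    then have "s \<ominus> t = Zero C W (Dom C f)"
      using R[THEN conjunct2, rule_format, of "s \<ominus> t"] st by simp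
    then show "s = t" using st by simp
  qed simp
qed

lemma epi_iff:
  "epi_arr C f \<longleftrightarrow> f \<in> Arr C \<and>
    (\<forall>t \<in> Arr C. Dom C t = Cod C f \<and> t \<cdot> f = Zero C (Dom C f) (Cod C t) \<longrightarrow>
      t = Zero C (Cod C f) (Cod C t))" (is "?L \<longleftrightarrow> ?R")
proof
  assume L: ?L
  note [simp] = epi_arrD[OF L]
  show ?R
  proof (intro conjI ballI impI, simp, elim conjE)
    fix t assume "t \<in> Arr C" "Dom C t = Cod C f" "t \<cdot> f = Zero C (Dom C f) (Cod C t)"
    then show "t = Zero C (Cod C f) (Cod C t)"
      by (intro epi_cancel[OF L, of t "Zero C (Cod C f) (Cod C t)"]) simp_all
  qed
next
  assume R: ?R
  then have [simp]: "f \<in> Arr C" by simp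
  show ?L unfolding epi_arr_def
  proof (intro conjI allI ballI impI)
    fix W s t assume st: "s \<in> Hom C (Cod C f) W" "t \<in> Hom C (Cod C f) W" "s \<cdot> f = t \<cdot> f"
    then have "(s \<ominus> t) \<cdot> f = Zero C (Dom C f) W" by simp
    then have "s \<ominus> t = Zero C (Cod C f) W"
      using R[THEN conjunct2, rule_format, of "s \<ominus> t"] st by simp
    then show "s = t" using st by simp
  qed simp
qed

lemma mono_zero:
  assumes "mono_arr C f" "f \<cdot> t = Zero C W Y" "t \<in> Arr C" "Cod C t = Dom C f" "Dom C t = W"
    "Cod C f = Y"
  shows "t = Zero C W (Dom C f)"
  using assms mono_iff by auto

lemma epi_zero:
  assumes "epi_arr C f" "t \<cdot> f = Zero C X W" "t \<in> Arr C" "Dom C t = Cod C f" "Cod C t = W"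
    "Dom C f = X"
  shows "t = Zero C (Cod C f) W"
  using assms epi_iff by auto

section \<open>Kernels, cokernels and biproducts\<close>

lemma Hom_Obj:
  assumes "f \<in> Hom C X Y"
  shows "X \<in> Obj C" "Y \<in> Obj C"
  using assms by auto

lemma kernelD:
  assumes "is_kernel C k f"
  shows "k \<in> Arr C" "f \<in> Arr C" "Cod C k = Dom C f" "f \<cdot> k = Zero C (Dom C k) (Cod C f)"
  using assms by (simp_all add: is_kernel_def)

lemma cokernelD:
  assumes "is_cokernel C q f"
  shows "q \<in> Arr C" "f \<in> Arr C" "Dom C q = Cod C f" "q \<cdot> f = Zero C (Dom C f) (Cod C q)"
  using assms by (simp_all add: is_cokernel_def)

lemma kernel_factor:
  assumes "is_kernel C k f" "t \<in> Hom C W (Dom C f)" "f \<cdot> t = Zero C W (Cod C f)"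
  obtains u where "u \<in> Hom C W (Dom C k)" "k \<cdot> u = t"
  using assms unfolding is_kernel_def by blast

lemma cokernel_factor:
  assumes "is_cokernel C q f" "t \<in> Hom C (Cod C f) W" "t \<cdot> f = Zero C (Dom C f) W"
  obtains u where "u \<in> Hom C (Cod C q) W" "u \<cdot> q = t"
  using assms unfolding is_cokernel_def by blast

lemma kernel_mono:
  assumes "is_kernel C k f"
  shows "mono_arr C k"
  unfolding mono_arr_def
proof (intro conjI allI ballI impI)
  note [simp] = kernelD(1-3)[OF assms]
  show "k \<in> Arr C" by simp
  fix W s t assume st: "s \<in> Hom C W (Dom C k)" "t \<in> Hom C W (Dom C k)" "k \<cdot> s = k \<cdot> t"
  have "k \<cdot> t \<in> Hom C W (Dom C f)" using st(2) by simp
  moreover have "f \<cdot> (k \<cdot> t) = Zero C W (Cod C f)"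
    using st(2) precomp[OF kernelD(4)[OF assms], of t] by simp
  ultimately have "\<exists>!u. u \<in> Hom C W (Dom C k) \<and> k \<cdot> u = k \<cdot> t"
    using assms unfolding is_kernel_def by blast
  then show "s = t" using st by blast
qed

lemma cokernel_epi:
  assumes "is_cokernel C q f"
  shows "epi_arr C q"
  unfolding epi_arr_def
proof (intro conjI allI ballI impI)
  note [simp] = cokernelD(1-3)[OF assms]
  show "q \<in> Arr C" by simp
  fix W s t assume st: "s \<in> Hom C (Cod C q) W" "t \<in> Hom C (Cod C q) W" "s \<cdot> q = t \<cdot> q"
  have "t \<cdot> q \<in> Hom C (Cod C f) W" using st(2) by simp
  moreover have "(t \<cdot> q) \<cdot> f = Zero C (Dom C f) W"
    using st(2) postcomp[OF cokernelD(4)[OF assms], of t] by simp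
  ultimately have "\<exists>!u. u \<in> Hom C (Cod C q) W \<and> u \<cdot> q = t \<cdot> q"
    using assms unfolding is_cokernel_def by blast
  then show "s = t" using st by blast
qed

lemma kernelI:
  assumes "mono_arr C k" "k \<in> Hom C X Y" "f \<in> Hom C Y Z" "f \<cdot> k = Zero C X Z"
    and factor: "\<And>W t. \<lbrakk>t \<in> Hom C W Y; f \<cdot> t = Zero C W Z\<rbrakk> \<Longrightarrow> \<exists>u \<in> Hom C W X. k \<cdot> u = t"
  shows "is_kernel C k f"
  unfolding is_kernel_def
proof (intro conjI allI ballI impI)
  fix W t assume "t \<in> Hom C W (Dom C f)" "f \<cdot> t = Zero C W (Cod C f)"
  then have "t \<in> Hom C W Y" "f \<cdot> t = Zero C W Z" using assms(3) by simp_all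
  then obtain u where u: "u \<in> Hom C W X" "k \<cdot> u = t" using factor by blast
  show "\<exists>!u. u \<in> Hom C W (Dom C k) \<and> k \<cdot> u = t"
  proof (rule ex1I[of _ u])
    fix v assume v: "v \<in> Hom C W (Dom C k) \<and> k \<cdot> v = t"
    then have "k \<cdot> v = k \<cdot> u" using u by simp
    then show "v = u" by (rule mono_cancel[OF assms(1)]) (use assms u(1) v in simp_all)
  qed (use u assms in simp)
qed (use assms in simp_all)

lemma cokernelI:
  assumes "epi_arr C q" "f \<in> Hom C X Y" "q \<in> Hom C Y Z" "q \<cdot> f = Zero C X Z"
    and factor: "\<And>W t. \<lbrakk>t \<in> Hom C Y W; t \<cdot> f = Zero C X W\<rbrakk> \<Longrightarrow> \<exists>u \<in> Hom C Z W. u \<cdot> q = t"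
  shows "is_cokernel C q f"
  unfolding is_cokernel_def
proof (intro conjI allI ballI impI)
  fix W t assume "t \<in> Hom C (Cod C f) W" "t \<cdot> f = Zero C (Dom C f) W"
  then have "t \<in> Hom C Y W" "t \<cdot> f = Zero C X W" using assms(2) by simp_all
  then obtain u where u: "u \<in> Hom C Z W" "u \<cdot> q = t" using factor by blast
  show "\<exists>!u. u \<in> Hom C (Cod C q) W \<and> u \<cdot> q = t"
  proof (rule ex1I[of _ u])
    fix v assume v: "v \<in> Hom C (Cod C q) W \<and> v \<cdot> q = t"
    then have "v \<cdot> q = u \<cdot> q" using u by simp
    then show "v = u" by (rule epi_cancel[OF assms(1)]) (use assms u(1) v in simp_all)
  qed (use u assms in simp)
qed (use assms in simp_all)

text \<open>Only one universal property is recorded; that p is also the cokernel of k follows from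
  normality. The objects are explicit arguments so that the types of both arrows can be read off by
  simplification.\<close>

definition ses where
  "ses X k E p Y \<longleftrightarrow> k \<in> Hom C X E \<and> p \<in> Hom C E Y \<and> is_kernel C k p \<and> epi_arr C p"

lemma sesD:
  assumes "ses X k E p Y"
  shows "k \<in> Arr C" "Dom C k = X" "Cod C k = E" "p \<in> Arr C" "Dom C p = E" "Cod C p = Y"
    "X \<in> Obj C" "E \<in> Obj C" "Y \<in> Obj C" "p \<cdot> k = Zero C X Y"
  using assms kernelD[of k p] unfolding ses_def by auto

lemma ses_mono: "ses X k E p Y \<Longrightarrow> mono_arr C k"
  and ses_epi: "ses X k E p Y \<Longrightarrow> epi_arr C p"
  and ses_kernel: "ses X k E p Y \<Longrightarrow> is_kernel C k p"
  using kernel_mono by (auto simp: ses_def)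

lemma ses_factor:
  assumes "ses X k E p Y" "t \<in> Hom C W E" "p \<cdot> t = Zero C W Y"
  obtains u where "u \<in> Hom C W X" "k \<cdot> u = t"
  using kernel_factor[OF ses_kernel[OF assms(1)], of t W] sesD[OF assms(1)] assms(2,3) by auto

lemma sesI:
  assumes "k \<in> Hom C X E" "p \<in> Hom C E Y" "mono_arr C k" "epi_arr C p" "p \<cdot> k = Zero C X Y"
    "\<And>W t. \<lbrakk>t \<in> Hom C W E; p \<cdot> t = Zero C W Y\<rbrakk> \<Longrightarrow> \<exists>u \<in> Hom C W X. k \<cdot> u = t"
  shows "ses X k E p Y"
  unfolding ses_def using assms kernelI[of k X E p Y] by auto

lemma is_coproduct_pair:
  "is_coproduct C [i, j] P \<longleftrightarrow> P \<in> Obj C \<and> i \<in> Arr C \<and> j \<in> Arr C \<and> Cod C i = P \<and> Cod C j = P \<and>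
    (\<forall>T \<in> Obj C. \<forall>f \<in> Hom C (Dom C i) T. \<forall>g \<in> Hom C (Dom C j) T.
      \<exists>!h. h \<in> Hom C P T \<and> h \<cdot> i = f \<and> h \<cdot> j = g)"
proof -
  have eq: "(\<forall>fs. length fs = length [i, j] \<and> Q fs \<longrightarrow> R fs) \<longleftrightarrow> (\<forall>f g. Q [f, g] \<longrightarrow> R [f, g])"
    for Q R :: "'b list \<Rightarrow> bool"
  proof (intro iffI allI impI)
    fix fs assume *: "\<forall>f g. Q [f, g] \<longrightarrow> R [f, g]" and "length fs = length [i, j] \<and> Q fs"
    then show "R fs" by (cases fs; cases "tl fs") auto
  qed simp
  have bb: "(\<forall>f g. f \<in> A \<and> g \<in> B \<longrightarrow> Q f g) \<longleftrightarrow> (\<forall>f \<in> A. \<forall>g \<in> B. Q f g)" for A B Q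
    by blast
  have lt: "(\<forall>l < length [i, j]. Q l) \<longleftrightarrow> Q 0 \<and> Q (Suc 0)" for Q
    by (simp add: All_less_Suc2)
  show ?thesis
    unfolding is_coproduct_def eq lt by (simp add: bb conj_ac del: in_Hom)
qed

lemma coproductD:
  assumes "is_coproduct C [i, j] P" "f \<in> Hom C (Dom C i) T" "g \<in> Hom C (Dom C j) T"
  obtains h where "h \<in> Hom C P T" "h \<cdot> i = f" "h \<cdot> j = g"
proof -
  have "T \<in> Obj C" using Hom_Obj(2)[OF assms(2)] .
  then show ?thesis using assms that unfolding is_coproduct_pair by blast
qed

lemma coproduct_eqI:
  assumes "is_coproduct C [i, j] P" "f \<in> Hom C P T" "g \<in> Hom C P T" "f \<cdot> i = g \<cdot> i" "f \<cdot> j = g \<cdot> j"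
  shows "f = g"
proof -
  have T: "T \<in> Obj C" using Hom_Obj(2)[OF assms(2)] .
  have "g \<cdot> i \<in> Hom C (Dom C i) T" "g \<cdot> j \<in> Hom C (Dom C j) T"
    using assms(1,3) unfolding is_coproduct_pair by auto
  then have "\<exists>!h. h \<in> Hom C P T \<and> h \<cdot> i = g \<cdot> i \<and> h \<cdot> j = g \<cdot> j"
    using assms(1) T unfolding is_coproduct_pair by blast
  then show ?thesis using assms(2-5) by blast
qed

text \<open>Uniqueness comes from the decomposition of the identity: an arrow h out of P is the sum
  of its restrictions along i and j, each preceded by a projection.\<close>

lemma coproductI:
  assumes i: "i \<in> Hom C X P" and j: "j \<in> Hom C Y P" and p: "p \<in> Hom C P X" and q: "q \<in> Hom C P Y"
    and "p \<cdot> i = Ident C X" "q \<cdot> j = Ident C Y" "q \<cdot> i = Zero C X Y" "p \<cdot> j = Zero C Y X"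
    and sum: "Plus C (i \<cdot> p) (j \<cdot> q) = Ident C P"
  shows "is_coproduct C [i, j] P"
  unfolding is_coproduct_pair
proof (intro conjI ballI)
  have [simp]: "X \<in> Obj C" "Y \<in> Obj C" "P \<in> Obj C" using i j by auto
  note [simp] = i[simplified] j[simplified] p[simplified] q[simplified] assms(5-8)
  fix T f g assume T: "T \<in> Obj C" and fg: "f \<in> Hom C (Dom C i) T" "g \<in> Hom C (Dom C j) T"
  note [simp] = T fg[simplified]
  show "\<exists>!h. h \<in> Hom C P T \<and> h \<cdot> i = f \<and> h \<cdot> j = g"
  proof (rule ex1I[of _ "Plus C (f \<cdot> p) (g \<cdot> q)"])
    show "Plus C (f \<cdot> p) (g \<cdot> q) \<in> Hom C P T \<and> Plus C (f \<cdot> p) (g \<cdot> q) \<cdot> i = f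
      \<and> Plus C (f \<cdot> p) (g \<cdot> q) \<cdot> j = g" by simp
    fix h assume h: "h \<in> Hom C P T \<and> h \<cdot> i = f \<and> h \<cdot> j = g"
    then have "h = h \<cdot> Plus C (i \<cdot> p) (j \<cdot> q)" using h sum by simp
    also have "\<dots> = Plus C ((h \<cdot> i) \<cdot> p) ((h \<cdot> j) \<cdot> q)"
      using h[THEN conjunct1] by (simp del: sum)
    finally show "h = Plus C (f \<cdot> p) (g \<cdot> q)" by (simp only: h)
  qed
qed (use i j in auto)

end

section \<open>Consequences of normality\<close>

context abelian_category
begin

lemma zero_object:
  obtains Z where "zero_obj C Z" "Z \<in> Obj C"
  using ex_zero_obj by (auto simp: zero_obj_def)

lemma zero_obj_eq:
  assumes "zero_obj C Z" "f \<in> Arr C"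
  shows "Dom C f = Z \<Longrightarrow> f = Zero C Z (Cod C f)" "Cod C f = Z \<Longrightarrow> f = Zero C (Dom C f) Z"
proof -
  have Z: "Z \<in> Obj C" using assms by (simp add: zero_obj_def)
  { assume "Dom C f = Z"
    then show "f = Zero C Z (Cod C f)"
      using assms(1)[unfolded zero_obj_def] assms(2) Z
      by (metis Cod_in_Obj Zero_arr in_Hom) }
  assume "Cod C f = Z"
  then show "f = Zero C (Dom C f) Z"
    using assms(1)[unfolded zero_obj_def] assms(2) Z
    by (metis Dom_in_Obj Zero_arr in_Hom)
qed

text \<open>The projections are obtained from the coproduct property by prescribing identities and
  zeros; the two sides of the sum formula agree on both injections.\<close>

lemma biproduct:
  assumes [simp]: "X \<in> Obj C" "Y \<in> Obj C"
  obtains P i j p q where "is_coproduct C [i, j] P" "P \<in> Obj C"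
    "i \<in> Hom C X P" "j \<in> Hom C Y P" "p \<in> Hom C P X" "q \<in> Hom C P Y"
    "p \<cdot> i = Ident C X" "q \<cdot> j = Ident C Y" "q \<cdot> i = Zero C X Y" "p \<cdot> j = Zero C Y X"
    "Plus C (i \<cdot> p) (j \<cdot> q) = Ident C P"
proof -
  obtain P i j where P: "Dom C i = X" "Dom C j = Y" "is_coproduct C [i, j] P"
    using ex_coproduct[OF assms] by blast
  have ij: "i \<in> Hom C X P" "j \<in> Hom C Y P" and [simp]: "P \<in> Obj C"
    using P unfolding is_coproduct_pair by auto
  note [simp] = ij[simplified]
  obtain p where p: "p \<in> Hom C P X" "p \<cdot> i = Ident C X" "p \<cdot> j = Zero C Y X"
    by (rule coproductD[OF P(3), of "Ident C X" X "Zero C Y X"]) auto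
  obtain q where q: "q \<in> Hom C P Y" "q \<cdot> i = Zero C X Y" "q \<cdot> j = Ident C Y"
    by (rule coproductD[OF P(3), of "Zero C X Y" Y "Ident C Y"]) auto
  have "Plus C (i \<cdot> p) (j \<cdot> q) = Ident C P"
    by (rule coproduct_eqI[OF P(3), of _ P]) (use p q in auto)
  then show ?thesis using that[of i j P p q] P(3) ij p q by simp
qed

text \<open>Normality makes f the cokernel of some g. Since g factors through the kernel k, every
  arrow that kills k kills g, so the universal property carries over from g to k.\<close>

lemma epi_cokernel:
  assumes "epi_arr C f" "is_kernel C k f"
  shows "is_cokernel C f k"
proof -
  define X E Y where "X = Dom C k" and "E = Dom C f" and "Y = Cod C f"
  have ty: "f \<in> Hom C E Y" "k \<in> Hom C X E" and fk: "f \<cdot> k = Zero C X Y"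
    using kernelD[OF assms(2)] by (simp_all add: X_def E_def Y_def)
  note [simp] = ty[simplified] Hom_Obj[OF ty(1)] Hom_Obj[OF ty(2)]
  obtain g where g: "is_cokernel C f g" using epi_normal[OF assms(1)] by blast
  define V where "V = Dom C g"
  have gt: "g \<in> Hom C V E" and fg: "f \<cdot> g = Zero C V Y"
    using cokernelD[OF g] by (simp_all add: V_def)
  note [simp] = gt[simplified]
  obtain h where h: "h \<in> Hom C V X" "k \<cdot> h = g"
    using kernel_factor[OF assms(2), of g V] fg by auto
  note [simp] = h(1)[simplified]
  show ?thesis
  proof (rule cokernelI[OF assms(1) ty(2) ty(1) fk])
    fix W t assume t: "t \<in> Hom C E W" "t \<cdot> k = Zero C X W"
    note [simp] = Hom_Obj[OF t(1)] t(1)[simplified]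
    have "t \<cdot> g = Zero C V W" using precomp[OF t(2), of h] h(2) by simp
    then show "\<exists>u \<in> Hom C Y W. u \<cdot> f = t"
      using cokernel_factor[OF g, of t W] by (simp add: Bex_def) blast
  qed
qed

lemma mono_kernel:
  assumes "mono_arr C f" "is_cokernel C q f"
  shows "is_kernel C f q"
proof -
  define X E Y where "X = Dom C f" and "E = Cod C f" and "Y = Cod C q"
  have ty: "f \<in> Hom C X E" "q \<in> Hom C E Y" and qf: "q \<cdot> f = Zero C X Y"
    using cokernelD[OF assms(2)] by (simp_all add: X_def E_def Y_def)
  note [simp] = ty[simplified] Hom_Obj[OF ty(1)] Hom_Obj[OF ty(2)]
  obtain g where g: "is_kernel C f g" using mono_normal[OF assms(1)] by blast
  define V where "V = Cod C g"
  have gt: "g \<in> Hom C E V" and gf: "g \<cdot> f = Zero C X V"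
    using kernelD[OF g] by (simp_all add: V_def)
  note [simp] = gt[simplified]
  obtain h where h: "h \<in> Hom C Y V" "h \<cdot> q = g"
    using cokernel_factor[OF assms(2), of g V] gf by auto
  note [simp] = h(1)[simplified]
  show ?thesis
  proof (rule kernelI[OF assms(1) ty(1) ty(2) qf])
    fix W t assume t: "t \<in> Hom C W E" "q \<cdot> t = Zero C W Y"
    note [simp] = Hom_Obj[OF t(1)] t(1)[simplified]
    have "(h \<cdot> q) \<cdot> t = h \<cdot> Zero C W Y" using t(2) by simp
    then have "g \<cdot> t = Zero C W V" unfolding h(2) by simp
    then show "\<exists>u \<in> Hom C W X. f \<cdot> u = t"
      using kernel_factor[OF g, of t W] by (simp add: Bex_def) blast
  qed
qed

lemma ses_of_epi:
  assumes "epi_arr C p" "p \<in> Hom C E Y"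
  obtains X k where "ses X k E p Y"
proof -
  obtain k where k: "is_kernel C k p" using ex_kernel epi_arrD[OF assms(1)] by blast
  then show ?thesis using that[of "Dom C k" k] assms kernelD[OF k] by (auto simp: ses_def)
qed

lemma ses_of_mono:
  assumes "mono_arr C k" "k \<in> Hom C X E"
  obtains Y p where "ses X k E p Y"
proof -
  obtain p where p: "is_cokernel C p k" using ex_cokernel mono_arrD[OF assms(1)] by blast
  then show ?thesis using that[of p "Cod C p"] assms cokernelD[OF p] mono_kernel[OF assms(1) p]
      cokernel_epi[OF p] by (auto simp: ses_def)
qed

lemma ses_cofactor:
  assumes "ses X k E p Y" "t \<in> Hom C E W" "t \<cdot> k = Zero C X W"
  obtains u where "u \<in> Hom C Y W" "u \<cdot> p = t"
proof -
  have "is_cokernel C p k" by (rule epi_cokernel[OF ses_epi[OF assms(1)] ses_kernel[OF assms(1)]])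
  then show ?thesis
    using cokernel_factor[of p k t W] that sesD[OF assms(1)] assms(2,3) by auto
qed

text \<open>The pullback is the kernel of a difference of two arrows on the biproduct. Its last
  clause, the stability of epimorphisms, is what makes chases with generalized elements
  possible.\<close>

lemma pullback:
  assumes f: "f \<in> Hom C X Z" and g: "g \<in> Hom C Y Z"
  obtains P a b where "a \<in> Hom C P X" "b \<in> Hom C P Y" "f \<cdot> a = g \<cdot> b"
    "\<And>W s t. \<lbrakk>s \<in> Hom C W X; t \<in> Hom C W Y; f \<cdot> s = g \<cdot> t\<rbrakk> \<Longrightarrow> \<exists>u \<in> Hom C W P. a \<cdot> u = s \<and> b \<cdot> u = t"
    "\<And>W u v. \<lbrakk>u \<in> Hom C W P; v \<in> Hom C W P; a \<cdot> u = a \<cdot> v; b \<cdot> u = b \<cdot> v\<rbrakk> \<Longrightarrow> u = v"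
    "epi_arr C f \<Longrightarrow> epi_arr C b"
proof -
  have [simp]: "X \<in> Obj C" "Y \<in> Obj C" "Z \<in> Obj C" using f g by auto
  note [simp] = f[simplified] g[simplified]
  obtain Q i j p q where Q: "is_coproduct C [i, j] Q" and [simp]: "Q \<in> Obj C"
    and ty: "i \<in> Hom C X Q" "j \<in> Hom C Y Q" "p \<in> Hom C Q X" "q \<in> Hom C Q Y"
    and [simp]: "p \<cdot> i = Ident C X" "q \<cdot> j = Ident C Y" "q \<cdot> i = Zero C X Y" "p \<cdot> j = Zero C Y X"
    and sum: "Plus C (i \<cdot> p) (j \<cdot> q) = Ident C Q"
    by (rule biproduct[of X Y]) auto
  note [simp] = ty[simplified]
  let ?d = "f \<cdot> p \<ominus> g \<cdot> q"
  obtain \<kappa> where \<kappa>: "is_kernel C \<kappa> ?d" using ex_kernel[of ?d] by auto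
  define P where "P = Dom C \<kappa>"
  have \<kappa>t [simp]: "\<kappa> \<in> Arr C" "Dom C \<kappa> = P" "Cod C \<kappa> = Q" "P \<in> Obj C"
    using kernelD[OF \<kappa>] by (simp_all add: P_def)
  have "?d \<cdot> \<kappa> = Zero C P Z" using kernelD(4)[OF \<kappa>] by (simp del: Minus_Comp)
  then have comm: "f \<cdot> (p \<cdot> \<kappa>) = g \<cdot> (q \<cdot> \<kappa>)" by simp
  have fac: "\<exists>u \<in> Hom C W P. (p \<cdot> \<kappa>) \<cdot> u = s \<and> (q \<cdot> \<kappa>) \<cdot> u = t"
    if st: "s \<in> Hom C W X" "t \<in> Hom C W Y" "f \<cdot> s = g \<cdot> t" for W s t
  proof -
    note [simp] = st(1,2)[simplified]
    have [simp]: "W \<in> Obj C" using Hom_Obj[OF st(1)] by simp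
    let ?w = "Plus C (i \<cdot> s) (j \<cdot> t)"
    have "p \<cdot> ?w = Plus C ((p \<cdot> i) \<cdot> s) ((p \<cdot> j) \<cdot> t)"
      by (simp del: \<open>p \<cdot> i = _\<close> \<open>p \<cdot> j = _\<close>)
    moreover have "q \<cdot> ?w = Plus C ((q \<cdot> i) \<cdot> s) ((q \<cdot> j) \<cdot> t)"
      by (simp del: \<open>q \<cdot> i = _\<close> \<open>q \<cdot> j = _\<close>)
    ultimately have pw': "p \<cdot> ?w = s" "q \<cdot> ?w = t" by (simp_all del: Comp_Plus' Comp_assoc')
    have "?d \<cdot> ?w = f \<cdot> (p \<cdot> ?w) \<ominus> g \<cdot> (q \<cdot> ?w)" by (simp del: Comp_Plus')
    then have "?d \<cdot> ?w = Zero C W Z" unfolding pw' using st(3) by simp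
    then obtain u where "u \<in> Hom C W P" "\<kappa> \<cdot> u = ?w"
      using kernel_factor[OF \<kappa>, of ?w W] by auto
    then show ?thesis using pw' by (intro bexI[of _ u]) (auto simp del: Comp_Plus')
  qed
  have mon: "u = v"
    if uv: "u \<in> Hom C W P" "v \<in> Hom C W P" "(p \<cdot> \<kappa>) \<cdot> u = (p \<cdot> \<kappa>) \<cdot> v" "(q \<cdot> \<kappa>) \<cdot> u = (q \<cdot> \<kappa>) \<cdot> v"
    for W u v
  proof -
    note [simp] = uv(1,2)[simplified]
    have e: "\<kappa> \<cdot> w = Plus C (i \<cdot> ((p \<cdot> \<kappa>) \<cdot> w)) (j \<cdot> ((q \<cdot> \<kappa>) \<cdot> w))"
      if [simp]: "w \<in> Arr C" "Cod C w = P" for w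
      using precomp[OF sum, of "\<kappa> \<cdot> w"] by simp
    have "\<kappa> \<cdot> u = Plus C (i \<cdot> ((p \<cdot> \<kappa>) \<cdot> v)) (j \<cdot> ((q \<cdot> \<kappa>) \<cdot> v))"
      unfolding uv(3,4)[symmetric] by (rule e) simp_all
    also have "\<dots> = \<kappa> \<cdot> v" by (rule e[symmetric]) simp_all
    finally show ?thesis by (rule mono_cancel[OF kernel_mono[OF \<kappa>]]) simp_all
  qed
  have epi: "epi_arr C (q \<cdot> \<kappa>)" if f: "epi_arr C f"
  proof -
    \<comment> \<open>On the first summand the difference is f; hence it is epic when f is, and then
      it is the cokernel of its own kernel.\<close>
    have di: "?d \<cdot> i = f" by simp
    have "epi_arr C ?d" by (rule epi_Comp_left[of ?d i]) (use f di in simp_all)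
    then have c: "is_cokernel C ?d \<kappa>" by (rule epi_cokernel[OF _ \<kappa>])
    have "t = Zero C Y (Cod C t)"
      if t: "t \<in> Arr C" "Dom C t = Y" "t \<cdot> (q \<cdot> \<kappa>) = Zero C P (Cod C t)" for t
    proof -
      note [simp] = t(1,2)
      have "(t \<cdot> q) \<cdot> \<kappa> = Zero C P (Cod C t)" using t(3) by simp
      then obtain u where u: "u \<in> Hom C Z (Cod C t)" "u \<cdot> ?d = t \<cdot> q"
        using cokernel_factor[OF c, of "t \<cdot> q" "Cod C t"] by auto
      note [simp] = u(1)[simplified]
      \<comment> \<open>Restriction to the first summand, where \<open>q\<close> vanishes, shows
        that u kills the epimorphism f.\<close>
      have "u \<cdot> (?d \<cdot> i) = t \<cdot> (q \<cdot> i)"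
        using precomp[OF u(2), of i] by (simp del: Comp_Minus Minus_Comp)
      then have "u \<cdot> f = Zero C X (Cod C t)" unfolding di by simp
      then have "u = Zero C Z (Cod C t)" using epi_zero[OF f] by simp
      then have "t \<cdot> q = Zero C Q (Cod C t)" using u(2)[symmetric] by (simp del: Comp_Minus)
      from precomp[OF this, of j] show ?thesis by simp
    qed
    then show ?thesis unfolding epi_iff by auto
  qed
  show ?thesis by (rule that[of "p \<cdot> \<kappa>" P "q \<cdot> \<kappa>"]) (use comm fac mon epi in auto)
qed

section \<open>Pullbacks and pushouts\<close>

text \<open>A factorization through a monomorphism that exists after an epimorphic cover descends
  from the cover: as k is monic, s kills the kernel of p and therefore factors through p.\<close>

lemma mono_descend:
  assumes "mono_arr C k" "epi_arr C p" "k \<in> Hom C X E" "p \<in> Hom C V W" "s \<in> Hom C V X" "t \<in> Hom C W E"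
    "k \<cdot> s = t \<cdot> p"
  obtains u where "u \<in> Hom C W X" "k \<cdot> u = t" "u \<cdot> p = s"
proof -
  note [simp] = assms(3-6)[simplified] Hom_Obj[OF assms(3)] Hom_Obj[OF assms(4)]
  obtain K \<kappa> where s: "ses K \<kappa> V p W" using ses_of_epi[OF assms(2,4)] .
  note [simp] = sesD[OF s]
  have "k \<cdot> (s \<cdot> \<kappa>) = Zero C K E" using precomp[OF assms(7), of \<kappa>] by simp
  then have "s \<cdot> \<kappa> = Zero C K X" using mono_zero[OF assms(1)] by simp
  then obtain u where u: "u \<in> Hom C W X" "u \<cdot> p = s" using ses_cofactor[OF s assms(5)] by blast
  note [simp] = u(1)[simplified]
  have "(k \<cdot> u) \<cdot> p = t \<cdot> p" using u(2) assms(7) by simp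
  then have "k \<cdot> u = t" by (rule epi_cancel[OF assms(2)]) simp_all
  then show ?thesis using that u by blast
qed

text \<open>Lifts into the kernel are demanded only after an epimorphic cover;
  \<open>mono_descend\<close> makes them global.\<close>

lemma sesI_local:
  assumes "k \<in> Hom C X E" "p \<in> Hom C E Y" "mono_arr C k" "epi_arr C p" "p \<cdot> k = Zero C X Y"
    "\<And>W t. \<lbrakk>t \<in> Hom C W E; p \<cdot> t = Zero C W Y\<rbrakk> \<Longrightarrow>
      \<exists>V q s. q \<in> Hom C V W \<and> epi_arr C q \<and> s \<in> Hom C V X \<and> k \<cdot> s = t \<cdot> q"
  shows "ses X k E p Y"
proof (rule sesI[OF assms(1-5)])
  fix W t assume t: "t \<in> Hom C W E" "p \<cdot> t = Zero C W Y"
  obtain V q s where "q \<in> Hom C V W" "epi_arr C q" "s \<in> Hom C V X" "k \<cdot> s = t \<cdot> q"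
    using assms(6)[OF t] by blast
  then show "\<exists>u \<in> Hom C W X. k \<cdot> u = t"
    using mono_descend[OF assms(3) _ assms(1) _ _ t(1)] by metis
qed

lemma epi_pullback:
  assumes "epi_arr C f" "f \<in> Hom C X Z" "g \<in> Hom C Y Z"
  obtains P a b where "a \<in> Hom C P X" "b \<in> Hom C P Y" "f \<cdot> a = g \<cdot> b" "epi_arr C b"
  using pullback[OF assms(2,3)] assms(1) by metis

lemma ses_pullback:
  assumes s: "ses X k E p Y" and g: "g \<in> Hom C Y' Y"
  obtains E' k' p' e where "ses X k' E' p' Y'" "e \<in> Hom C E' E" "e \<cdot> k' = k" "p \<cdot> e = g \<cdot> p'"
proof -
  note [simp] = sesD[OF s] g[simplified] Hom_Obj[OF g]
  obtain P a b where P: "a \<in> Hom C P E" "b \<in> Hom C P Y'" "p \<cdot> a = g \<cdot> b"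
    "\<And>W s t. \<lbrakk>s \<in> Hom C W E; t \<in> Hom C W Y'; p \<cdot> s = g \<cdot> t\<rbrakk> \<Longrightarrow> \<exists>u \<in> Hom C W P. a \<cdot> u = s \<and> b \<cdot> u = t"
    "\<And>W u v. \<lbrakk>u \<in> Hom C W P; v \<in> Hom C W P; a \<cdot> u = a \<cdot> v; b \<cdot> u = b \<cdot> v\<rbrakk> \<Longrightarrow> u = v"
    "epi_arr C b"
    by (rule pullback[of p E Y g Y']) (use ses_epi[OF s] in \<open>simp_all del: in_Hom add: \<open>g \<in> _\<close>\<close>, simp)
  note [simp] = P(1,2)[simplified] Hom_Obj[OF P(1)]
  obtain k' where k': "k' \<in> Hom C X P" "a \<cdot> k' = k" "b \<cdot> k' = Zero C X Y'"
    using P(4)[of k X "Zero C X Y'"] by auto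
  note [simp] = k'(1)[simplified]
  have "mono_arr C k'" by (rule mono_Comp_right[of a]) (use k' ses_mono[OF s] in simp_all)
  then have "ses X k' P b Y'"
  proof (rule sesI[rotated 2])
    fix W t assume t: "t \<in> Hom C W P" "b \<cdot> t = Zero C W Y'"
    note [simp] = t(1)[simplified] Hom_Obj[OF t(1)]
    have "p \<cdot> (a \<cdot> t) = Zero C W Y" using precomp[OF P(3), of t] t(2) by simp
    then obtain u where u: "u \<in> Hom C W X" "k \<cdot> u = a \<cdot> t" using ses_factor[OF s, of "a \<cdot> t" W] by auto
    note [simp] = u(1)[simplified]
    have "a \<cdot> (k' \<cdot> u) = a \<cdot> t" "b \<cdot> (k' \<cdot> u) = b \<cdot> t"
      using precomp[OF k'(2), of u] precomp[OF k'(3), of u] u(2) t(2) by simp_all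
    then have "k' \<cdot> u = t" using P(5)[of "k' \<cdot> u" W t] by simp
    then show "\<exists>u \<in> Hom C W X. k' \<cdot> u = t" using u(1) by blast
  qed (use P(6) k'(3) in simp_all)
  then show ?thesis using that P(1,3) k'(2) by blast
qed

lemma ses_pushout:
  assumes s: "ses X k E p Y" and v: "v \<in> Hom C X X'"
  obtains E' k' p' e where "ses X' k' E' p' Y" "e \<in> Hom C E E'" "e \<cdot> k = k' \<cdot> v" "p' \<cdot> e = p"
    "\<And>T s t. \<lbrakk>s \<in> Hom C E T; t \<in> Hom C X' T; s \<cdot> k = t \<cdot> v\<rbrakk> \<Longrightarrow>
      \<exists>u \<in> Hom C E' T. u \<cdot> e = s \<and> u \<cdot> k' = t"
    "\<And>T u w. \<lbrakk>u \<in> Hom C E' T; w \<in> Hom C E' T; u \<cdot> e = w \<cdot> e; u \<cdot> k' = w \<cdot> k'\<rbrakk> \<Longrightarrow> u = w"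
proof -
  note [simp] = sesD[OF s] v[simplified] Hom_Obj[OF v]
  obtain Q i j r q where Q: "is_coproduct C [i, j] Q" and [simp]: "Q \<in> Obj C"
    and ty: "i \<in> Hom C X' Q" "j \<in> Hom C E Q" "r \<in> Hom C Q X'" "q \<in> Hom C Q E"
    and biprod [simp]: "r \<cdot> i = Ident C X'" "q \<cdot> j = Ident C E" "q \<cdot> i = Zero C X' E" "r \<cdot> j = Zero C E X'"
    by (rule biproduct[of X' E]) auto
  note [simp] = ty[simplified]
  \<comment> \<open>The pushout is the cokernel of this arrow into the biproduct. It is monic
    because \<open>q \<cdot> d\<close> is k, so it is also the kernel of that cokernel, which yields
    the monicity of the new left arrow.\<close>
  define d where "d = j \<cdot> k \<ominus> i \<cdot> v"
  have d [simp]: "d \<in> Arr C" "Dom C d = X" "Cod C d = Q" by (simp_all add: d_def)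
  have qjk: "q \<cdot> (j \<cdot> k) = k" "q \<cdot> (i \<cdot> v) = Zero C X E"
    using precomp[OF biprod(2), of k] precomp[OF biprod(3), of v] by (simp_all del: biprod)
  then have qd: "q \<cdot> d = k" by (simp add: d_def)
  have "mono_arr C d" by (rule mono_Comp_right[of q]) (use ses_mono[OF s] qd in simp_all)
  then obtain E' c where c: "ses X d Q c E'" by (rule ses_of_mono) simp_all
  note [simp] = sesD(4-9)[OF c]
  have cd: "c \<cdot> d = Zero C X E'" by (rule sesD[OF c])
  have ek: "c \<cdot> (j \<cdot> k) = c \<cdot> (i \<cdot> v)" using cd unfolding d_def by simp
  have "(p \<cdot> q) \<cdot> d = Zero C X Y" by (simp add: qd)
  then obtain p' where p': "p' \<in> Hom C E' Y" "p' \<cdot> c = p \<cdot> q"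
    using ses_cofactor[OF c, of "p \<cdot> q" Y] by auto
  note [simp] = p'(1)[simplified]
  have p'e: "p' \<cdot> (c \<cdot> j) = p" and p'k: "p' \<cdot> (c \<cdot> i) = Zero C X' Y"
    using precomp[OF p'(2), of j] precomp[OF p'(2), of i] by simp_all
  have epi: "epi_arr C p'" by (rule epi_Comp_left[of p' "c \<cdot> j"]) (use ses_epi[OF s] p'e in simp_all)
  have mono: "mono_arr C (c \<cdot> i)" unfolding mono_iff
  proof (intro conjI ballI impI, simp, elim conjE)
    fix t assume t: "t \<in> Arr C" "Cod C t = Dom C (c \<cdot> i)" "(c \<cdot> i) \<cdot> t = Zero C (Dom C t) (Cod C (c \<cdot> i))"
    define W where "W = Dom C t"
    have tt: "t \<in> Hom C W X'" using t by (simp add: W_def)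
    note [simp] = tt[simplified] Hom_Obj[OF tt]
    have "c \<cdot> (i \<cdot> t) = Zero C W E'" using t(3) by simp
    then obtain u where u: "u \<in> Hom C W X" "d \<cdot> u = i \<cdot> t" using ses_factor[OF c, of "i \<cdot> t" W] by auto
    note [simp] = u(1)[simplified]
    have "(q \<cdot> d) \<cdot> u = (q \<cdot> i) \<cdot> t" using u(2) by (simp del: biprod)
    then have "k \<cdot> u = Zero C W E" unfolding qd by simp
    then have "u = Zero C W X" using mono_zero[OF ses_mono[OF s]] by simp
    then have "i \<cdot> t = Zero C W Q" using u(2) by simp
    then have "(r \<cdot> i) \<cdot> t = Zero C W X'" by (simp del: biprod)
    then show "t = Zero C (Dom C t) (Dom C (c \<cdot> i))" by simp
  qed
  have "is_cokernel C p' (c \<cdot> i)"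
  proof (rule cokernelI[OF epi, of _ X' E'])
    fix W t assume t: "t \<in> Hom C E' W" "t \<cdot> (c \<cdot> i) = Zero C X' W"
    note [simp] = t(1)[simplified] Hom_Obj[OF t(1)]
    \<comment> \<open>The arrow \<open>t \<cdot> c\<close> vanishes on the summand X', so it depends
      on the summand E only.\<close>
    have 1: "t \<cdot> c = (t \<cdot> (c \<cdot> j)) \<cdot> q"
      by (rule coproduct_eqI[OF Q]) (use t(2) in simp_all)
    have "(t \<cdot> (c \<cdot> j)) \<cdot> k = Zero C X W"
      using postcomp[OF ek, of t] precomp[OF t(2), of v] by simp
    then obtain u where u: "u \<in> Hom C Y W" "u \<cdot> p = t \<cdot> (c \<cdot> j)"
      using ses_cofactor[OF s, of "t \<cdot> (c \<cdot> j)" W] by auto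
    note [simp] = u(1)[simplified]
    have "(u \<cdot> p') \<cdot> c = t \<cdot> c" unfolding 1 u(2)[symmetric] by (simp add: p'(2))
    then have "u \<cdot> p' = t" by (rule epi_cancel[OF ses_epi[OF c]]) simp_all
    then show "\<exists>u \<in> Hom C Y W. u \<cdot> p' = t" using u(1) by blast
  qed (use p'k in simp_all)
  then have "is_kernel C (c \<cdot> i) p'" by (rule mono_kernel[OF mono])
  then have "ses X' (c \<cdot> i) E' p' Y" using epi by (simp add: ses_def)
  moreover have "\<exists>u \<in> Hom C E' T. u \<cdot> (c \<cdot> j) = s \<and> u \<cdot> (c \<cdot> i) = t"
    if st: "s \<in> Hom C E T" "t \<in> Hom C X' T" "s \<cdot> k = t \<cdot> v" for T s t
  proof -
    note [simp] = st(1,2)[simplified] Hom_Obj[OF st(1)]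
    obtain h where h: "h \<in> Hom C Q T" "h \<cdot> i = t" "h \<cdot> j = s"
      by (rule coproductD[OF Q, of t T s]) simp_all
    note [simp] = h(1)[simplified]
    have "h \<cdot> d = (h \<cdot> j) \<cdot> k \<ominus> (h \<cdot> i) \<cdot> v" unfolding d_def by simp
    then have "h \<cdot> d = Zero C X T" unfolding h using st(3) by simp
    then obtain u where u: "u \<in> Hom C E' T" "u \<cdot> c = h" using ses_cofactor[OF c h(1)] by auto
    note [simp] = u(1)[simplified]
    have "u \<cdot> (c \<cdot> j) = s \<and> u \<cdot> (c \<cdot> i) = t"
      using precomp[OF u(2), of j] precomp[OF u(2), of i] h(2,3) by simp
    then show ?thesis using u(1) by blast
  qed
  moreover have "u = w"
    if uw: "u \<in> Hom C E' T" "w \<in> Hom C E' T" "u \<cdot> (c \<cdot> j) = w \<cdot> (c \<cdot> j)" "u \<cdot> (c \<cdot> i) = w \<cdot> (c \<cdot> i)"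
    for T u w
  proof -
    note [simp] = uw(1,2)[simplified] Hom_Obj[OF uw(1)]
    have "u \<cdot> c = w \<cdot> c" by (rule coproduct_eqI[OF Q]) (use uw(3,4) in simp_all)
    then show ?thesis by (rule epi_cancel[OF ses_epi[OF c]]) simp_all
  qed
  ultimately show ?thesis
    by (intro that[of "c \<cdot> i" E' p' "c \<cdot> j"]) (use p'e ek in \<open>simp_all del: in_Hom\<close>, simp)
qed

section \<open>Exact sequences and generalized elements\<close>

text \<open>The factor e is epic by minimality of the image. If t kills e, then f factors through
  \<open>m \<cdot> k\<close> with k the kernel of t. This monomorphism is the kernel of its cokernel
  c; as c kills f, it factors through q and kills m. So m factors through
  \<open>m \<cdot> k\<close>, which makes k split epic and t zero.\<close>

lemma image_factor:
  assumes q: "is_cokernel C q f" and m: "is_kernel C m q"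
  obtains e where "e \<in> Hom C (Dom C f) (Dom C m)" "m \<cdot> e = f" "epi_arr C e"
proof -
  define X Y I Q where "X = Dom C f" and "Y = Cod C f" and "I = Dom C m" and "Q = Cod C q"
  have ty: "f \<in> Hom C X Y" "q \<in> Hom C Y Q" "m \<in> Hom C I Y"
    and qf: "q \<cdot> f = Zero C X Q" and qm: "q \<cdot> m = Zero C I Q"
    using cokernelD[OF q] kernelD[OF m] by (simp_all add: X_def Y_def I_def Q_def)
  note [simp] = ty[simplified] Hom_Obj[OF ty(1)] Hom_Obj[OF ty(2)] Hom_Obj[OF ty(3)]
  obtain e where e: "e \<in> Hom C X I" "m \<cdot> e = f"
    using kernel_factor[OF m, of f X] qf by auto
  note [simp] = e(1)[simplified]
  have "t = Zero C I (Cod C t)"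
    if t: "t \<in> Arr C" "Dom C t = I" "t \<cdot> e = Zero C X (Cod C t)" for t
  proof -
    define W where "W = Cod C t"
    have tt: "t \<in> Hom C I W" using t by (simp add: W_def)
    note [simp] = tt[simplified] Hom_Obj[OF tt]
    obtain k where k: "is_kernel C k t" using ex_kernel t(1) by blast
    define K where "K = Dom C k"
    have kt: "k \<in> Hom C K I" and tk: "t \<cdot> k = Zero C K W"
      using kernelD[OF k] by (simp_all add: K_def)
    note [simp] = kt[simplified] Hom_Obj[OF kt]
    obtain e' where e': "e' \<in> Hom C X K" "k \<cdot> e' = e"
      using kernel_factor[OF k, of e X] t(3) by auto
    note [simp] = e'(1)[simplified]
    have mk: "mono_arr C (m \<cdot> k)" by (rule mono_Comp) (use kernel_mono m k in auto)
    then obtain Z c where c: "ses K (m \<cdot> k) Y c Z" by (rule ses_of_mono) simp_all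
    note [simp] = sesD(4-9)[OF c]
    have cmk: "c \<cdot> (m \<cdot> k) = Zero C K Z" by (rule sesD[OF c])
    have "c \<cdot> f = Zero C X Z"
      unfolding e(2)[symmetric] e'(2)[symmetric] using precomp[OF cmk, of e'] by simp
    then obtain c' where c': "c' \<in> Hom C Q Z" "c' \<cdot> q = c"
      using cokernel_factor[OF q, of c Z] by auto
    note [simp] = c'(1)[simplified]
    have "c \<cdot> m = Zero C I Z" unfolding c'(2)[symmetric] using qm by simp
    then obtain r where r: "r \<in> Hom C I K" "(m \<cdot> k) \<cdot> r = m"
      using ses_factor[OF c, of m I] by auto
    note [simp] = r(1)[simplified]
    have "m \<cdot> (k \<cdot> r) = m \<cdot> Ident C I" using r(2) by simp
    then have "k \<cdot> r = Ident C I" by (rule mono_cancel[OF kernel_mono[OF m]]) simp_all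
    then have "t = (t \<cdot> k) \<cdot> r" by simp
    then show ?thesis unfolding tk by simp
  qed
  then have "epi_arr C e" unfolding epi_iff by simp
  then show ?thesis using that[of e] e by simp
qed

lemma exact_atD:
  assumes "exact_at C f g"
  shows "f \<in> Arr C" "g \<in> Arr C" "Cod C f = Dom C g"
  using assms kernelD cokernelD unfolding exact_at_def is_image_def by metis+

text \<open>In a chase, exactness means that an element t killed by g comes from X after a cover: t
  factors through the image of f, and the cover is a pullback of the epic part of f.\<close>

lemma exact_at_lift:
  assumes ex: "exact_at C f g" and ty: "f \<in> Hom C X Y" "g \<in> Hom C Y Z" "t \<in> Hom C W Y"
    and gt: "g \<cdot> t = Zero C W Z"
  obtains V p s where "p \<in> Hom C V W" "epi_arr C p" "s \<in> Hom C V X" "f \<cdot> s = t \<cdot> p"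
proof -
  note [simp] = ty[simplified] Hom_Obj[OF ty(1)] Hom_Obj[OF ty(2)] Hom_Obj[OF ty(3)]
  obtain m q where q: "is_cokernel C q f" and m: "is_kernel C m q" and mg: "is_kernel C m g"
    using ex unfolding exact_at_def is_image_def by blast
  define I where "I = Dom C m"
  have m': "m \<in> Hom C I Y" using kernelD[OF mg] by (simp add: I_def)
  note [simp] = m'[simplified] Hom_Obj[OF m']
  obtain e where e: "e \<in> Hom C X I" "m \<cdot> e = f" "epi_arr C e"
    using image_factor[OF q m] by auto
  note [simp] = e(1)[simplified]
  obtain u where u: "u \<in> Hom C W I" "m \<cdot> u = t" using kernel_factor[OF mg, of t W] gt by auto
  note [simp] = u(1)[simplified]
  obtain V s p where p: "s \<in> Hom C V X" "p \<in> Hom C V W" "e \<cdot> s = u \<cdot> p" "epi_arr C p"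
    using epi_pullback[OF e(3,1) u(1)] .
  note [simp] = p(1,2)[simplified]
  have "f \<cdot> s = t \<cdot> p" unfolding e(2)[symmetric] u(2)[symmetric] using p(3) by simp
  then show ?thesis using that p by blast
qed

lemma exact_atD_zero:
  assumes ex: "exact_at C f g" and ty: "f \<in> Hom C X Y" "g \<in> Hom C Y Z"
  shows "g \<cdot> f = Zero C X Z"
proof -
  note [simp] = ty[simplified] Hom_Obj[OF ty(1)] Hom_Obj[OF ty(2)]
  obtain m q where q: "is_cokernel C q f" and m: "is_kernel C m q" and mg: "is_kernel C m g"
    using ex unfolding exact_at_def is_image_def by blast
  define I where "I = Dom C m"
  have m': "m \<in> Hom C I Y" and gm: "g \<cdot> m = Zero C I Z" using kernelD[OF mg] by (simp_all add: I_def)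
  note [simp] = m'[simplified] Hom_Obj[OF m']
  obtain e where e: "e \<in> Hom C X I" "m \<cdot> e = f" "epi_arr C e"
    using image_factor[OF q m] by auto
  note [simp] = e(1)[simplified]
  show ?thesis unfolding e(2)[symmetric] using precomp[OF gm, of e] by simp
qed

text \<open>Local lifts suffice: cancelling the cover shows that whatever g kills is killed by the
  cokernel of f as well, so the image of f is the kernel of g.\<close>

lemma exact_atI:
  assumes ty: "f \<in> Hom C X Y" "g \<in> Hom C Y Z" and gf: "g \<cdot> f = Zero C X Z"
    and lift: "\<And>W t. \<lbrakk>t \<in> Hom C W Y; g \<cdot> t = Zero C W Z\<rbrakk> \<Longrightarrow>
      \<exists>V p s. p \<in> Hom C V W \<and> epi_arr C p \<and> s \<in> Hom C V X \<and> f \<cdot> s = t \<cdot> p"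
  shows "exact_at C f g"
proof -
  note [simp] = ty[simplified] Hom_Obj[OF ty(1)] Hom_Obj[OF ty(2)]
  obtain q where q: "is_cokernel C q f" using ex_cokernel[of f] by auto
  then obtain m where m: "is_kernel C m q" using ex_kernel cokernelD(1) by blast
  define I Q where "I = Dom C m" and "Q = Cod C q"
  have ty': "q \<in> Hom C Y Q" "m \<in> Hom C I Y" and qf: "q \<cdot> f = Zero C X Q"
    using cokernelD[OF q] kernelD[OF m] by (simp_all add: I_def Q_def)
  note [simp] = ty'[simplified] Hom_Obj[OF ty'(1)] Hom_Obj[OF ty'(2)]
  obtain e where e: "e \<in> Hom C X I" "m \<cdot> e = f" "epi_arr C e"
    using image_factor[OF q m] by auto
  note [simp] = e(1)[simplified]
  have "(g \<cdot> m) \<cdot> e = Zero C X Z" using gf e(2) by simp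
  then have gm: "g \<cdot> m = Zero C I Z" using epi_zero[OF e(3), of "g \<cdot> m"] by simp
  have "is_kernel C m g"
  proof (rule kernelI[OF kernel_mono[OF m] ty'(2) ty(2) gm])
    fix W t assume t: "t \<in> Hom C W Y" "g \<cdot> t = Zero C W Z"
    note [simp] = t(1)[simplified] Hom_Obj[OF t(1)]
    obtain V p s where p: "p \<in> Hom C V W" "epi_arr C p" "s \<in> Hom C V X" "f \<cdot> s = t \<cdot> p"
      using lift[OF t] by blast
    note [simp] = p(1,3)[simplified] Hom_Obj[OF p(1)]
    have "(q \<cdot> t) \<cdot> p = q \<cdot> (f \<cdot> s)" using p(4) by simp
    also have "\<dots> = Zero C V Q" using precomp[OF qf, of s] by simp
    finally have "q \<cdot> t = Zero C W Q" using epi_zero[OF p(2), of "q \<cdot> t" V Q] by simp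
    then obtain u where "u \<in> Hom C W I" "m \<cdot> u = t" using kernel_factor[OF m, of t W] by auto
    then show "\<exists>u \<in> Hom C W I. m \<cdot> u = t" by blast
  qed
  then show ?thesis unfolding exact_at_def is_image_def using q m by blast
qed

lemma zero_obj_in_Obj: "zero_obj C Z \<Longrightarrow> Z \<in> Obj C"
  by (simp add: zero_obj_def)

lemma exact_at_mono:
  assumes Z: "zero_obj C Z" and f: "f \<in> Hom C X Y"
  shows "exact_at C (Zero C Z X) f \<longleftrightarrow> mono_arr C f"
proof
  note [simp] = zero_obj_in_Obj[OF Z] f[simplified] Hom_Obj[OF f]
  { assume ex: "exact_at C (Zero C Z X) f"
    have "t = Zero C (Dom C t) X"
      if t: "t \<in> Arr C" "Cod C t = X" "f \<cdot> t = Zero C (Dom C t) Y" for t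
    proof -
      define W where "W = Dom C t"
      have tt: "t \<in> Hom C W X" and ft: "f \<cdot> t = Zero C W Y" using t by (simp_all add: W_def)
      note [simp] = tt[simplified] Hom_Obj[OF tt]
      have z: "Zero C Z X \<in> Hom C Z X" by simp
      obtain V p s where p: "p \<in> Hom C V W" "epi_arr C p" "s \<in> Hom C V Z" "Zero C Z X \<cdot> s = t \<cdot> p"
        using exact_at_lift[OF ex z f tt ft] .
      note [simp] = p(1,3)[simplified] Hom_Obj[OF p(1)]
      have "t \<cdot> p = Zero C V X" using p(4) by simp
      then show ?thesis using epi_zero[OF p(2), of t V X] by simp
    qed
    then show "mono_arr C f" unfolding mono_iff by simp }
  assume m: "mono_arr C f"
  show "exact_at C (Zero C Z X) f"
  proof (rule exact_atI[of _ Z X f Y])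
    fix W t assume t: "t \<in> Hom C W X" "f \<cdot> t = Zero C W Y"
    note [simp] = t(1)[simplified] Hom_Obj[OF t(1)]
    have "t = Zero C W X" using mono_zero[OF m t(2)] by simp
    then have "Zero C Z X \<cdot> Zero C W Z = t \<cdot> Ident C W" by simp
    moreover have "Ident C W \<in> Hom C W W" "Zero C W Z \<in> Hom C W Z" "epi_arr C (Ident C W)"
      using epi_Ident by simp_all
    ultimately show "\<exists>V p s. p \<in> Hom C V W \<and> epi_arr C p \<and> s \<in> Hom C V Z \<and> Zero C Z X \<cdot> s = t \<cdot> p"
      by blast
  qed simp_all
qed

lemma exact_at_epi:
  assumes Z: "zero_obj C Z" and f: "f \<in> Hom C X Y"
  shows "exact_at C f (Zero C Y Z) \<longleftrightarrow> epi_arr C f"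
proof
  note [simp] = zero_obj_in_Obj[OF Z] f[simplified] Hom_Obj[OF f]
  { assume ex: "exact_at C f (Zero C Y Z)"
    have z: "Zero C Y Z \<in> Hom C Y Z" "Ident C Y \<in> Hom C Y Y" "Zero C Y Z \<cdot> Ident C Y = Zero C Y Z"
      by simp_all
    obtain V p s where p: "p \<in> Hom C V Y" "epi_arr C p" "s \<in> Hom C V X" "f \<cdot> s = Ident C Y \<cdot> p"
      using exact_at_lift[OF ex f z] .
    note [simp] = p(1,3)[simplified] Hom_Obj[OF p(1)]
    show "epi_arr C f" by (rule epi_Comp_left[of f s]) (use p(2,4) in simp_all) }
  assume e: "epi_arr C f"
  show "exact_at C f (Zero C Y Z)"
  proof (rule exact_atI[OF f])
    fix W t assume t: "t \<in> Hom C W Y" "Zero C Y Z \<cdot> t = Zero C W Z"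
    show "\<exists>V p s. p \<in> Hom C V W \<and> epi_arr C p \<and> s \<in> Hom C V X \<and> f \<cdot> s = t \<cdot> p"
      using epi_pullback[OF e f t(1)] by metis
  qed simp_all
qed

lemma exact_at_ses:
  assumes "ses X k E p Y"
  shows "exact_at C k p"
proof (rule exact_atI[of k X E p Y])
  note [simp] = sesD[OF assms]
  show "k \<in> Hom C X E" "p \<in> Hom C E Y" "p \<cdot> k = Zero C X Y" by simp_all
  fix W t assume t: "t \<in> Hom C W E" "p \<cdot> t = Zero C W Y"
  note [simp] = t(1)[simplified] Hom_Obj[OF t(1)]
  obtain u where u: "u \<in> Hom C W X" "k \<cdot> u = t" using ses_factor[OF assms t] .
  have "Ident C W \<in> Hom C W W" "epi_arr C (Ident C W)" "k \<cdot> u = t \<cdot> Ident C W"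
    using u epi_Ident by simp_all
  then show "\<exists>V q s. q \<in> Hom C V W \<and> epi_arr C q \<and> s \<in> Hom C V X \<and> k \<cdot> s = t \<cdot> q"
    using u(1) by blast
qed

lemma sesI_exact:
  assumes "exact_at C k p" "mono_arr C k" "epi_arr C p" "k \<in> Hom C X E" "p \<in> Hom C E Y"
  shows "ses X k E p Y"
  using exact_at_lift[OF assms(1,4,5)] exact_atD_zero[OF assms(1,4,5)]
  by (intro sesI_local[OF assms(4,5,2,3)]) metis+

lemma exact_at_Comp_mono:
  assumes k: "mono_arr C k" "k \<in> Hom C X E" and q: "q \<in> Hom C W X"
  shows "exact_at C g (k \<cdot> q) \<longleftrightarrow> exact_at C g q"
proof -
  note [simp] = k(2)[simplified] q[simplified] Hom_Obj[OF q] Hom_Obj[OF k(2)]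
  have kq: "k \<cdot> q \<in> Hom C W E" by simp
  have z: "(k \<cdot> q) \<cdot> t = Zero C V E \<longleftrightarrow> q \<cdot> t = Zero C V X" if t: "t \<in> Hom C V W" for t V
  proof -
    note [simp] = t[simplified] Hom_Obj[OF t]
    show ?thesis using mono_zero[OF k(1), of "q \<cdot> t" V E] by auto
  qed
  show ?thesis
  proof
    assume e: "exact_at C g (k \<cdot> q)"
    have g: "g \<in> Hom C (Dom C g) W" using exact_atD[OF e] by simp
    show "exact_at C g q"
      using exact_at_lift[OF e g kq] z exact_atD_zero[OF e g kq] z[OF g]
      by (intro exact_atI[OF g q]) metis+
  next
    assume e: "exact_at C g q"
    have g: "g \<in> Hom C (Dom C g) W" using exact_atD[OF e] by simp
    show "exact_at C g (k \<cdot> q)"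
      using exact_at_lift[OF e g q] z exact_atD_zero[OF e g q] z[OF g]
      by (intro exact_atI[OF g kq]) metis+
  qed
qed

text \<open>A local lift along f is lifted once more along p, at the price of a second
  cover.\<close>

lemma exact_at_Comp_epi:
  assumes ex: "exact_at C f g" and p: "epi_arr C p" "p \<in> Hom C W X" and f: "f \<in> Hom C X Y"
  shows "exact_at C (f \<cdot> p) g"
proof -
  define Z where "Z = Cod C g"
  have g: "g \<in> Hom C Y Z" using exact_atD[OF ex] f by (simp add: Z_def)
  note [simp] = p(2)[simplified] f[simplified] g[simplified]
    Hom_Obj[OF p(2)] Hom_Obj[OF f] Hom_Obj[OF g]
  show ?thesis
  proof (rule exact_atI[of _ W Y g Z])
    show "g \<cdot> (f \<cdot> p) = Zero C W Z" using precomp[OF exact_atD_zero[OF ex f g], of p] by simp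
    fix V t assume t: "t \<in> Hom C V Y" "g \<cdot> t = Zero C V Z"
    note [simp] = t(1)[simplified] Hom_Obj[OF t(1)]
    obtain U r s where r: "r \<in> Hom C U V" "epi_arr C r" "s \<in> Hom C U X" "f \<cdot> s = t \<cdot> r"
      using exact_at_lift[OF ex f g t] .
    note [simp] = r(1,3)[simplified] Hom_Obj[OF r(1)]
    obtain U' a b where b: "a \<in> Hom C U' W" "b \<in> Hom C U' U" "p \<cdot> a = s \<cdot> b" "epi_arr C b"
      using epi_pullback[OF p r(3)] .
    note [simp] = b(1,2)[simplified] Hom_Obj[OF b(1)]
    have "(f \<cdot> p) \<cdot> a = t \<cdot> (r \<cdot> b)" using b(3) precomp[OF r(4), of b] by simp
    moreover have "r \<cdot> b \<in> Hom C U' V" "epi_arr C (r \<cdot> b)" using epi_Comp[OF b(4) r(2)] by simp_all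
    ultimately show "\<exists>U r s. r \<in> Hom C U V \<and> epi_arr C r \<and> s \<in> Hom C U W \<and> (f \<cdot> p) \<cdot> s = t \<cdot> r"
      using b(1) by blast
  qed simp_all
qed

text \<open>Lists are reversed compared with \<open>exact_seq\<close>: the head is the rightmost arrow.\<close>

fun left_exact :: "'b list \<Rightarrow> bool" where
  "left_exact [] \<longleftrightarrow> False"
| "left_exact [f] \<longleftrightarrow> mono_arr C f"
| "left_exact (f # g # rs) \<longleftrightarrow> exact_at C g f \<and> left_exact (g # rs)"

lemma exact_seq_snoc: "exact_seq C (fs @ [f, g]) \<longleftrightarrow> exact_seq C (fs @ [f]) \<and> exact_at C f g"
proof -
  have "(\<forall>i. i < Suc (length fs) \<longrightarrow> Q i) \<longleftrightarrow> (\<forall>i. i < length fs \<longrightarrow> Q i) \<and> Q (length fs)" for Q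
    by (auto simp: less_Suc_eq)
  then show ?thesis
    unfolding exact_seq_def by (simp add: nth_append)
qed

lemma exact_seq_zero_rev:
  assumes "rs \<noteq> []" "zero_obj C Z"
  shows "exact_seq C (Zero C Z (Dom C (last rs)) # rev rs) \<longleftrightarrow> left_exact rs"
  using assms
proof (induction rs rule: left_exact.induct)
  case (2 f)
  have "exact_at C (Zero C Z (Dom C f)) f \<longleftrightarrow> mono_arr C f"
    using exact_at_mono[OF 2(2), of f "Dom C f" "Cod C f"] exact_atD(2) mono_arrD by auto
  then show ?case using exact_seq_snoc[of "[]" "Zero C Z (Dom C f)" f] by (simp add: exact_seq_def)
next
  case (3 f g rs)
  then show ?case
    using exact_seq_snoc[of "Zero C Z (Dom C (last (g # rs))) # rev rs" g f] by auto
qed simp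

text \<open>The zeros at the ends are absorbed: the left one makes the last entry of the reversed
  list monic, the right one makes its head epic. Neither condition depends on the zero objects
  chosen, so their quantifiers disappear.\<close>

lemma exact_with_zeros_rev: "exact_with_zeros C (rev rs) \<longleftrightarrow> left_exact rs \<and> epi_arr C (hd rs)"
proof (cases rs)
  case Nil
  then show ?thesis by (simp add: exact_with_zeros_def)
next
  case (Cons f rs')
  have last: "exact_at C f (Zero C (Cod C f) Z) \<longleftrightarrow> epi_arr C f" if "zero_obj C Z" for Z
    using exact_at_epi[OF that, of f "Dom C f" "Cod C f"] exact_atD(1) epi_arrD by auto
  have "exact_seq C ([Zero C Z (Dom C (hd (rev rs)))] @ rev rs @ [Zero C (Cod C (last (rev rs))) Z'])
      \<longleftrightarrow> left_exact rs \<and> epi_arr C f" if "zero_obj C Z" "zero_obj C Z'" for Z Z'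
    using exact_seq_snoc[of "Zero C Z (Dom C (last rs)) # rev rs'" f "Zero C (Cod C f) Z'"]
      exact_seq_zero_rev[of rs Z] last that Cons
    by (cases "rs' = []") (auto simp: hd_rev last_rev)
  then show ?thesis
    unfolding exact_with_zeros_def using Cons ex_zero_obj by (metis list.sel(1) rev_is_Nil_conv list.distinct(1))
qed

lemma short_exact_iff:
  assumes "f \<in> Hom C X E" "g \<in> Hom C E Y"
  shows "short_exact C f g \<longleftrightarrow> ses X f E g Y"
  unfolding short_exact_def
  using exact_with_zeros_rev[of "[g, f]"] sesI_exact[of f g X E Y] assms exact_at_ses ses_mono ses_epi
  by auto

lemma left_exact_splice:
  assumes "left_exact (q # rs)" "epi_arr C q" "q \<in> Hom C W X" and s: "ses X k E p Y"
  shows "left_exact (p # (k \<cdot> q) # rs)"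
proof -
  note [simp] = sesD[OF s] assms(3)[simplified]
  have "left_exact ((k \<cdot> q) # rs)"
    using assms(1) exact_at_Comp_mono[OF ses_mono[OF s] _ assms(3), of E] mono_Comp[OF _ ses_mono[OF s]]
    by (cases rs) auto
  moreover have "exact_at C (k \<cdot> q) p"
    by (rule exact_at_Comp_epi[OF exact_at_ses[OF s] assms(2,3)]) simp
  ultimately show ?thesis by simp
qed

lemma left_exact_unsplice:
  assumes "left_exact (f # g # rs)" "epi_arr C f" "f \<in> Hom C E Y"
  obtains X k q where "ses X k E f Y" "q \<in> Hom C (Dom C g) X" "k \<cdot> q = g" "epi_arr C q"
    "left_exact (q # rs)"
proof -
  have ex: "exact_at C g f" using assms(1) by simp
  define W where "W = Dom C g"
  have g: "g \<in> Hom C W E" using exact_atD[OF ex] assms(3) by (simp add: W_def)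
  note [simp] = g[simplified] assms(3)[simplified] Hom_Obj[OF g] Hom_Obj[OF assms(3)]
  obtain X k where s: "ses X k E f Y" using ses_of_epi[OF assms(2,3)] .
  note [simp] = sesD[OF s]
  obtain q where q: "q \<in> Hom C W X" "k \<cdot> q = g"
    using ses_factor[OF s g exact_atD_zero[OF ex g assms(3)]] .
  note [simp] = q(1)[simplified]
  \<comment> \<open>The inclusion k is itself an element killed by f. Lifting it along g after a
    cover p gives \<open>q \<cdot> t = p\<close>, which makes q epic.\<close>
  have k: "k \<in> Hom C X E" "f \<cdot> k = Zero C X Y" by simp_all
  obtain V p t where p: "p \<in> Hom C V X" "epi_arr C p" "t \<in> Hom C V W" "g \<cdot> t = k \<cdot> p"
    using exact_at_lift[OF ex g assms(3) k] .
  note [simp] = p(1,3)[simplified] Hom_Obj[OF p(1)]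
  have "k \<cdot> (q \<cdot> t) = k \<cdot> p" using p(4) unfolding q(2)[symmetric] by simp
  then have "q \<cdot> t = p" by (rule mono_cancel[OF ses_mono[OF s]]) simp_all
  then have "epi_arr C q" using p(2) by (intro epi_Comp_left[of q t]) simp_all
  moreover have "left_exact (q # rs)"
    using assms(1) exact_at_Comp_mono[OF ses_mono[OF s] k(1) q(1)] mono_Comp_right[of k q] q(2)
    by (cases rs) auto
  ultimately show ?thesis using that[of X k q] s q by simp
qed

text \<open>Splicing a short exact sequence at the left end Y moves this end to X. It represents the
  connecting map from Ext^i(-, Y) to Ext^{i+1}(-, X) on the level of sequences.\<close>

lemma left_exact_append_ses:
  assumes "left_exact (rs @ [f])" "f \<in> Hom C Y W" and s: "ses X k E p Y"
  shows "left_exact (rs @ [f \<cdot> p, k])"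
  using assms(1)
proof (induction rs rule: left_exact.induct)
  case 1
  then have m: "mono_arr C f" by simp
  have "exact_at C k (f \<cdot> p)"
    using exact_at_Comp_mono[OF m assms(2), of p E k] sesD[OF s] exact_at_ses[OF s] by simp
  then show ?case using ses_mono[OF s] by simp
next
  case (2 g)
  then have m: "mono_arr C f" by simp
  have "exact_at C k (f \<cdot> p)"
    using exact_at_Comp_mono[OF m assms(2), of p E k] sesD[OF s] exact_at_ses[OF s] by simp
  moreover have "exact_at C (f \<cdot> p) g"
    by (rule exact_at_Comp_epi[OF _ ses_epi[OF s] _ assms(2)]) (use 2 sesD[OF s] in auto)
  ultimately show ?case using ses_mono[OF s] by simp
qed simp_all

section \<open>Effaceability of extensions\<close>

lemma ses_Ident:
  assumes Z: "zero_obj C Z" and N: "N \<in> Obj C"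
  shows "ses Z (Zero C Z N) N (Ident C N) N"
proof (rule sesI)
  note [simp] = N zero_obj_in_Obj[OF Z]
  show "mono_arr C (Zero C Z N)" "Zero C Z N \<in> Hom C Z N" "Ident C N \<in> Hom C N N" "epi_arr C (Ident C N)"
    "Ident C N \<cdot> Zero C Z N = Zero C Z N"
    unfolding mono_iff using zero_obj_eq(2)[OF Z] by (simp_all add: epi_Ident)
  show "\<exists>v \<in> Hom C W Z. Zero C Z N \<cdot> v = t" if t: "t \<in> Hom C W N" "Ident C N \<cdot> t = Zero C W N" for W t
    using t Hom_Obj[OF t(1)] by (intro bexI[of _ "Zero C W Z"]) simp_all
qed

text \<open>The class of an extension is effaced by lifting along an epimorphism \<open>p\<close> and continuing with
  the restriction of the lift to the kernel of \<open>p\<close>. The last arrow of the list, the inclusion of the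
  left end, does not enter.\<close>

fun erased :: "'b list \<Rightarrow> 'b \<Rightarrow> bool" where
  "erased [f, e] y \<longleftrightarrow> (\<exists>u. u \<in> Hom C (Dom C y) (Dom C f) \<and> f \<cdot> u = y)"
| "erased (f # g # h # rs) y \<longleftrightarrow> (\<exists>K k V p u. ses K k V p (Dom C y) \<and>
    u \<in> Hom C V (Dom C f) \<and> f \<cdot> u = y \<cdot> p \<and> erased (g # h # rs) (u \<cdot> k))"
| "erased _ y \<longleftrightarrow> False"

text \<open>A morphism of extensions read from right to left: \<open>h\<close> is the vertical arrow
  at the current codomain, \<open>b\<close> the one prescribed at the far left. It is kept arbitrary
  because dimension shifting compares extensions with different left ends; Yoneda equivalence takes
  an identity there.\<close>

fun ladder :: "'b \<Rightarrow> 'b \<Rightarrow> 'b list \<Rightarrow> 'b list \<Rightarrow> bool" where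
  "ladder b h [] [] \<longleftrightarrow> h = b"
| "ladder b h (f # rs) (g # ss) \<longleftrightarrow> h \<in> Hom C (Cod C f) (Cod C g) \<and>
    (\<exists>h'. h' \<in> Hom C (Dom C f) (Dom C g) \<and> h \<cdot> f = g \<cdot> h' \<and> ladder b h' rs ss)"
| "ladder b h _ _ \<longleftrightarrow> False"

lemma ladder_length: "ladder b h rs ss \<Longrightarrow> length ss = length rs"
  by (induction b h rs ss rule: ladder.induct) auto

lemma left_exact_arr: "left_exact rs \<Longrightarrow> f \<in> set rs \<Longrightarrow> f \<in> Arr C"
  by (induction rs rule: left_exact.induct) (auto dest: exact_atD mono_arrD)

text \<open>The first cover is pulled back along x. Its kernel stays the same, so the later covers
  are reused unchanged.\<close>

lemma erased_precomp:
  assumes "erased rs y" "left_exact rs" "y \<in> Hom C N (Cod C (hd rs))" "x \<in> Hom C N' N"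
  shows "erased rs (y \<cdot> x)"
  using assms(1-3)
proof (induction rs y rule: erased.induct)
  case (1 f e y)
  then have y: "f \<in> Arr C" "y \<in> Hom C N (Cod C f)" using left_exact_arr[OF 1(2)] by auto
  note [simp] = y(1) y(2)[simplified] assms(4)[simplified]
  obtain u where u: "u \<in> Hom C N (Dom C f)" "f \<cdot> u = y" using 1 by auto
  note [simp] = u(1)[simplified]
  have "f \<cdot> (u \<cdot> x) = y \<cdot> x" using precomp[OF u(2), of x] by simp
  then show ?case unfolding erased.simps by (intro exI[of _ "u \<cdot> x"]) simp
next
  case (2 f g h rs' y)
  then have y: "f \<in> Arr C" "y \<in> Hom C N (Cod C f)" using left_exact_arr[OF 2(3)] by auto
  note [simp] = y(1) y(2)[simplified] assms(4)[simplified] Hom_Obj[OF assms(4)]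
  obtain K k V p u where s: "ses K k V p N" and u: "u \<in> Hom C V (Dom C f)" "f \<cdot> u = y \<cdot> p"
    "erased (g # h # rs') (u \<cdot> k)"
    using 2 by auto
  note [simp] = sesD[OF s] u(1)[simplified]
  obtain V' k' p' e where s': "ses K k' V' p' N'" "e \<in> Hom C V' V" "e \<cdot> k' = k" "p \<cdot> e = x \<cdot> p'"
    using ses_pullback[OF s assms(4)] .
  note [simp] = sesD[OF s'(1)] s'(2)[simplified]
  have "f \<cdot> (u \<cdot> e) = (y \<cdot> x) \<cdot> p'" using precomp[OF u(2), of e] s'(4) by simp
  moreover have "erased (g # h # rs') ((u \<cdot> e) \<cdot> k')" using u(3) s'(3) by simp
  moreover have "ses K k' V' p' (Dom C (y \<cdot> x))" "u \<cdot> e \<in> Hom C V' (Dom C f)"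
    using s'(1) by simp_all
  ultimately show ?case unfolding erased.simps by blast
qed simp_all

text \<open>An arrow that already lifts is handled by the identity cover, whose kernel is zero. What
  remains is a zero arrow, which lifts along the next head in turn.\<close>

lemma erased_Comp_hd:
  assumes "left_exact (f # g # rs)" "u \<in> Hom C N (Dom C f)"
  shows "erased (f # g # rs) (f \<cdot> u)"
  using assms
proof (induction rs arbitrary: f g u N)
  case Nil
  have "f \<in> Arr C" using left_exact_arr[OF Nil(1)] by simp
  then show ?case using Nil(2) by auto
next
  case (Cons h rs)
  have "exact_at C g f" using Cons(2) by simp
  note [simp] = exact_atD[OF this] Cons(3)[simplified] Hom_Obj[OF Cons(3)]
  obtain Z where Z: "zero_obj C Z" "Z \<in> Obj C" using zero_object .
  note [simp] = Z(2)
  have "ses Z (Zero C Z N) N (Ident C N) N" using ses_Ident[OF Z(1)] by simp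
  moreover have "erased (g # h # rs) (u \<cdot> Zero C Z N)"
    using Cons(1)[of g h "Zero C Z (Dom C g)" Z] Cons(2) by simp
  moreover have "f \<cdot> u = (f \<cdot> u) \<cdot> Ident C N" by simp
  moreover have "Dom C (f \<cdot> u) = N" by simp
  ultimately show ?case unfolding erased.simps using Cons(3) by metis
qed

text \<open>The covers of y and y' are refined to a common one by a pullback. Its kernel maps to
  both old kernels, so the two restricted lifts can be subtracted there.\<close>

lemma erased_Minus:
  assumes "erased rs y" "erased rs y'" "left_exact rs" "y \<in> Hom C N (Cod C (hd rs))"
    "y' \<in> Hom C N (Cod C (hd rs))"
  shows "erased rs (y \<ominus> y')"
  using assms
proof (induction rs y arbitrary: N y' rule: erased.induct)
  case (1 f e y)
  have f: "f \<in> Arr C" using left_exact_arr[OF 1(3)] by simp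
  note [simp] = f 1(4,5)[simplified]
  obtain u u' where u: "u \<in> Hom C N (Dom C f)" "f \<cdot> u = y" "u' \<in> Hom C N (Dom C f)" "f \<cdot> u' = y'"
    using 1(1,2) by auto
  note [simp] = u(1,3)[simplified]
  have "f \<cdot> (u \<ominus> u') = y \<ominus> y'" using u(2,4) by simp
  then show ?case unfolding erased.simps by (intro exI[of _ "u \<ominus> u'"]) simp
next
  case (2 f g h rs y)
  have "exact_at C g f" using 2(4) by simp
  note [simp] = exact_atD(1,2)[OF this] exact_atD(3)[OF this] 2(5,6)[simplified]
  obtain K k V p u where s: "ses K k V p N" and u: "u \<in> Hom C V (Dom C f)" "f \<cdot> u = y \<cdot> p"
    "erased (g # h # rs) (u \<cdot> k)"
    using 2(2) by auto
  obtain K' k' V' p' u' where s': "ses K' k' V' p' N" and u': "u' \<in> Hom C V' (Dom C f)"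
    "f \<cdot> u' = y' \<cdot> p'" "erased (g # h # rs) (u' \<cdot> k')"
    using 2(3) by auto
  note [simp] = sesD[OF s] u(1)[simplified] sesD[OF s'] u'(1)[simplified]
  have pH: "p \<in> Hom C V N" "p' \<in> Hom C V' N" by simp_all
  obtain P a b where ab: "a \<in> Hom C P V" "b \<in> Hom C P V'" "p \<cdot> a = p' \<cdot> b" "epi_arr C b"
    using epi_pullback[OF ses_epi[OF s] pH] .
  note [simp] = ab(1,2)[simplified] Hom_Obj[OF ab(1)]
  have "epi_arr C (p' \<cdot> b)" using epi_Comp[OF ab(4) ses_epi[OF s']] by simp
  then obtain L l where l: "ses L l P (p' \<cdot> b) N" by (rule ses_of_epi) simp_all
  note [simp] = sesD(1-3,7-9)[OF l]
  have z: "p' \<cdot> (b \<cdot> l) = Zero C L N" using sesD(10)[OF l] by simp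
  then have z': "p \<cdot> (a \<cdot> l) = Zero C L N" using precomp[OF ab(3), of l] by simp
  obtain t where t: "t \<in> Hom C L K" "k \<cdot> t = a \<cdot> l"
    using ses_factor[OF s, of "a \<cdot> l" L] z' by auto
  obtain t' where t': "t' \<in> Hom C L K'" "k' \<cdot> t' = b \<cdot> l"
    using ses_factor[OF s', of "b \<cdot> l" L] z by auto
  note [simp] = t(1)[simplified] t'(1)[simplified]
  have le: "left_exact (g # h # rs)" using 2(4) by simp
  have "erased (g # h # rs) ((u \<cdot> k) \<cdot> t)" by (rule erased_precomp[OF u(3) le]) simp_all
  moreover have "erased (g # h # rs) ((u' \<cdot> k') \<cdot> t')" by (rule erased_precomp[OF u'(3) le]) simp_all
  ultimately have "erased (g # h # rs) ((u \<cdot> k) \<cdot> t \<ominus> (u' \<cdot> k') \<cdot> t')"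
    by (rule 2(1)[OF _ _ le]) simp_all
  then have "erased (g # h # rs) ((u \<cdot> a \<ominus> u' \<cdot> b) \<cdot> l)" using t(2) t'(2) by simp
  moreover have "f \<cdot> (u \<cdot> a \<ominus> u' \<cdot> b) = (y \<ominus> y') \<cdot> (p' \<cdot> b)"
    using precomp[OF u(2), of a] precomp[OF u'(2), of b] ab(3) by simp
  moreover have "u \<cdot> a \<ominus> u' \<cdot> b \<in> Hom C P (Dom C f)" by simp
  moreover have "ses L l P (p' \<cdot> b) (Dom C (y \<ominus> y'))" using l by simp
  ultimately show ?case unfolding erased.simps by blast
qed simp_all

text \<open>The covers stay the same, and the lifts are composed with the vertical arrows.\<close>

lemma erased_ladder:
  assumes "erased rs y" "ladder b h rs ss" "left_exact rs" "left_exact ss"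
    "y \<in> Hom C N (Cod C (hd rs))"
  shows "erased ss (h \<cdot> y)"
  using assms
proof (induction rs y arbitrary: ss h N rule: erased.induct)
  case (1 f e y)
  obtain f' e' where ss: "ss = [f', e']"
    using ladder_length[OF 1(2)] by (auto simp: length_Suc_conv)
  then obtain h' where h: "h \<in> Hom C (Cod C f) (Cod C f')"
    "h' \<in> Hom C (Dom C f) (Dom C f')" "h \<cdot> f = f' \<cdot> h'"
    using 1(2) by auto
  have f: "f \<in> Arr C" "f' \<in> Arr C" using left_exact_arr[OF 1(3)] left_exact_arr[OF 1(4)] ss by simp_all
  note [simp] = f h(1,2)[simplified] 1(5)[simplified]
  obtain u where u: "u \<in> Hom C N (Dom C f)" "f \<cdot> u = y" using 1(1) by auto
  note [simp] = u(1)[simplified]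
  have "f' \<cdot> (h' \<cdot> u) = h \<cdot> y" using precomp[OF h(3), of u] u(2) by simp
  then show ?case unfolding ss erased.simps by (intro exI[of _ "h' \<cdot> u"]) simp
next
  case (2 f g e rs y)
  obtain f' g' e' rs' where ss: "ss = f' # g' # e' # rs'"
    using ladder_length[OF 2(3)] by (auto simp: length_Suc_conv)
  obtain h' where h: "h \<in> Hom C (Cod C f) (Cod C f')"
    "h' \<in> Hom C (Dom C f) (Dom C f')" "h \<cdot> f = f' \<cdot> h'" "ladder b h' (g # e # rs) (g' # e' # rs')"
    using 2(3) unfolding ss ladder.simps(2)[of b h] by blast
  have ex: "exact_at C g f" "exact_at C g' f'" using 2(4,5) ss by simp_all
  note [simp] = exact_atD[OF ex(1)] exact_atD[OF ex(2)] h(1,2)[simplified] 2(6)[simplified]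
  obtain K k V p u where s: "ses K k V p N" and u: "u \<in> Hom C V (Dom C f)" "f \<cdot> u = y \<cdot> p"
    "erased (g # e # rs) (u \<cdot> k)"
    using 2(2) by auto
  note [simp] = sesD[OF s] u(1)[simplified]
  have "erased (g' # e' # rs') (h' \<cdot> (u \<cdot> k))"
    by (rule 2(1)[OF u(3) h(4)]) (use 2(4,5) ss in simp_all)
  then have "erased (g' # e' # rs') ((h' \<cdot> u) \<cdot> k)" by simp
  moreover have "f' \<cdot> (h' \<cdot> u) = (h \<cdot> y) \<cdot> p"
    using precomp[OF h(3), of u] u(2) by simp
  moreover have "h' \<cdot> u \<in> Hom C V (Dom C f')" "ses K k V p (Dom C (h \<cdot> y))" using s by simp_all
  ultimately show ?case unfolding ss erased.simps by blast
qed simp_all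

text \<open>The hard direction of invariance, from the target of a morphism back to its source; it
  depends on equal left ends. A lift u in the target and the image of a local lift s in the source
  agree under the target head, so they differ locally by an arrow through the next entry. This
  discrepancy is moved to the left until it reaches the common end B. The cover q and the local lift
  s are carried along because the induction can supply them: at the start from the epic head, later
  from exactness.\<close>

lemma erased_ladder_reflect:
  assumes "erased ss (h \<cdot> y)" "ladder (Ident C B) h rs ss" "left_exact rs" "left_exact ss"
    "y \<in> Hom C N (Cod C (hd rs))" "B \<in> Obj C"
    "q \<in> Hom C V N" "epi_arr C q" "s \<in> Hom C V (Dom C (hd rs))" "hd rs \<cdot> s = y \<cdot> q"
  shows "erased rs y"
  using assms
proof (induction rs arbitrary: ss h y N q V s rule: left_exact.induct)
  case 1
  then show ?case by simp
next
  case (2 f)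
  then show ?case using ladder_length[OF 2(2)] by (auto simp: length_Suc_conv)
next
  case (3 f g rs)
  show ?case
  proof (cases rs)
    case Nil
    obtain f' g' where ss: "ss = [f', g']"
      using ladder_length[OF 3(3)] Nil by (auto simp: length_Suc_conv)
    obtain h' where h: "h \<in> Hom C (Cod C f) (Cod C f')" "h' \<in> Hom C (Dom C f) (Dom C f')"
      "h \<cdot> f = f' \<cdot> h'" and h'g: "h' \<cdot> g = g' \<cdot> Ident C B"
      and B: "Ident C B \<in> Hom C (Dom C g) (Dom C g')"
      using 3(3) unfolding ss Nil by auto
    have ex: "exact_at C g f" "exact_at C g' f'" and mono: "mono_arr C g" "mono_arr C g'"
      using 3(4,5) ss Nil by simp_all
    have d: "Dom C g = B" "Dom C g' = B" using B 3(7) by auto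
    define A M A' M' where "A = Dom C f" and "M = Cod C f" and "A' = Dom C f'" and "M' = Cod C f'"
    have ty: "f \<in> Hom C A M" "g \<in> Hom C B A" "f' \<in> Hom C A' M'" "g' \<in> Hom C B A'"
      "h \<in> Hom C M M'" "h' \<in> Hom C A A'" "y \<in> Hom C N M" "s \<in> Hom C V A"
      using exact_atD[OF ex(1)] exact_atD[OF ex(2)] d h 3(6,10)
      by (simp_all add: A_def M_def A'_def M'_def)
    note [simp] = ty[simplified] 3(7) 3(8)[simplified] Hom_Obj[OF ty(1)] Hom_Obj[OF ty(3)]
      Hom_Obj[OF 3(8)]
    have h'g: "h' \<cdot> g = g'" using h'g by simp
    have fs: "f \<cdot> s = y \<cdot> q" using 3(11) by simp
    have fg: "f \<cdot> g = Zero C B M" by (rule exact_atD_zero[OF ex(1) ty(2,1)])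
    obtain u where u: "u \<in> Hom C N A'" "f' \<cdot> u = h \<cdot> y" using 3(2) unfolding ss by auto
    note [simp] = u(1)[simplified]
    have "f' \<cdot> (h' \<cdot> s \<ominus> u \<cdot> q) = Zero C V M'"
      using precomp[OF h(3), of s] precomp[OF u(2), of q] fs by simp
    moreover have "h' \<cdot> s \<ominus> u \<cdot> q \<in> Hom C V A'" by simp
    ultimately obtain V' r b where r: "r \<in> Hom C V' V" "epi_arr C r" "b \<in> Hom C V' B"
      and gb: "g' \<cdot> b = (h' \<cdot> s \<ominus> u \<cdot> q) \<cdot> r"
      using exact_at_lift[OF ex(2) ty(4,3)] by metis
    note [simp] = r(1,3)[simplified] Hom_Obj[OF r(1)]
    have gb: "g' \<cdot> b = h' \<cdot> (s \<cdot> r) \<ominus> u \<cdot> (q \<cdot> r)" using gb by simp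
    \<comment> \<open>The discrepancy b takes values in the common left end, so it can be corrected
      in the source. Afterwards the image of \<open>s'\<close> in the target is
      \<open>u \<cdot> (q \<cdot> r)\<close>, which comes from N.\<close>
    define s' where "s' = s \<cdot> r \<ominus> g \<cdot> b"
    have [simp]: "s' \<in> Arr C" "Dom C s' = V'" "Cod C s' = A" by (simp_all add: s'_def)
    have fs': "f \<cdot> s' = y \<cdot> (q \<cdot> r)"
      using precomp[OF fs, of r] precomp[OF fg, of b] by (simp add: s'_def)
    have "h' \<cdot> s' = h' \<cdot> (s \<cdot> r) \<ominus> g' \<cdot> b"
      using precomp[OF h'g, of b] by (simp add: s'_def)
    then have hs': "h' \<cdot> s' = u \<cdot> (q \<cdot> r)" unfolding gb by (simp add: Minus_Minus)
    have "epi_arr C (q \<cdot> r)" by (rule epi_Comp[OF r(2) 3(9)]) simp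
    then obtain K \<kappa> where K: "ses K \<kappa> V' (q \<cdot> r) N" by (rule ses_of_epi) simp_all
    note [simp] = sesD(1-3,7-9)[OF K]
    have z: "q \<cdot> (r \<cdot> \<kappa>) = Zero C K N" using sesD(10)[OF K] by simp
    \<comment> \<open>For the descent to N, \<open>s'\<close> has to vanish on the kernel of the
      cover. There it comes locally from some c into B, and c is zero because \<open>g'\<close> is
      monic and the image in the target vanishes.\<close>
    have "f \<cdot> (s' \<cdot> \<kappa>) = Zero C K M" using precomp[OF fs', of \<kappa>] z by simp
    moreover have "s' \<cdot> \<kappa> \<in> Hom C K A" by simp
    ultimately obtain W w c where w: "w \<in> Hom C W K" "epi_arr C w" "c \<in> Hom C W B"
      and gc: "g \<cdot> c = (s' \<cdot> \<kappa>) \<cdot> w"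
      using exact_at_lift[OF ex(1) ty(2,1)] by metis
    note [simp] = w(1,3)[simplified] Hom_Obj[OF w(1)]
    have "g' \<cdot> c = h' \<cdot> (s' \<cdot> (\<kappa> \<cdot> w))" using precomp[OF h'g, of c] gc by simp
    also have "\<dots> = Zero C W A'" using precomp[OF hs', of "\<kappa> \<cdot> w"] precomp[OF z, of w] by simp
    finally have "c = Zero C W B" using mono_zero[OF mono(2), of c] by simp
    then have "s' \<cdot> \<kappa> = Zero C K A" using gc epi_zero[OF w(2), of "s' \<cdot> \<kappa>" W A] by simp
    then obtain v where v: "v \<in> Hom C N A" "v \<cdot> (q \<cdot> r) = s'"
      using ses_cofactor[OF K, of s' A] by auto
    note [simp] = v(1)[simplified]
    have "(f \<cdot> v) \<cdot> (q \<cdot> r) = y \<cdot> (q \<cdot> r)" using fs' v(2) by simp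
    then have "f \<cdot> v = y" by (rule epi_cancel[OF \<open>epi_arr C (q \<cdot> r)\<close>]) simp_all
    then show ?thesis unfolding Nil erased.simps by (intro exI[of _ v]) simp
  next
    case (Cons e rs1)
    obtain f' g' e' ss1 where ss: "ss = f' # g' # e' # ss1"
      using ladder_length[OF 3(3)] Cons by (auto simp: length_Suc_conv)
    obtain h' where h: "h \<in> Hom C (Cod C f) (Cod C f')" "h' \<in> Hom C (Dom C f) (Dom C f')"
      "h \<cdot> f = f' \<cdot> h'" "ladder (Ident C B) h' (g # rs) (g' # e' # ss1)"
      using 3(3) unfolding ss ladder.simps(2)[of "Ident C B" h] by blast
    have ex: "exact_at C g f" "exact_at C g' f'" using 3(4,5) ss by simp_all
    have le: "left_exact (g # rs)" "left_exact (g' # e' # ss1)" using 3(4,5) ss by simp_all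
    define A M A' M' D D' where "A = Dom C f" and "M = Cod C f" and "A' = Dom C f'" and "M' = Cod C f'"
      and "D = Dom C g" and "D' = Dom C g'"
    have ty: "f \<in> Hom C A M" "g \<in> Hom C D A" "f' \<in> Hom C A' M'" "g' \<in> Hom C D' A'"
      "h \<in> Hom C M M'" "h' \<in> Hom C A A'" "y \<in> Hom C N M" "s \<in> Hom C V A"
      using exact_atD[OF ex(1)] exact_atD[OF ex(2)] h 3(6,10)
      by (simp_all add: A_def M_def A'_def M'_def D_def D'_def)
    note [simp] = ty[simplified] 3(8)[simplified] Hom_Obj[OF ty(1)] Hom_Obj[OF ty(3)]
      Hom_Obj[OF ty(2)] Hom_Obj[OF ty(4)] Hom_Obj[OF 3(8)]
    have fs: "f \<cdot> s = y \<cdot> q" using 3(11) by simp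
    obtain K k V0 p u where S: "ses K k V0 p N" and u: "u \<in> Hom C V0 A'" "f' \<cdot> u = (h \<cdot> y) \<cdot> p"
      "erased (g' # e' # ss1) (u \<cdot> k)"
      using 3(2) unfolding ss by auto
    note [simp] = sesD[OF S] u(1)[simplified]
    have pq: "p \<in> Hom C V0 N" by simp
    obtain P a b where ab: "a \<in> Hom C P V0" "b \<in> Hom C P V" "p \<cdot> a = q \<cdot> b" "epi_arr C b"
      using epi_pullback[OF ses_epi[OF S] pq 3(8)] .
    note [simp] = ab(1,2)[simplified] Hom_Obj[OF ab(1)]
    have "f' \<cdot> (u \<cdot> a \<ominus> h' \<cdot> (s \<cdot> b)) = Zero C P M'"
      using precomp[OF h(3), of "s \<cdot> b"] precomp[OF u(2), of a] precomp[OF fs, of b] ab(3) by simp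
    moreover have "u \<cdot> a \<ominus> h' \<cdot> (s \<cdot> b) \<in> Hom C P A'" by simp
    ultimately obtain P' r c where r: "r \<in> Hom C P' P" "epi_arr C r" "c \<in> Hom C P' D'"
      and gc: "g' \<cdot> c = (u \<cdot> a \<ominus> h' \<cdot> (s \<cdot> b)) \<cdot> r"
      using exact_at_lift[OF ex(2) ty(4,3)] by metis
    note [simp] = r(1,3)[simplified] Hom_Obj[OF r(1)]
    have gc: "g' \<cdot> c = u \<cdot> (a \<cdot> r) \<ominus> h' \<cdot> (s \<cdot> (b \<cdot> r))" using gc by simp
    have hs: "h' \<cdot> (s \<cdot> (b \<cdot> r)) = u \<cdot> (a \<cdot> r) \<ominus> g' \<cdot> c" unfolding gc by (simp add: Minus_Minus)
    have "epi_arr C (q \<cdot> (b \<cdot> r))"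
      by (rule epi_Comp[OF epi_Comp[OF r(2) ab(4)] 3(9)]) simp_all
    then obtain L l where L: "ses L l P' (q \<cdot> (b \<cdot> r)) N" by (rule ses_of_epi) simp_all
    note [simp] = sesD(1-3,7-9)[OF L]
    have z: "q \<cdot> (b \<cdot> (r \<cdot> l)) = Zero C L N" using sesD(10)[OF L] by simp
    then have "p \<cdot> (a \<cdot> (r \<cdot> l)) = Zero C L N" using precomp[OF ab(3), of "r \<cdot> l"] by simp
    then obtain t where t: "t \<in> Hom C L K" "k \<cdot> t = a \<cdot> (r \<cdot> l)"
      using ses_factor[OF S, of "a \<cdot> (r \<cdot> l)" L] by auto
    note [simp] = t(1)[simplified]
    \<comment> \<open>On the kernel L of the refined cover, the image of \<open>?s\<close> is the
      difference of a restriction of \<open>u \<cdot> k\<close>, which is erased, and an arrow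
      through \<open>g'\<close>, which is erased trivially.\<close>
    let ?s = "s \<cdot> (b \<cdot> (r \<cdot> l))"
    have "erased (g' # e' # ss1) ((u \<cdot> k) \<cdot> t)" by (rule erased_precomp[OF u(3) le(2)]) simp_all
    moreover have "erased (g' # e' # ss1) (g' \<cdot> (c \<cdot> l))"
      by (rule erased_Comp_hd[OF le(2), of _ L]) simp
    ultimately have "erased (g' # e' # ss1) ((u \<cdot> k) \<cdot> t \<ominus> g' \<cdot> (c \<cdot> l))"
      by (rule erased_Minus[OF _ _ le(2), where N = L]) simp_all
    moreover have "(u \<cdot> k) \<cdot> t \<ominus> g' \<cdot> (c \<cdot> l) = h' \<cdot> ?s"
      using precomp[OF hs, of l] t(2) by simp
    ultimately have er: "erased (g' # e' # ss1) (h' \<cdot> ?s)" by simp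
    \<comment> \<open>Exactness now provides the local lift of \<open>?s\<close> along g that the
      induction hypothesis asks for.\<close>
    have "f \<cdot> ?s = Zero C L M" using precomp[OF fs, of "b \<cdot> (r \<cdot> l)"] z by simp
    moreover have "?s \<in> Hom C L A" by simp
    ultimately obtain W w v where w: "w \<in> Hom C W L" "epi_arr C w" "v \<in> Hom C W D" "g \<cdot> v = ?s \<cdot> w"
      using exact_at_lift[OF ex(1) ty(2,1)] by metis
    have "erased (g # rs) ?s"
      by (rule 3(1)[OF er h(4) le _ _ w(1,2) _ _]) (use w(3,4) 3(7) in simp_all)
    moreover have "f \<cdot> (s \<cdot> (b \<cdot> r)) = y \<cdot> (q \<cdot> (b \<cdot> r))" using precomp[OF fs, of "b \<cdot> r"] by simp
    moreover have "s \<cdot> (b \<cdot> r) \<in> Hom C P' (Dom C f)" "(s \<cdot> (b \<cdot> r)) \<cdot> l = ?s" by simp_all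
    moreover have "ses L l P' (q \<cdot> (b \<cdot> r)) (Dom C y)" using L by simp
    ultimately show ?thesis unfolding Cons erased.simps by metis
  qed
qed

section \<open>Yoneda classes and dimension shifting\<close>

lemma exact_with_zeros_nth:
  assumes "exact_with_zeros C fs" "Suc i < length fs"
  shows "exact_at C (fs ! i) (fs ! Suc i)"
proof -
  obtain z w where "exact_seq C ([z] @ fs @ [w])" using assms(1) unfolding exact_with_zeros_def by blast
  then have "exact_at C (([z] @ fs @ [w]) ! Suc i) (([z] @ fs @ [w]) ! Suc (Suc i))"
    using assms(2) unfolding exact_seq_def by (elim allE[of _ "Suc i"]) simp
  then show ?thesis using assms(2) by (simp add: nth_append)
qed

lemma extension_rev:
  assumes "fs \<in> extensions C i A B"
  shows "length (rev fs) = Suc i" "left_exact (rev fs)" "epi_arr C (hd (rev fs))"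
    "Cod C (hd (rev fs)) = A" "Dom C (last (rev fs)) = B" "A \<in> Obj C" "B \<in> Obj C"
proof -
  have fs: "length fs = Suc i" "exact_with_zeros C fs" "Dom C (hd fs) = B" "Cod C (last fs) = A"
    using assms by (auto simp: extensions_def)
  then have ne: "fs \<noteq> []" by auto
  show "length (rev fs) = Suc i" using fs by simp
  show le: "left_exact (rev fs)" "epi_arr C (hd (rev fs))"
    using exact_with_zeros_rev[of "rev fs"] fs by simp_all
  show eq: "Cod C (hd (rev fs)) = A" "Dom C (last (rev fs)) = B"
    using fs ne by (simp_all add: hd_rev last_rev)
  have "f \<in> Arr C" if "f \<in> set fs" for f using left_exact_arr[OF le(1), of f] that by simp
  then show "A \<in> Obj C" "B \<in> Obj C" using eq ne by (auto simp: hd_rev last_rev)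
qed

lemma extension_morphism_ladder:
  assumes "(fs, gs) \<in> extension_morphism C i A B"
  shows "ladder (Ident C B) (Ident C A) (rev fs) (rev gs)"
proof -
  obtain hs where fs: "fs \<in> extensions C i A B" and gs: "gs \<in> extensions C i A B"
    and hs: "length hs = i + 2" "hs ! 0 = Ident C B" "hs ! Suc i = Ident C A"
      "\<And>j. j \<le> i \<Longrightarrow> hs ! j \<in> Hom C (Dom C (fs ! j)) (Dom C (gs ! j))"
      "\<And>j. j \<le> i \<Longrightarrow> hs ! Suc j \<cdot> fs ! j = gs ! j \<cdot> hs ! j"
    using assms unfolding extension_morphism_def by blast
  have len: "length fs = Suc i" "length gs = Suc i" using fs gs by (simp_all add: extensions_def)
  have ex: "exact_with_zeros C fs" "exact_with_zeros C gs" using fs gs by (simp_all add: extensions_def)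
  have "ladder (Ident C B) (hs ! j) (rev (take j fs)) (rev (take j gs))" if "j \<le> Suc i" for j
    using that
  proof (induction j)
    case 0
    then show ?case using hs(2) by simp
  next
    case (Suc j)
    have "hs ! Suc j \<in> Hom C (Cod C (fs ! j)) (Cod C (gs ! j))"
    proof (cases "j = i")
      case True
      have "fs \<noteq> []" "gs \<noteq> []" using len by auto
      then have "last fs = fs ! i" "last gs = gs ! i" using len by (simp_all add: last_conv_nth)
      then have "Cod C (fs ! i) = A" "Cod C (gs ! i) = A"
        using fs gs by (simp_all add: extensions_def)
      then show ?thesis using True hs(3) Ident_arr[OF extension_rev(6)[OF fs]] by simp
    next
      case False
      then have j: "Suc j \<le> i" using Suc by simp
      have "exact_at C (fs ! j) (fs ! Suc j)" "exact_at C (gs ! j) (gs ! Suc j)"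
        using exact_with_zeros_nth[OF ex(1), of j] exact_with_zeros_nth[OF ex(2), of j] len j by simp_all
      then show ?thesis using exact_atD(3) hs(4)[OF j] by metis
    qed
    then show ?case using Suc hs(4,5)[of j] len by (auto simp: take_Suc_conv_app_nth)
  qed
  from this[of "Suc i"] show ?thesis using hs(3) len by simp
qed

text \<open>Both directions matter, since the Yoneda relation is generated by morphisms together
  with their reversals.\<close>

lemma erased_extension_morphism:
  assumes "(fs, gs) \<in> extension_morphism C i A B"
  shows "erased (rev fs) (Ident C A) \<longleftrightarrow> erased (rev gs) (Ident C A)"
proof -
  have fs: "fs \<in> extensions C i A B" and gs: "gs \<in> extensions C i A B"
    using assms by (auto simp: extension_morphism_def)
  note l = extension_morphism_ladder[OF assms]
  note [simp] = extension_rev(6,7)[OF fs]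
  have y: "Ident C A \<in> Hom C A (Cod C (hd (rev fs)))" using extension_rev(4)[OF fs] by simp
  have h: "hd (rev fs) \<in> Arr C" using epi_arrD extension_rev(3)[OF fs] by blast
  show ?thesis
  proof
    assume "erased (rev fs) (Ident C A)"
    from erased_ladder[OF this l extension_rev(2)[OF fs] extension_rev(2)[OF gs] y]
    show "erased (rev gs) (Ident C A)" by simp
  next
    assume "erased (rev gs) (Ident C A)"
    then have "erased (rev gs) (Ident C A \<cdot> Ident C A)" by simp
    \<comment> \<open>The epic head serves as the cover: the identity of its domain is then the
      local lift of \<open>Ident C A\<close>.\<close>
    from erased_ladder_reflect[OF this l extension_rev(2)[OF fs] extension_rev(2)[OF gs] y _ _
      extension_rev(3)[OF fs], of "Dom C (hd (rev fs))" "Ident C (Dom C (hd (rev fs)))"]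
    show "erased (rev fs) (Ident C A)" using h extension_rev(4)[OF fs] by simp
  qed
qed

lemma erased_yoneda_singleton:
  assumes "is_singleton (yoneda_Ext C i A B)" "fs \<in> extensions C i A B" "gs \<in> extensions C i A B"
    "erased (rev gs) (Ident C A)"
  shows "erased (rev fs) (Ident C A)"
proof -
  define R where "R = (extension_morphism C i A B \<union> (extension_morphism C i A B)\<inverse>)\<^sup>*"
  have "R `` {fs} \<in> yoneda_Ext C i A B" "R `` {gs} \<in> yoneda_Ext C i A B"
    using assms(2,3) unfolding yoneda_Ext_def R_def by (auto intro: quotientI)
  then have "R `` {fs} = R `` {gs}" using assms(1) unfolding is_singleton_def by auto
  then have "(gs, fs) \<in> R" unfolding R_def by auto
  then show ?thesis
    unfolding R_def
    by (induction rule: rtrancl_induct) (use assms(4) erased_extension_morphism in auto)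
qed

text \<open>The working form of Ext^i(A, B) = 0 for i \<ge> 1, with representatives in place of
  classes. The i middle terms and the two ends are joined by i + 1 arrows.\<close>

definition erasable where
  "erasable i A B \<longleftrightarrow> A \<in> Obj C \<and> B \<in> Obj C \<and> (\<forall>rs. length rs = Suc i \<and> left_exact rs \<and>
    epi_arr C (hd rs) \<and> Cod C (hd rs) = A \<and> Dom C (last rs) = B \<longrightarrow> erased rs (Ident C A))"

lemma ses_biproduct:
  assumes "X \<in> Obj C" "Y \<in> Obj C"
  obtains P i j p q where "is_coproduct C [i, j] P" "ses X i P q Y" "ses Y j P p X"
    "p \<cdot> i = Ident C X" "q \<cdot> j = Ident C Y"
proof -
  note [simp] = assms
  obtain P i j p q where P: "is_coproduct C [i, j] P" and [simp]: "P \<in> Obj C"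
    and ty: "i \<in> Hom C X P" "j \<in> Hom C Y P" "p \<in> Hom C P X" "q \<in> Hom C P Y"
    and eq: "p \<cdot> i = Ident C X" "q \<cdot> j = Ident C Y" "q \<cdot> i = Zero C X Y" "p \<cdot> j = Zero C Y X"
    and sum: "Plus C (i \<cdot> p) (j \<cdot> q) = Ident C P"
    using biproduct[OF assms] .
  note [simp] = ty[simplified]
  have m: "mono_arr C i" "mono_arr C j"
    using mono_Comp_right[of p i] mono_Comp_right[of q j] eq mono_Ident by simp_all
  have e: "epi_arr C p" "epi_arr C q"
    using epi_Comp_left[of p i] epi_Comp_left[of q j] eq epi_Ident by simp_all
  have sum': "t = Plus C (i \<cdot> (p \<cdot> t)) (j \<cdot> (q \<cdot> t))" if "t \<in> Hom C W P" for W t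
    using precomp[OF sum, of t] that by simp
  have 1: "ses X i P q Y"
  proof (rule sesI[OF ty(1,4) m(1) e(2) eq(3)])
    fix W t assume t: "t \<in> Hom C W P" "q \<cdot> t = Zero C W Y"
    note [simp] = t(1)[simplified] Hom_Obj[OF t(1)]
    have "i \<cdot> (p \<cdot> t) = t" using sum'[OF t(1)] t(2) by simp
    then show "\<exists>u \<in> Hom C W X. i \<cdot> u = t" by (intro bexI[of _ "p \<cdot> t"]) simp_all
  qed
  have 2: "ses Y j P p X"
  proof (rule sesI[OF ty(2,3) m(2) e(1) eq(4)])
    fix W t assume t: "t \<in> Hom C W P" "p \<cdot> t = Zero C W X"
    note [simp] = t(1)[simplified] Hom_Obj[OF t(1)]
    have "j \<cdot> (q \<cdot> t) = t" using sum'[OF t(1)] t(2) by simp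
    then show "\<exists>u \<in> Hom C W Y. j \<cdot> u = t" by (intro bexI[of _ "q \<cdot> t"]) simp_all
  qed
  show ?thesis using that[OF P 1 2 eq(1,2)] .
qed

text \<open>The left part B = B \<rightarrow> 0 \<rightarrow> ... \<rightarrow> 0 \<rightarrow> M of
  a trivial extension, with n zero objects in between. The object D next to M is B for n = 0 and a
  zero object otherwise, hence the quantifier.\<close>

lemma left_exact_zero:
  assumes "B \<in> Obj C" "M \<in> Obj C"
  shows "\<exists>D rs. D \<in> Obj C \<and> length rs = Suc n \<and> left_exact (Zero C D M # rs) \<and> Dom C (last rs) = B"
  using assms(2)
proof (induction n arbitrary: M)
  case 0
  note [simp] = assms(1) 0
  have "exact_at C (Ident C B) (Zero C B M)"
  proof (rule exact_atI[of _ B B _ M])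
    fix W t assume t: "t \<in> Hom C W B" "Zero C B M \<cdot> t = Zero C W M"
    show "\<exists>V p s. p \<in> Hom C V W \<and> epi_arr C p \<and> s \<in> Hom C V B \<and> Ident C B \<cdot> s = t \<cdot> p"
      using t Hom_Obj[OF t(1)] epi_Ident
      by (intro exI[of _ W] exI[of _ "Ident C W"] exI[of _ t]) simp
  qed simp_all
  then show ?case using mono_Ident
    by (intro exI[of _ B] exI[of _ "[Ident C B]"]) simp
next
  case (Suc n)
  obtain Z where Z: "zero_obj C Z" "Z \<in> Obj C" using zero_object .
  note [simp] = Suc(2) Z(2)
  obtain D rs where D: "D \<in> Obj C" "length rs = Suc n" "left_exact (Zero C D Z # rs)" "Dom C (last rs) = B"
    using Suc(1)[OF Z(2)] by blast
  note [simp] = D(1)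
  have "exact_at C (Zero C D Z) (Zero C Z M)"
  proof (rule exact_atI[of _ D Z _ M])
    fix W t assume t: "t \<in> Hom C W Z" "Zero C Z M \<cdot> t = Zero C W M"
    have "t = Zero C W Z" using zero_obj_eq(2)[OF Z(1), of t] t(1) by simp
    then show "\<exists>V p s. p \<in> Hom C V W \<and> epi_arr C p \<and> s \<in> Hom C V D \<and> Zero C D Z \<cdot> s = t \<cdot> p"
      using t Hom_Obj[OF t(1)] epi_Ident
      by (intro exI[of _ W] exI[of _ "Ident C W"] exI[of _ "Zero C W D"]) simp
  qed simp_all
  then show ?case using D(2-4)
    by (intro exI[of _ Z] exI[of _ "Zero C D Z # rs"]) auto
qed

text \<open>The witness is the trivial extension: the biproduct in degree 1, and B = B \<rightarrow>
  0 \<rightarrow> ... \<rightarrow> 0 \<rightarrow> A = A with i - 2 zero objects from degree 2 on.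
  There the head is an identity, along which every arrow lifts.\<close>

lemma ex_erased_extension:
  assumes "A \<in> Obj C" "B \<in> Obj C" "1 \<le> i"
  obtains rs where "length rs = Suc i" "left_exact rs" "epi_arr C (hd rs)" "Cod C (hd rs) = A"
    "Dom C (last rs) = B" "erased rs (Ident C A)"
proof (cases "i = 1")
  case True
  obtain P a b p q where s: "ses B b P p A" and pa: "p \<cdot> a = Ident C A" and a: "ses A a P q B"
    using ses_biproduct[OF assms(1,2)] by metis
  note [simp] = sesD(1-9)[OF s] sesD(1-3)[OF a]
  have "erased [p, b] (Ident C A)" using pa by (auto intro!: exI[of _ a])
  then show ?thesis
    using that[of "[p, b]"] True ses_epi[OF s] ses_mono[OF s] exact_at_ses[OF s] by simp
next
  case False
  then obtain n where n: "i = Suc (Suc n)" using assms(3) by (cases i; cases "i - 1") auto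
  obtain D rs where D: "D \<in> Obj C" "length rs = Suc n" "left_exact (Zero C D A # rs)" "Dom C (last rs) = B"
    using left_exact_zero[OF assms(2,1)] by blast
  note [simp] = D(1) assms(1,2)
  have "exact_at C (Zero C D A) (Ident C A)"
  proof (rule exact_atI[of _ D A _ A])
    fix W t assume t: "t \<in> Hom C W A" "Ident C A \<cdot> t = Zero C W A"
    show "\<exists>V p s. p \<in> Hom C V W \<and> epi_arr C p \<and> s \<in> Hom C V D \<and> Zero C D A \<cdot> s = t \<cdot> p"
      using t Hom_Obj[OF t(1)] epi_Ident
      by (intro exI[of _ W] exI[of _ "Ident C W"] exI[of _ "Zero C W D"]) simp
  qed simp_all
  then have le: "left_exact (Ident C A # Zero C D A # rs)" using D(3) by simp
  have "erased (Ident C A # Zero C D A # rs) (Ident C A \<cdot> Ident C A)"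
    by (rule erased_Comp_hd[OF le, of _ A]) simp
  then show ?thesis
    using that[of "Ident C A # Zero C D A # rs"] le D n epi_Ident by (cases "rs = []") auto
qed

text \<open>The only Yoneda class contains an erased extension, and erasedness is constant on the
  class.\<close>

lemma Ext_vanishes_erasable:
  assumes "Ext_vanishes C i \<A> \<B>" "A \<in> \<A>" "B \<in> \<B>" "A \<in> Obj C" "B \<in> Obj C" "1 \<le> i"
  shows "erasable i A B"
  unfolding erasable_def
proof (intro conjI allI impI)
  have ext: "rev rs \<in> extensions C i A B" if "length rs = Suc i" "left_exact rs" "epi_arr C (hd rs)"
    "Cod C (hd rs) = A" "Dom C (last rs) = B" for rs
    using that exact_with_zeros_rev[of rs] unfolding extensions_def
    by (cases "rs = []") (auto simp: hd_rev last_rev)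
  fix rs assume rs: "length rs = Suc i \<and> left_exact rs \<and>
    epi_arr C (hd rs) \<and> Cod C (hd rs) = A \<and> Dom C (last rs) = B"
  obtain ss where ss: "length ss = Suc i" "left_exact ss" "epi_arr C (hd ss)" "Cod C (hd ss) = A"
    "Dom C (last ss) = B" "erased ss (Ident C A)"
    using ex_erased_extension[OF assms(4-6)] .
  have "is_singleton (yoneda_Ext C i A B)" using assms(1-3) by (simp add: Ext_vanishes_def)
  from erased_yoneda_singleton[OF this ext ext] show "erased rs (Ident C A)" using rs ss by simp
qed (use assms in simp_all)

text \<open>A substitute for exactness of Ext^i(N, B) \<rightarrow> Ext^i(N, Y) \<rightarrow>
  Ext^{i+1}(N, X) in the middle. The data that erase the spliced sequence assemble to an extension
  \<open>gs\<close> with left end B: the short exact sequences of the covers are spliced, the last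
  one after a pushout into B, and the lifts u become the vertical arrows.\<close>

lemma erased_append_ses:
  assumes "erased (rs @ [f \<cdot> p, k]) y" "left_exact (rs @ [f])" "f \<in> Hom C Y E" "ses X k B p Y"
    "rs \<noteq> []" "y \<in> Hom C N (Cod C (hd rs))"
  shows "\<exists>gs. length gs = Suc (length rs) \<and> left_exact gs \<and> epi_arr C (hd gs) \<and> Cod C (hd gs) = N \<and>
    Dom C (last gs) = B \<and> ladder p y gs (rs @ [f])"
  using assms(5,1,2,6)
proof (induction rs arbitrary: y N rule: list_nonempty_induct)
  case (single g)
  note s = assms(4)
  have ex: "exact_at C f g" using single(2) by simp
  define M where "M = Cod C g"
  have g: "g \<in> Hom C E M" using exact_atD[OF ex] assms(3) by (simp add: M_def)
  have yH: "y \<in> Hom C N M" using single(3) by (simp add: M_def)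
  note [simp] = g[simplified] assms(3)[simplified] sesD[OF s] yH[simplified]
    Hom_Obj[OF g] Hom_Obj[OF assms(3)] Hom_Obj[OF yH]
  have gf: "g \<cdot> f = Zero C Y M" by (rule exact_atD_zero[OF ex assms(3) g])
  obtain L l V r u where L: "ses L l V r N" and u: "u \<in> Hom C V E" "g \<cdot> u = y \<cdot> r"
    and er: "erased [f \<cdot> p, k] (u \<cdot> l)"
    using single(1) unfolding append_Cons append_Nil erased.simps(2)
    by (elim exE conjE) (rule that; simp del: erased.simps)
  note [simp] = sesD[OF L] u(1)[simplified]
  \<comment> \<open>The last stage of the erasure gives an arrow from the kernel L into B; the last
    cover is pushed out along it.\<close>
  obtain v where v: "v \<in> Hom C L B" "(f \<cdot> p) \<cdot> v = u \<cdot> l" using er by auto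
  obtain G k' r' e where G: "ses B k' G r' N" "e \<in> Hom C V G" "e \<cdot> l = k' \<cdot> v" "r' \<cdot> e = r"
    and univ: "\<And>T s t. \<lbrakk>s \<in> Hom C V T; t \<in> Hom C B T; s \<cdot> l = t \<cdot> v\<rbrakk> \<Longrightarrow>
      \<exists>u \<in> Hom C G T. u \<cdot> e = s \<and> u \<cdot> k' = t"
    and uniq: "\<And>T u w. \<lbrakk>u \<in> Hom C G T; w \<in> Hom C G T; u \<cdot> e = w \<cdot> e; u \<cdot> k' = w \<cdot> k'\<rbrakk> \<Longrightarrow> u = w"
    by (rule ses_pushout[OF L v(1)]) (rule that)
  note [simp] = sesD[OF G(1)] G(2)[simplified]
  obtain w where w: "w \<in> Hom C G E" "w \<cdot> e = u" "w \<cdot> k' = f \<cdot> p"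
    using univ[of u E "f \<cdot> p"] v(2) by auto
  note [simp] = w(1)[simplified]
  \<comment> \<open>The two sides agree on both legs of the pushout; on the leg from B they are
    zero.\<close>
  have "g \<cdot> w = y \<cdot> r'"
  proof (rule uniq[of _ M])
    show "(g \<cdot> w) \<cdot> e = (y \<cdot> r') \<cdot> e" using u(2) w(2) G(4) by simp
    show "(g \<cdot> w) \<cdot> k' = (y \<cdot> r') \<cdot> k'" using w(3) precomp[OF gf, of p] by simp
  qed simp_all
  then have "ladder p y [r', k'] ([g] @ [f])" using w(3) by (auto intro!: exI[of _ w])
  moreover have "left_exact [r', k']" using exact_at_ses[OF G(1)] ses_mono[OF G(1)] by simp
  ultimately show ?case using ses_epi[OF G(1)] by (intro exI[of _ "[r', k']"]) simp
next
  case (cons g rs)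
  obtain h rs1 where rs: "rs = h # rs1" using cons(1) by (cases rs) auto
  have ex: "exact_at C h g" and le: "left_exact (rs @ [f])" using cons(4) rs by simp_all
  define M D where "M = Cod C g" and "D = Dom C g"
  have g: "g \<in> Hom C D M" and h: "Cod C h = D" using exact_atD[OF ex] by (simp_all add: M_def D_def)
  have yH: "y \<in> Hom C N M" using cons(5) by (simp add: M_def)
  note [simp] = g[simplified] h yH[simplified] Hom_Obj[OF g] Hom_Obj[OF yH]
  have "\<exists>e es. rs1 @ [f \<cdot> p, k] = e # es" by (cases rs1) auto
  then obtain L l V r u where L: "ses L l V r N" and u: "u \<in> Hom C V D" "g \<cdot> u = y \<cdot> r"
    and er: "erased (rs @ [f \<cdot> p, k]) (u \<cdot> l)"
    using cons(3) unfolding rs by auto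
  note [simp] = sesD[OF L] u(1)[simplified]
  have "u \<cdot> l \<in> Hom C L (Cod C (hd rs))" using rs by simp
  from cons(2)[OF er le this] obtain gs where gs: "length gs = Suc (length rs)" "left_exact gs"
    "epi_arr C (hd gs)" "Cod C (hd gs) = L" "Dom C (last gs) = B" "ladder p (u \<cdot> l) gs (rs @ [f])"
    by blast
  obtain q gs1 where q: "gs = q # gs1" "gs1 \<noteq> []" using gs(1) rs by (cases gs; cases "tl gs") auto
  have qH: "q \<in> Hom C (Dom C q) L" using gs(3,4) q epi_arrD by auto
  note [simp] = qH[simplified]
  have le': "left_exact (r # (l \<cdot> q) # gs1)"
    using left_exact_splice[OF _ _ qH L] gs(2,3) q by simp
  have "ladder p u ((l \<cdot> q) # gs1) (rs @ [f])" using gs(6) unfolding q rs by auto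
  then have "ladder p y (r # (l \<cdot> q) # gs1) ((g # rs) @ [f])" using u(2)
    by (auto intro!: exI[of _ u])
  then show ?case using le' gs(1,5) q ses_epi[OF L]
    by (intro exI[of _ "r # (l \<cdot> q) # gs1"]) simp
qed

text \<open>Splicing lands in degree i + 1 with left end X, where everything is erased. Hence a
  given extension with left end Y receives a ladder from one with left end B. The latter is erased
  too, and erasedness is pushed forward along the ladder.\<close>

lemma erasable_shift:
  assumes "erasable i A B" "erasable (Suc i) A X" and s: "ses X k B p Y" and i: "1 \<le> i"
  shows "erasable i A Y"
  unfolding erasable_def
proof (intro conjI allI impI)
  show A: "A \<in> Obj C" and "Y \<in> Obj C" using assms(1) sesD[OF s] by (simp_all add: erasable_def)
  fix rs assume *: "length rs = Suc i \<and> left_exact rs \<and>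
    epi_arr C (hd rs) \<and> Cod C (hd rs) = A \<and> Dom C (last rs) = Y"
  then obtain rs0 f where rs: "rs = rs0 @ [f]" by (cases rs rule: rev_cases) auto
  with * i have rs0: "rs0 \<noteq> []" by auto
  have f: "f \<in> Hom C Y (Cod C f)" using * left_exact_arr[of rs f] rs by simp
  have "left_exact (rs0 @ [f \<cdot> p, k])" using left_exact_append_ses[OF _ f s] * rs by simp
  then have e: "erased (rs0 @ [f \<cdot> p, k]) (Ident C A)"
    using assms(2) * rs rs0 sesD[OF s] unfolding erasable_def by simp
  have "Ident C A \<in> Hom C A (Cod C (hd rs0))" "left_exact (rs0 @ [f])" using * rs rs0 A by simp_all
  then obtain gs where gs: "length gs = Suc (length rs0)" "left_exact gs" "epi_arr C (hd gs)"
    "Cod C (hd gs) = A" "Dom C (last gs) = B" "ladder p (Ident C A) gs (rs0 @ [f])"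
    using erased_append_ses[OF e _ f s rs0] by blast
  have "erased gs (Ident C A)" using assms(1) gs * rs unfolding erasable_def by simp
  from erased_ladder[OF this gs(6,2), of A] show "erased rs (Ident C A)"
    using * rs gs(4) A by simp
qed

section \<open>Lifting and the section of an extension\<close>

text \<open>In degree 1 to be erased means to split: the pullback along g has a section, and its
  composite with \<open>e\<close> is the lift.\<close>

lemma erasable_1_lift:
  assumes "erasable 1 A L" and s: "ses L l E q Y" and g: "g \<in> Hom C A Y"
  obtains h where "h \<in> Hom C A E" "q \<cdot> h = g"
proof -
  note [simp] = sesD[OF s] g[simplified] Hom_Obj[OF g]
  obtain E' l' q' e where P: "ses L l' E' q' A" "e \<in> Hom C E' E" "e \<cdot> l' = l" "q \<cdot> e = g \<cdot> q'"
    using ses_pullback[OF s g] .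
  note [simp] = sesD[OF P(1)] P(2)[simplified]
  have "left_exact [q', l']" using exact_at_ses[OF P(1)] ses_mono[OF P(1)] by simp
  then have "erased [q', l'] (Ident C A)"
    using assms(1)[unfolded erasable_def, THEN conjunct2, THEN conjunct2, rule_format, of "[q', l']"]
      ses_epi[OF P(1)] by simp
  then obtain u where u: "u \<in> Hom C A E'" "q' \<cdot> u = Ident C A" by auto
  note [simp] = u(1)[simplified]
  have "q \<cdot> (e \<cdot> u) = g" using precomp[OF P(4), of u] u(2) by simp
  then show ?thesis using that[of "e \<cdot> u"] by simp
qed

text \<open>The pullback of the second sequence along \<open>\<gamma>\<close> has a class in \<open>Ext\<^sup>1(A', X)\<close>, which comes
  from \<open>Ext\<^sup>1(A', A)\<close> because its image in \<open>Ext\<^sup>2(A', K)\<close> vanishes.\<close>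

lemma erasable_2_lift:
  assumes er: "erasable 2 A' K" and s: "ses K a A \<alpha> X" and t: "ses X x Y y Z" and g: "\<gamma> \<in> Hom C A' Z"
  obtains E i j \<beta> where "ses A i E j A'" "\<beta> \<in> Hom C E Y" "\<beta> \<cdot> i = x \<cdot> \<alpha>" "y \<cdot> \<beta> = \<gamma> \<cdot> j"
proof -
  note [simp] = sesD[OF s] sesD[OF t] g[simplified] Hom_Obj[OF g]
  obtain Y' x' y' e where P: "ses X x' Y' y' A'" "e \<in> Hom C Y' Y" "e \<cdot> x' = x" "y \<cdot> e = \<gamma> \<cdot> y'"
    using ses_pullback[OF t g] .
  note [simp] = sesD[OF P(1)] P(2)[simplified]
  have le: "left_exact ([y'] @ [x'])" using exact_at_ses[OF P(1)] ses_mono[OF P(1)] by simp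
  have xH: "x' \<in> Hom C X Y'" by simp
  \<comment> \<open>This splice of K \<rightarrow> A \<rightarrow> X with the pulled back sequence
    is the representative in Ext^2(A', K).\<close>
  have le2: "left_exact ([y'] @ [x' \<cdot> \<alpha>, a])" by (rule left_exact_append_ses[OF le xH s])
  then have "erased ([y'] @ [x' \<cdot> \<alpha>, a]) (Ident C A')"
    using er[unfolded erasable_def, THEN conjunct2, THEN conjunct2, rule_format, of "[y', x' \<cdot> \<alpha>, a]"]
      ses_epi[OF P(1)] by simp
  then obtain gs where gs: "length gs = Suc (length [y'])" "left_exact gs" "epi_arr C (hd gs)"
    "Cod C (hd gs) = A'" "Dom C (last gs) = A" "ladder \<alpha> (Ident C A') gs ([y'] @ [x'])"
    using erased_append_ses[OF _ le xH s, of "Ident C A'" A'] by auto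
  then obtain j i where ji: "gs = [j, i]" by (auto simp: length_Suc_conv)
  have ex: "exact_at C i j" "mono_arr C i" "epi_arr C j" using gs(2,3) ji by simp_all
  define E where "E = Dom C j"
  have ty: "i \<in> Hom C A E" "j \<in> Hom C E A'"
    using exact_atD[OF ex(1)] gs(4,5) ji by (simp_all add: E_def)
  note [simp] = ty[simplified]
  have S: "ses A i E j A'" by (rule sesI_exact[OF ex ty])
  obtain h where h: "h \<in> Hom C E Y'" "y' \<cdot> h = j" "h \<cdot> i = x' \<cdot> \<alpha>"
    using gs(6) unfolding ji by auto
  note [simp] = h(1)[simplified]
  have "(e \<cdot> h) \<cdot> i = x \<cdot> \<alpha>" using h(3) precomp[OF P(3), of \<alpha>] by simp
  moreover have "y \<cdot> (e \<cdot> h) = \<gamma> \<cdot> j" using h(2) precomp[OF P(4), of h] by simp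
  ultimately show ?thesis using that[OF S, of "e \<cdot> h"] by simp
qed

text \<open>A form of the nine lemma: \<beta> is epic because \<alpha> and \<gamma> are, and
  epicness of \<alpha> removes the obstruction to exactness on the right of the kernel
  sequence.\<close>

lemma ses_kernels:
  assumes E: "ses A i E j A'" and Y: "ses X x Y y Z" and b: "\<beta> \<in> Hom C E Y"
    and comm: "\<beta> \<cdot> i = x \<cdot> \<alpha>" "y \<cdot> \<beta> = \<gamma> \<cdot> j"
    and K: "ses K a A \<alpha> X" and K': "ses K' c A' \<gamma> Z"
  obtains K'' b' i' j' where "ses K'' b' E \<beta> Y" "ses K i' K'' j' K'"
proof -
  note [simp] = sesD[OF E] sesD[OF Y] sesD[OF K] sesD[OF K'] b[simplified]
  have "t = Zero C Y (Cod C t)" if t: "t \<in> Arr C" "Dom C t = Y" "t \<cdot> \<beta> = Zero C E (Cod C t)" for t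
  proof -
    define W where "W = Cod C t"
    have tt: "t \<in> Hom C Y W" and tb: "t \<cdot> \<beta> = Zero C E W" using t by (simp_all add: W_def)
    note [simp] = tt[simplified] Hom_Obj[OF tt]
    have "t \<cdot> (x \<cdot> \<alpha>) = Zero C A W"
      using precomp[OF tb, of i] unfolding comm(1)[symmetric] by simp
    then have "t \<cdot> x = Zero C X W" using epi_zero[OF ses_epi[OF K], of "t \<cdot> x" A W] by simp
    then obtain u where u: "u \<in> Hom C Z W" "u \<cdot> y = t" using ses_cofactor[OF Y tt] by blast
    note [simp] = u(1)[simplified]
    have "u \<cdot> (\<gamma> \<cdot> j) = Zero C E W"
      unfolding comm(2)[symmetric] using precomp[OF u(2), of \<beta>] tb by simp
    moreover have "epi_arr C (\<gamma> \<cdot> j)" by (rule epi_Comp[OF ses_epi[OF E] ses_epi[OF K']]) simp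
    ultimately have "u = Zero C Z W" using epi_zero[of "\<gamma> \<cdot> j" u E W] by simp
    then show ?thesis using u(2)[symmetric] by simp
  qed
  then have "epi_arr C \<beta>" unfolding epi_iff by simp
  then obtain K'' b' where S: "ses K'' b' E \<beta> Y" by (rule ses_of_epi) simp_all
  note [simp] = sesD[OF S]
  have "\<beta> \<cdot> (i \<cdot> a) = Zero C K Y" using precomp[OF comm(1), of a] by simp
  then obtain i' where i': "i' \<in> Hom C K K''" "b' \<cdot> i' = i \<cdot> a"
    using ses_factor[OF S, of "i \<cdot> a" K] by auto
  note [simp] = i'(1)[simplified]
  have "\<gamma> \<cdot> (j \<cdot> b') = Zero C K'' Z" using precomp[OF comm(2), of b'] by simp
  then obtain j' where j': "j' \<in> Hom C K'' K'" "c \<cdot> j' = j \<cdot> b'"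
    using ses_factor[OF K', of "j \<cdot> b'" K''] by auto
  note [simp] = j'(1)[simplified]
  have mia: "mono_arr C (i \<cdot> a)" by (rule mono_Comp[OF ses_mono[OF K] ses_mono[OF E]]) simp
  have mi: "mono_arr C i'" by (rule mono_Comp_right[of b']) (use mia i'(2) in simp_all)
  have "c \<cdot> (j' \<cdot> i') = j \<cdot> (i \<cdot> a)" using precomp[OF j'(2), of i'] i'(2) by simp
  also have "\<dots> = Zero C K A'" using precomp[OF sesD(10)[OF E], of a] by (simp del: sesD(10)[OF E])
  finally have ji: "j' \<cdot> i' = Zero C K K'" using mono_zero[OF ses_mono[OF K'], of "j' \<cdot> i'"] by simp
  \<comment> \<open>For epicness of \<open>j'\<close>, a cover p of \<open>K'\<close> is lifted to
    an element e of E. Its image under \<beta> comes from X, hence locally from A, and subtracting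
    \<open>i \<cdot> s\<close> moves e into the kernel of \<beta> without changing its image in
    \<open>A'\<close>.\<close>
  have cH: "c \<in> Hom C K' A'" "j \<in> Hom C E A'" "\<alpha> \<in> Hom C A X" by simp_all
  obtain V e p where V: "e \<in> Hom C V E" "p \<in> Hom C V K'" "j \<cdot> e = c \<cdot> p" "epi_arr C p"
    using epi_pullback[OF ses_epi[OF E] cH(2,1)] .
  note [simp] = V(1,2)[simplified] Hom_Obj[OF V(1)]
  have "y \<cdot> (\<beta> \<cdot> e) = (\<gamma> \<cdot> c) \<cdot> p"
    using precomp[OF comm(2), of e] V(3) by (simp del: sesD(10)[OF K'])
  then have "y \<cdot> (\<beta> \<cdot> e) = Zero C V Z" by simp
  then obtain r where r: "r \<in> Hom C V X" "x \<cdot> r = \<beta> \<cdot> e" using ses_factor[OF Y, of "\<beta> \<cdot> e" V] by auto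
  obtain V' s p' where V': "s \<in> Hom C V' A" "p' \<in> Hom C V' V" "\<alpha> \<cdot> s = r \<cdot> p'" "epi_arr C p'"
    using epi_pullback[OF ses_epi[OF K] cH(3) r(1)] .
  note [simp] = r(1)[simplified] V'(1,2)[simplified] Hom_Obj[OF V'(1)]
  have "\<beta> \<cdot> (e \<cdot> p' \<ominus> i \<cdot> s) = Zero C V' Y"
    using precomp[OF r(2), of p'] precomp[OF comm(1), of s] V'(3) by simp
  then obtain w where w: "w \<in> Hom C V' K''" "b' \<cdot> w = e \<cdot> p' \<ominus> i \<cdot> s"
    using ses_factor[OF S, of "e \<cdot> p' \<ominus> i \<cdot> s" V'] by auto
  note [simp] = w(1)[simplified]
  have "c \<cdot> (j' \<cdot> w) = j \<cdot> (b' \<cdot> w)" using precomp[OF j'(2), of w] by simp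
  also have "\<dots> = c \<cdot> (p \<cdot> p')"
    unfolding w(2) using precomp[OF V(3), of p'] precomp[OF sesD(10)[OF E], of s] by (simp del: sesD(10)[OF E])
  finally have "j' \<cdot> w = p \<cdot> p'" by (rule mono_cancel[OF ses_mono[OF K']]) simp_all
  then have ej: "epi_arr C j'"
    using epi_Comp[OF V'(4) V(4)] by (intro epi_Comp_left[of j' w]) simp_all
  have "ses K i' K'' j' K'"
  proof (rule sesI[OF _ _ mi ej ji])
    fix W t assume t: "t \<in> Hom C W K''" "j' \<cdot> t = Zero C W K'"
    note [simp] = t(1)[simplified] Hom_Obj[OF t(1)]
    have "j \<cdot> (b' \<cdot> t) = Zero C W A'" using precomp[OF j'(2), of t] t(2) by simp
    then obtain u where u: "u \<in> Hom C W A" "i \<cdot> u = b' \<cdot> t" using ses_factor[OF E, of "b' \<cdot> t" W] by auto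
    note [simp] = u(1)[simplified]
    have "x \<cdot> (\<alpha> \<cdot> u) = \<beta> \<cdot> (b' \<cdot> t)" using precomp[OF comm(1), of u] u(2) by simp
    also have "\<dots> = Zero C W Y" using precomp[OF sesD(10)[OF S], of t] by (simp del: sesD(10)[OF S])
    finally have "\<alpha> \<cdot> u = Zero C W X" using mono_zero[OF ses_mono[OF Y], of "\<alpha> \<cdot> u"] by simp
    then obtain v where v: "v \<in> Hom C W K" "a \<cdot> v = u" using ses_factor[OF K u(1)] by blast
    note [simp] = v(1)[simplified]
    have "b' \<cdot> (i' \<cdot> v) = b' \<cdot> t" using precomp[OF i'(2), of v] v(2) u(2) by simp
    then have "i' \<cdot> v = t" by (rule mono_cancel[OF ses_mono[OF S]]) simp_all
    then show "\<exists>u \<in> Hom C W K. i' \<cdot> u = t" using v(1) by blast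
  qed simp_all
  then show ?thesis using that[OF S] by blast
qed

text \<open>The idempotent 1 - rq factors through the kernel l, and the factor m is the projection
  onto L.\<close>

lemma section_coproduct:
  assumes s: "ses L l E q Y" and r: "r \<in> Hom C Y E" "q \<cdot> r = Ident C Y"
  shows "is_coproduct C [r, l] E"
proof -
  note [simp] = sesD[OF s] r(1)[simplified]
  let ?e = "Ident C E \<ominus> r \<cdot> q"
  have "q \<cdot> ?e = Zero C E Y" using precomp[OF r(2), of q] by simp
  then obtain m where m: "m \<in> Hom C E L" "l \<cdot> m = ?e" using ses_factor[OF s, of ?e E] by auto
  note [simp] = m(1)[simplified]
  have "l \<cdot> (m \<cdot> l) = l \<cdot> Ident C L" using precomp[OF m(2), of l] by simp
  then have ml: "m \<cdot> l = Ident C L" by (rule mono_cancel[OF ses_mono[OF s]]) simp_all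
  have "l \<cdot> (m \<cdot> r) = Zero C Y E" using precomp[OF m(2), of r] r(2) by simp
  then have mr: "m \<cdot> r = Zero C Y L" using mono_zero[OF ses_mono[OF s], of "m \<cdot> r"] by simp
  have "Plus C (r \<cdot> q) (l \<cdot> m) = Plus C (l \<cdot> m) (r \<cdot> q)" by (rule Plus_commute) simp_all
  then have "Plus C (r \<cdot> q) (l \<cdot> m) = Ident C E" unfolding m(2) by simp
  then show ?thesis
    using ml mr r by (intro coproductI[of r Y E l L q m]) simp_all
qed

text \<open>The extension is pushed down to \<open>A'\<close> by dividing out a lift of \<open>i\<close>; a section over \<open>A'\<close> then
  determines the section over \<open>E\<close>, because \<open>q\<close> and the quotient map are jointly monic.\<close>

lemma extension_section:
  assumes E: "ses A i E j A'" and S: "ses L l D q E" and er: "erasable 1 A L" "erasable 1 A' L"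
  obtains r where "r \<in> Hom C E D" "q \<cdot> r = Ident C E"
proof -
  note [simp] = sesD[OF E] sesD[OF S]
  have iH: "i \<in> Hom C A E" by simp
  obtain s where s: "s \<in> Hom C A D" "q \<cdot> s = i" using erasable_1_lift[OF er(1) S iH] .
  note [simp] = s(1)[simplified]
  have "mono_arr C s" by (rule mono_Comp_right[of q]) (use s(2) ses_mono[OF E] in simp_all)
  then obtain W c where W: "ses A s D c W" using ses_of_mono s(1) by blast
  note [simp] = sesD(4-9)[OF W]
  have cs: "c \<cdot> s = Zero C A W" by (rule sesD[OF W])
  have "(j \<cdot> q) \<cdot> s = Zero C A A'" using s(2) by simp
  then obtain w where w: "w \<in> Hom C W A'" "w \<cdot> c = j \<cdot> q"
    using ses_cofactor[OF W, of "j \<cdot> q" A'] by auto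
  note [simp] = w(1)[simplified]
  have ew: "epi_arr C w"
    using epi_Comp[OF ses_epi[OF S] ses_epi[OF E]] w(2) by (intro epi_Comp_left[of w c]) simp_all
  \<comment> \<open>Joint monicity of q and c: an arrow killed by c comes from A through s, and
    \<open>q \<cdot> s = i\<close> is monic. It serves for the monicity of
    \<open>c \<cdot> l\<close> and again for the final descent.\<close>
  have zero: "t = Zero C V D"
    if t: "t \<in> Hom C V D" "q \<cdot> t = Zero C V E" "c \<cdot> t = Zero C V W" for V t
  proof -
    note [simp] = t(1)[simplified] Hom_Obj[OF t(1)]
    obtain u where u: "u \<in> Hom C V A" "s \<cdot> u = t" using ses_factor[OF W t(1,3)] .
    note [simp] = u(1)[simplified]
    have "i \<cdot> u = Zero C V E" using precomp[OF s(2), of u] u(2) t(2) by simp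
    then have "u = Zero C V A" using mono_zero[OF ses_mono[OF E]] by simp
    then show ?thesis using u(2)[symmetric] by simp
  qed
  have "ses L (c \<cdot> l) W w A'"
  proof (rule sesI_local)
    show "w \<cdot> (c \<cdot> l) = Zero C L A'" using precomp[OF w(2), of l] by simp
    show "mono_arr C (c \<cdot> l)" unfolding mono_iff
    proof (intro conjI ballI impI, simp, elim conjE)
      fix t assume t: "t \<in> Arr C" "Cod C t = Dom C (c \<cdot> l)" "(c \<cdot> l) \<cdot> t = Zero C (Dom C t) (Cod C (c \<cdot> l))"
      define V where "V = Dom C t"
      have tt: "t \<in> Hom C V L" using t by (simp add: V_def)
      note [simp] = tt[simplified] Hom_Obj[OF tt]
      have "l \<cdot> t = Zero C V D"
        by (rule zero) (use t(3) precomp[OF sesD(10)[OF S], of t] in \<open>simp_all del: sesD(10)[OF S]\<close>)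
      then show "t = Zero C (Dom C t) (Dom C (c \<cdot> l))" using mono_zero[OF ses_mono[OF S]] by simp
    qed
    fix V t assume t: "t \<in> Hom C V W" "w \<cdot> t = Zero C V A'"
    note [simp] = t(1)[simplified] Hom_Obj[OF t(1)]
    have cH: "c \<in> Hom C D W" by simp
    obtain U b p where U: "b \<in> Hom C U D" "p \<in> Hom C U V" "c \<cdot> b = t \<cdot> p" "epi_arr C p"
      using epi_pullback[OF ses_epi[OF W] cH t(1)] .
    note [simp] = U(1,2)[simplified] Hom_Obj[OF U(1)]
    have "j \<cdot> (q \<cdot> b) = w \<cdot> (c \<cdot> b)" using precomp[OF w(2), of b] by simp
    also have "\<dots> = Zero C U A'" unfolding U(3) using precomp[OF t(2), of p] by simp
    finally obtain u where u: "u \<in> Hom C U A" "i \<cdot> u = q \<cdot> b" using ses_factor[OF E, of "q \<cdot> b" U] by auto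
    note [simp] = u(1)[simplified]
    \<comment> \<open>Lifts along c are determined up to arrows through s; subtracting one of these
      moves b into the kernel of q and leaves \<open>c \<cdot> b\<close> unchanged.\<close>
    have "q \<cdot> (b \<ominus> s \<cdot> u) = Zero C U E" using precomp[OF s(2), of u] u(2) by simp
    then obtain m where m: "m \<in> Hom C U L" "l \<cdot> m = b \<ominus> s \<cdot> u"
      using ses_factor[OF S, of "b \<ominus> s \<cdot> u" U] by auto
    note [simp] = m(1)[simplified]
    have "(c \<cdot> l) \<cdot> m = t \<cdot> p" using m(2) precomp[OF cs, of u] U(3) by simp
    then show "\<exists>U p s. p \<in> Hom C U V \<and> epi_arr C p \<and> s \<in> Hom C U L \<and> (c \<cdot> l) \<cdot> s = t \<cdot> p"
      using U(2,4) m(1) by blast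
  qed (use ew in simp_all)
  note T = this
  have "Ident C A' \<in> Hom C A' A'" by simp
  with erasable_1_lift[OF er(2) T] obtain h where h: "h \<in> Hom C A' W" "w \<cdot> h = Ident C A'" by blast
  note [simp] = h(1)[simplified]
  have H: "c \<in> Hom C D W" "h \<cdot> j \<in> Hom C E W" by simp_all
  obtain V e p where V: "e \<in> Hom C V D" "p \<in> Hom C V E" "c \<cdot> e = (h \<cdot> j) \<cdot> p" "epi_arr C p"
    using epi_pullback[OF ses_epi[OF W] H] .
  note [simp] = V(1,2)[simplified] Hom_Obj[OF V(1)]
  have "j \<cdot> (q \<cdot> e) = w \<cdot> (c \<cdot> e)" using precomp[OF w(2), of e] by simp
  also have "\<dots> = j \<cdot> p" unfolding V(3) using precomp[OF h(2), of "j \<cdot> p"] by simp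
  finally have "j \<cdot> (q \<cdot> e \<ominus> p) = Zero C V A'" by simp
  then obtain u where u: "u \<in> Hom C V A" "i \<cdot> u = q \<cdot> e \<ominus> p"
    using ses_factor[OF E, of "q \<cdot> e \<ominus> p" V] by auto
  note [simp] = u(1)[simplified]
  \<comment> \<open>After this correction both \<open>q \<cdot> f\<close> and
    \<open>c \<cdot> f\<close> factor through the cover p, so f vanishes on the kernel of p and
    descends to the desired section.\<close>
  define f where "f = e \<ominus> s \<cdot> u"
  have [simp]: "f \<in> Arr C" "Dom C f = V" "Cod C f = D" by (simp_all add: f_def)
  have "q \<cdot> f = q \<cdot> e \<ominus> i \<cdot> u" using precomp[OF s(2), of u] by (simp add: f_def)
  then have qf: "q \<cdot> f = p" unfolding u(2) by (simp add: Minus_Minus)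
  have cf: "c \<cdot> f = h \<cdot> (j \<cdot> p)" using precomp[OF cs, of u] V(3) by (simp add: f_def)
  obtain N \<kappa> where N: "ses N \<kappa> V p E" using ses_of_epi[OF V(4,2)] .
  note [simp] = sesD(1-3,7-9)[OF N]
  have pk: "p \<cdot> \<kappa> = Zero C N E" by (rule sesD[OF N])
  have "f \<cdot> \<kappa> = Zero C N D"
    by (rule zero) (use precomp[OF qf, of \<kappa>] precomp[OF cf, of \<kappa>] pk in simp_all)
  then obtain r where r: "r \<in> Hom C E D" "r \<cdot> p = f" using ses_cofactor[OF N, of f D] by auto
  note [simp] = r(1)[simplified]
  have "(q \<cdot> r) \<cdot> p = Ident C E \<cdot> p" using r(2) qf by simp
  then have "q \<cdot> r = Ident C E" by (rule epi_cancel[OF V(4)]) simp_all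
  then show ?thesis using that r(1) by blast
qed

section \<open>Resolution classes\<close>

text \<open>Resolutions are peeled off from the right, one short exact sequence at a time, with
  length exactly m. Under the coproduct hypothesis this is the class of dimension at most m: zero
  objects pad shorter resolutions, and closure under isomorphism settles dimension 0.\<close>

primrec resolvable :: "'a set \<Rightarrow> nat \<Rightarrow> 'a set" where
  "resolvable \<B> 0 = \<B>"
| "resolvable \<B> (Suc m) = {X. \<exists>K k B p. ses K k B p X \<and> B \<in> \<B> \<and> K \<in> resolvable \<B> m}"

context
  fixes \<B>
  assumes coprod: "closed_finite_coproducts C \<B>" and sub: "\<B> \<subseteq> Obj C"
begin

lemma closed_pair:
  assumes "is_coproduct C [i, j] P" "Dom C i \<in> \<B>" "Dom C j \<in> \<B>"
  shows "P \<in> \<B>"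
proof -
  have "\<forall>f \<in> set [i, j]. Dom C f \<in> \<B>" using assms by simp
  then show ?thesis using coprod assms(1) unfolding closed_finite_coproducts_def by blast
qed

lemma closed_zero:
  assumes "zero_obj C Z"
  shows "Z \<in> \<B>"
proof -
  have "is_coproduct C [] Z" using assms unfolding is_coproduct_def zero_obj_def by auto
  then show ?thesis using coprod unfolding closed_finite_coproducts_def by fastforce
qed

text \<open>An isomorphism exhibits its codomain as the coproduct of a single object, so closure
  under finite coproducts includes closure under isomorphism.\<close>

lemma closed_iso:
  assumes f: "mono_arr C f" "epi_arr C f" "f \<in> Hom C X Y" and X: "X \<in> \<B>"
  shows "Y \<in> \<B>"
proof -
  note [simp] = f(3)[simplified] Hom_Obj[OF f(3)]
  obtain u where u: "u \<in> Hom C Y X" "f \<cdot> u = Ident C Y" "u \<cdot> f = Ident C X"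
    by (rule mono_descend[OF f(1,2) f(3) f(3), of "Ident C X" "Ident C Y"]) simp_all
  note [simp] = u(1)[simplified]
  have "\<exists>!h. h \<in> Hom C Y T \<and> h \<cdot> f = g" if g: "g \<in> Hom C X T" for T g
  proof (rule ex1I[of _ "g \<cdot> u"])
    note [simp] = g[simplified]
    show "g \<cdot> u \<in> Hom C Y T \<and> (g \<cdot> u) \<cdot> f = g" using u(3) by simp
    show "h = g \<cdot> u" if h: "h \<in> Hom C Y T \<and> h \<cdot> f = g" for h
      by (rule epi_cancel[OF f(2)]) (use h u(3) in simp_all)
  qed
  then have "is_coproduct C [f] Y"
    unfolding is_coproduct_def by (simp add: length_Suc_conv del: in_Hom)
  then show ?thesis using coprod X unfolding closed_finite_coproducts_def by fastforce
qed

lemma resolvable_Suc: "resolvable \<B> m \<subseteq> resolvable \<B> (Suc m)"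
proof (induction m)
  case 0
  obtain Z where Z: "zero_obj C Z" using zero_object by blast
  show ?case
  proof
    fix X assume "X \<in> resolvable \<B> 0"
    then have "X \<in> \<B>" "ses Z (Zero C Z X) X (Ident C X) X" using sub ses_Ident[OF Z] by auto
    then show "X \<in> resolvable \<B> (Suc 0)" using closed_zero[OF Z] by auto
  qed
next
  case (Suc m)
  then show ?case by fastforce
qed

lemma resolvable_mono: "j \<le> m \<Longrightarrow> resolvable \<B> j \<subseteq> resolvable \<B> m"
  by (rule lift_Suc_mono_le[of "resolvable \<B>"]) (rule resolvable_Suc)

text \<open>A resolution with one arrow is an isomorphism; a longer one is cut at the kernel of its
  head.\<close>

lemma resolvable_of_left_exact:
  assumes "length rs = Suc j" "left_exact rs" "epi_arr C (hd rs)" "\<forall>f \<in> set rs. Dom C f \<in> \<B>"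
  shows "Cod C (hd rs) \<in> resolvable \<B> j"
  using assms
proof (induction j arbitrary: rs)
  case 0
  then obtain f where "rs = [f]" by (auto simp: length_Suc_conv)
  then show ?case using closed_iso[of f "Dom C f" "Cod C f"] 0 epi_arrD by auto
next
  case (Suc j)
  then obtain f g rs' where rs: "rs = f # g # rs'" by (auto simp: length_Suc_conv)
  have "f \<in> Hom C (Dom C f) (Cod C f)" using Suc(4) epi_arrD rs by simp
  then obtain X k q where q: "ses X k (Dom C f) f (Cod C f)" "q \<in> Hom C (Dom C g) X" "k \<cdot> q = g"
    "epi_arr C q" "left_exact (q # rs')"
    using left_exact_unsplice[of f g rs'] Suc(3,4) rs by auto
  have "Cod C (hd (q # rs')) \<in> resolvable \<B> j" by (rule Suc(1)) (use Suc(2,5) q rs in auto)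
  then have "X \<in> resolvable \<B> j" using q(2) by simp
  then show ?case using q(1) Suc(5) rs by auto
qed

lemma left_exact_of_resolvable:
  assumes "X \<in> resolvable \<B> m"
  shows "\<exists>rs. length rs = Suc m \<and> left_exact rs \<and> epi_arr C (hd rs) \<and> Cod C (hd rs) = X \<and>
    (\<forall>f \<in> set rs. Dom C f \<in> \<B>)"
  using assms
proof (induction m arbitrary: X)
  case 0
  then have "X \<in> \<B>" "X \<in> Obj C" using sub by auto
  then show ?case using epi_Ident mono_Ident by (intro exI[of _ "[Ident C X]"]) simp
next
  case (Suc m)
  then obtain K k B p where s: "ses K k B p X" and B: "B \<in> \<B>" "K \<in> resolvable \<B> m" by auto
  note [simp] = sesD[OF s]
  obtain rs where rs: "length rs = Suc m" "left_exact rs" "epi_arr C (hd rs)" "Cod C (hd rs) = K"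
    "\<forall>f \<in> set rs. Dom C f \<in> \<B>"
    using Suc(1)[OF B(2)] by blast
  then obtain q rs' where q: "rs = q # rs'" by (auto simp: length_Suc_conv)
  have qH: "q \<in> Hom C (Dom C q) K" using rs q epi_arrD by simp
  have "left_exact (p # (k \<cdot> q) # rs')"
    by (rule left_exact_splice[OF _ _ qH s]) (use rs q in simp_all)
  moreover have "Dom C (k \<cdot> q) = Dom C q" using qH by simp
  ultimately show ?case using rs q B ses_epi[OF s] by (intro exI[of _ "p # (k \<cdot> q) # rs'"]) simp
qed

lemma resolved_eq: "resolved C \<B> m = resolvable \<B> m"
proof (intro subset_antisym subsetI)
  fix X assume "X \<in> resolved C \<B> m"
  then obtain j fs where j: "j \<le> m" "length fs = Suc j" "exact_with_zeros C fs" "Cod C (last fs) = X"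
    "\<forall>f \<in> set fs. Dom C f \<in> \<B>"
    unfolding resolved_def by blast
  then have "fs \<noteq> []" by auto
  then have "X \<in> resolvable \<B> j"
    using resolvable_of_left_exact[of "rev fs" j] exact_with_zeros_rev[of "rev fs"] j
    by (simp add: hd_rev)
  then show "X \<in> resolvable \<B> m" using resolvable_mono[OF j(1)] by blast
next
  fix X assume "X \<in> resolvable \<B> m"
  then obtain rs where rs: "length rs = Suc m" "left_exact rs" "epi_arr C (hd rs)" "Cod C (hd rs) = X"
    "\<forall>f \<in> set rs. Dom C f \<in> \<B>"
    using left_exact_of_resolvable by blast
  then have "rs \<noteq> []" by auto
  moreover have "X \<in> Obj C" using rs(3,4) epi_arrD by auto
  ultimately show "X \<in> resolved C \<B> m"
    unfolding resolved_def using rs exact_with_zeros_rev[of rs]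
    by (auto intro!: exI[of _ m] exI[of _ "rev rs"] simp: last_rev)
qed

text \<open>The horseshoe, one layer at a time. In dimension 0 the sequence splits. Otherwise
  \<gamma> lifts to E because Ext^1(B', K) vanishes, the coproduct of B and B' maps onto E, and the
  kernel is an extension of L' by L in smaller dimension. The layers meet every dimension j \<le> m,
  hence the form of the assumption.\<close>

lemma resolvable_extension:
  assumes "\<And>j B K. \<lbrakk>j \<le> m; B \<in> \<B>; K \<in> resolvable \<B> j\<rbrakk> \<Longrightarrow> erasable 1 B K"
    and "ses K i E j K'" "K \<in> resolvable \<B> m" "K' \<in> resolvable \<B> m"
  shows "E \<in> resolvable \<B> m"
  using assms
proof (induction m arbitrary: K i E j K')
  case 0
  note s = 0(2)
  note [simp] = sesD[OF s]
  have "Ident C K' \<in> Hom C K' K'" by simp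
  moreover have "erasable 1 K' K" using 0 by simp
  ultimately obtain r where r: "r \<in> Hom C K' E" "j \<cdot> r = Ident C K'"
    using erasable_1_lift[OF _ s] by blast
  show ?case using closed_pair[OF section_coproduct[OF s r]] r(1) 0(3,4) by simp
next
  case (Suc m)
  note s = Suc(3)
  obtain L a B \<alpha> where A: "ses L a B \<alpha> K" "B \<in> \<B>" "L \<in> resolvable \<B> m" using Suc(4) by auto
  obtain L' c B' \<gamma> where G: "ses L' c B' \<gamma> K'" "B' \<in> \<B>" "L' \<in> resolvable \<B> m" using Suc(5) by auto
  note [simp] = sesD[OF s] sesD[OF A(1)] sesD[OF G(1)]
  have "erasable 1 B' K" using Suc(2)[of "Suc m"] G(2) Suc(4) by simp
  moreover have "\<gamma> \<in> Hom C B' K'" by simp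
  ultimately obtain h where h: "h \<in> Hom C B' E" "j \<cdot> h = \<gamma>" using erasable_1_lift[OF _ s] by blast
  obtain P u v p q where P: "is_coproduct C [u, v] P" "ses B u P q B'" "ses B' v P p B"
    "q \<cdot> v = Ident C B'"
    by (rule ses_biproduct[of B B']) (use that in simp_all)
  note [simp] = h(1)[simplified] sesD[OF P(2)] sesD(1-9)[OF P(3)]
  obtain \<beta> where b: "\<beta> \<in> Hom C P E" "\<beta> \<cdot> u = i \<cdot> \<alpha>" "\<beta> \<cdot> v = h"
    by (rule coproductD[OF P(1), of "i \<cdot> \<alpha>" E h]) simp_all
  note [simp] = b(1)[simplified]
  have "j \<cdot> \<beta> = \<gamma> \<cdot> q"
  proof (rule coproduct_eqI[OF P(1)])
    show "(j \<cdot> \<beta>) \<cdot> u = (\<gamma> \<cdot> q) \<cdot> u"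
      using b(2) precomp[OF sesD(10)[OF s], of \<alpha>] by (simp del: sesD(10)[OF s])
    show "(j \<cdot> \<beta>) \<cdot> v = (\<gamma> \<cdot> q) \<cdot> v" using b(3) h(2) P(4) by simp
  qed simp_all
  then obtain L'' b' i' j' where "ses L'' b' P \<beta> E" "ses L i' L'' j' L'"
    using ses_kernels[OF P(2) s b(1,2) _ A(1) G(1)] by blast
  moreover from this(2) have "L'' \<in> resolvable \<B> m"
  proof (rule Suc(1)[rotated])
    show "erasable 1 B K" if "j \<le> m" "B \<in> \<B>" "K \<in> resolvable \<B> j" for j B K
      using Suc(2)[of j B K] that by simp
  qed (use A G in simp_all)
  moreover have "P \<in> \<B>" using closed_pair[OF P(1)] A(2) G(2) by simp
  ultimately show ?case by auto
qed

text \<open>Each step of the resolution trades one unit of dimension for one of degree, so i + m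
  stays constant and bounds the degrees in which vanishing on \<B> is called upon.\<close>

lemma erasable_resolvable:
  assumes "\<And>i B. \<lbrakk>1 \<le> i; i \<le> n; B \<in> \<B>\<rbrakk> \<Longrightarrow> erasable i A B" "K \<in> resolvable \<B> m" "1 \<le> i" "i + m \<le> n"
  shows "erasable i A K"
  using assms(2-4)
proof (induction m arbitrary: i K)
  case 0
  then show ?case using assms(1) by simp
next
  case (Suc m)
  then obtain L k B p where s: "ses L k B p K" and B: "B \<in> \<B>" "L \<in> resolvable \<B> m" by auto
  have "erasable i A B" "erasable (Suc i) A L" using assms(1) Suc B by simp_all
  then show ?case using erasable_shift[OF _ _ s] Suc(3) by blast
qed

lemma resolvable_Obj: "X \<in> resolvable \<B> m \<Longrightarrow> X \<in> Obj C"
  using sub sesD(9) by (cases m) auto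

end

section \<open>Special precovers as short exact sequences, and closure under extensions\<close>

lemma special_precover_ses:
  assumes "special_precover C \<A> k \<B> X f"
  obtains K \<kappa> where "ses K \<kappa> (Dom C f) f X" "Dom C f \<in> \<A>" "K \<in> resolved C \<B> (k - 1)"
proof -
  obtain \<kappa> where k: "is_kernel C \<kappa> f" "Dom C \<kappa> \<in> resolved C \<B> (k - 1)"
    using assms unfolding special_precover_def by blast
  have "ses (Dom C \<kappa>) \<kappa> (Dom C f) f X"
    using assms k(1) kernelD[OF k(1)] unfolding ses_def special_precover_def precover_def by auto
  then show ?thesis using that k(2) assms unfolding special_precover_def precover_def by blast
qed

lemma short_exact_ses:
  assumes "short_exact C f g"
  shows "ses (Dom C f) f (Cod C f) g (Cod C g)"
proof -
  have "exact_at C f g"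
    using exact_with_zeros_nth[of "[f, g]" 0] assms unfolding short_exact_def by simp
  note [simp] = exact_atD[OF this]
  show ?thesis using short_exact_iff[of f "Dom C f" "Dom C g" g "Cod C g"] assms by simp
qed

end

theorem corollary3p11:
  fixes C :: "('o, 'm, 'r) cat_scheme" and n :: nat and \<A> \<B> :: "'o set"
  assumes "abelian_category C"
    and "n \<ge> 2"
    and "left_cotorsion_pair C n \<A> \<B>"
    and "closed_finite_coproducts C \<B>"
    and "\<And>k. \<lbrakk>1 \<le> k; k \<le> max 1 (n - 1)\<rbrakk> \<Longrightarrow> Ext_vanishes C 1 \<B> (resolved C \<B> (k - 1))"
  shows "\<forall>k. 1 \<le> k \<and> k \<le> max 1 (n - 1) \<longrightarrow> closed_extensions C (Prec C k \<A> \<B>)"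
proof (intro allI impI)
  interpret abelian_category C by (rule assms(1))
  have AO: "\<A> \<subseteq> Obj C" and BO: "\<B> \<subseteq> Obj C" and summands: "closed_direct_summands C \<A>"
    and ext: "\<And>i. \<lbrakk>1 \<le> i; i \<le> n\<rbrakk> \<Longrightarrow> Ext_vanishes C i \<A> \<B>"
    and approx: "\<And>X. X \<in> Obj C \<Longrightarrow> \<exists>f g. short_exact C f g \<and> Cod C g = X \<and>
      Dom C g \<in> \<A> \<and> Dom C f \<in> resolved C \<B> (n - 1)"
    using assms(3) unfolding left_cotorsion_pair_def by blast+
  note coprod = assms(4)
  note res = resolved_eq[OF coprod BO]
  have erA: "erasable i A K" if "A \<in> \<A>" "K \<in> resolvable \<B> m" "1 \<le> i" "i + m \<le> n" for i A K m
  proof (rule erasable_resolvable[OF coprod BO _ that(2-4)])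
    show "erasable i A B" if "1 \<le> i" "i \<le> n" "B \<in> \<B>" for i B
      using Ext_vanishes_erasable[OF ext] that \<open>A \<in> \<A>\<close> AO BO by blast
  qed
  fix k assume k: "1 \<le> k \<and> k \<le> max 1 (n - 1)"
  \<comment> \<open>As n \<ge> 2, the maximum of 1 and n - 1 is n - 1.\<close>
  have kn: "k + 1 \<le> n" using k assms(2) by auto
  \<comment> \<open>The hypothesis with index k speaks of dimension k - 1, so dimension j calls for
    the index \<open>Suc j\<close>.\<close>
  have erB: "erasable 1 B K" if "j \<le> k - 1" "B \<in> \<B>" "K \<in> resolvable \<B> j" for j B K
    using Ext_vanishes_erasable[OF assms(5)[of "Suc j"]] that k res resolvable_Obj[OF coprod BO] BO
    by auto
  show "closed_extensions C (Prec C k \<A> \<B>)"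
    unfolding closed_extensions_def
  proof (intro allI impI, elim conjE)
    fix x y assume "short_exact C x y" and X: "Dom C x \<in> Prec C k \<A> \<B>" and Z: "Cod C y \<in> Prec C k \<A> \<B>"
    then have xy: "ses (Dom C x) x (Cod C x) y (Cod C y)" using short_exact_ses by blast
    obtain \<alpha> K a where \<alpha>: "ses K a (Dom C \<alpha>) \<alpha> (Dom C x)" "Dom C \<alpha> \<in> \<A>" "K \<in> resolvable \<B> (k - 1)"
      using X special_precover_ses unfolding Prec_def res[symmetric] by blast
    obtain \<gamma> K' c where \<gamma>: "ses K' c (Dom C \<gamma>) \<gamma> (Cod C y)" "Dom C \<gamma> \<in> \<A>" "K' \<in> resolvable \<B> (k - 1)"
      using Z special_precover_ses unfolding Prec_def res[symmetric] by blast
    have gH: "\<gamma> \<in> Hom C (Dom C \<gamma>) (Cod C y)" using sesD[OF \<gamma>(1)] by simp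
    \<comment> \<open>Degree 2 and dimension k - 1 add up to k + 1, which \<open>kn\<close> keeps in
      range.\<close>
    have er2: "erasable 2 (Dom C \<gamma>) K" using erA[OF \<gamma>(2) \<alpha>(3)] kn k by simp
    obtain E i j \<beta> where E: "ses (Dom C \<alpha>) i E j (Dom C \<gamma>)"
      and \<beta>: "\<beta> \<in> Hom C E (Cod C x)" "\<beta> \<cdot>\<^bsub>C\<^esub> i = x \<cdot>\<^bsub>C\<^esub> \<alpha>" "y \<cdot>\<^bsub>C\<^esub> \<beta> = \<gamma> \<cdot>\<^bsub>C\<^esub> j"
      using erasable_2_lift[OF er2 \<alpha>(1) xy gH] .
    \<comment> \<open>Closure of \<A> under extensions is not among the hypotheses, only closure
      under summands. So E is compared with its own approximation, whose kernel has dimension at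
      most n - 1; degree 1 then uses the full range 1 + (n - 1) = n.\<close>
    have EA: "E \<in> \<A>"
    proof -
      obtain l q where lq: "short_exact C l q" "Cod C q = E" "Dom C q \<in> \<A>" "Dom C l \<in> resolvable \<B> (n - 1)"
        using approx[OF sesD(8)[OF E]] unfolding res by blast
      have s: "ses (Dom C l) l (Cod C l) q E" using short_exact_ses[OF lq(1)] lq(2) by simp
      have "erasable 1 (Dom C \<alpha>) (Dom C l)" "erasable 1 (Dom C \<gamma>) (Dom C l)"
        using erA[OF _ lq(4)] \<alpha>(2) \<gamma>(2) assms(2) by simp_all
      then obtain r where r: "r \<in> Hom C E (Cod C l)" "q \<cdot>\<^bsub>C\<^esub> r = Ident C E"
        using extension_section[OF E s] by blast
      have "Cod C l \<in> \<A>" using lq(3) sesD[OF s] by simp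
      then have "Dom C r \<in> \<A>"
        using section_coproduct[OF s r] summands unfolding closed_direct_summands_def by blast
      then show ?thesis using r(1) by simp
    qed
    obtain K'' b i' j' where K'': "ses K'' b E \<beta> (Cod C x)" "ses K i' K'' j' K'"
      using ses_kernels[OF E xy \<beta> \<alpha>(1) \<gamma>(1)] .
    have K''res: "K'' \<in> resolvable \<B> (k - 1)"
      by (rule resolvable_extension[OF coprod BO erB K''(2) \<alpha>(3) \<gamma>(3)])
    note b = sesD[OF K''(1)]
    \<comment> \<open>The kernel of \<beta> again has dimension at most k - 1, so Ext^1 from \<A>
      vanishes on it and every arrow from \<A> lifts.\<close>
    have lift: "\<exists>h \<in> Hom C A' (Dom C \<beta>). \<beta> \<cdot>\<^bsub>C\<^esub> h = g" if A': "A' \<in> \<A>" and g: "g \<in> Hom C A' (Cod C x)" for A' g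
    proof -
      have er1: "erasable 1 A' K''" using erA[OF A' K''res] kn k by simp
      obtain h where "h \<in> Hom C A' E" "\<beta> \<cdot>\<^bsub>C\<^esub> h = g" using erasable_1_lift[OF er1 K''(1) g] .
      then show ?thesis using b(5) by blast
    qed
    have "precover C \<A> (Cod C x) \<beta>"
      unfolding precover_def by (intro conjI ballI lift) (use b EA in \<open>simp_all del: in_Hom\<close>)
    moreover have "is_kernel C b \<beta>" "Dom C b \<in> resolved C \<B> (k - 1)"
      using ses_kernel[OF K''(1)] K''res b(2) res by simp_all
    ultimately have "special_precover C \<A> k \<B> (Cod C x) \<beta>"
      unfolding special_precover_def using ses_epi[OF K''(1)] by blast
    then show "Cod C x \<in> Prec C k \<A> \<B>" unfolding Prec_def using sesD(8)[OF xy] by blast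
  qed
qed

end
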